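(* The algorithm $\mathcal{A}$ described in the context checks in time $O(m^2n)=O(n^5)$ whether a given signed bipartite graph $(B,\Pi)$ of unbalanced-girth $2k$ on $n$ vertices and $m$ edges bounds the class of all signed bipartite graphs of unbalanced-girth at least $2k$ whose underlying graph is $K_4$-minor-free, that is, whether every signed graph in this class admits a homomorphism to $(B,\Pi)$.
   Context: All graphs are finite and simple. A signed graph $(G,\Sigma)$ is a graph $G$ with a set $\Sigma\subseteq E(G)$ of negative edges; the other edges are positive. It is a signed bipartite graph if $G$ is bipartite. A closed walk, path or cycle is balanced if the product of the signs of its edges, counted with repetition, is $+$, and unbalanced otherwise. The unbalanced-girth of $(G,\Sigma)$ is the length of a shortest unbalanced cycle, and $\infty$ if there is none. A homomorphism of $(G,\Sigma)$ to $(H,\Pi)$ is a map $\varphi:V(G)\to V(H)$ such that the image of each closed walk of $(G,\Sigma)$ is a closed walk of $(H,\Pi)$ with the same balance (in particular, $\varphi$ sends edges to edges). Algebraic distance: for vertices $u,v$ of a signed graph $(G,\Sigma)$, with $d_G$ the usual graph distance, $ad_{(G,\Sigma)}(u,v)=d_G(u,v)$ if there is a balanced $u$–$v$ path of length $d_G(u,v)$, and $ad_{(G,\Sigma)}(u,v)=-d_G(u,v)$ otherwise. The complete signed distance graph of $(B,\Pi)$ is the complete graph on $V(B)$ in which each edge $xy$ has weight $ad_{(B,\Pi)}(x,y)$, also written $ad_{(B,\Pi)}(xy)$. A $k$-partial signed distance graph of $(B,\Pi)$ is a spanning subgraph of it all of whose edges have weight of absolute value at most $k$. $k$-good triples: let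 $p,q,r$ be non-zero integers of absolute value at most $k$ with $p+q+r$ even. $T_{2k}(p,q,r)$ is the signed bipartite graph built from three vertices $u,v,w$ by joining $u$ and $v$ by two paths of lengths $|p|$ and $2k-|p|$, $u$ and $w$ by two paths of lengths $|q|$ and $2k-|q|$, and $v$ and $w$ by two paths of lengths $|r|$ and $2k-|r|$ (all six paths internally disjoint). For each of $p,q,r$ (call it $s$) and the corresponding pair of paths, exactly one edge is negative: it lies on the path of length $|s|$ if $s<0$, and on the path of length $2k-|s|$ if $s>0$. The triple $(p,q,r)$ is $k$-good if $T_{2k}(p,q,r)$ has unbalanced-girth $2k$. All $k$-good property: let $(G,w)$ be a graph with non-zero integer edge weights of absolute value at most $k$, such that for some partition $\{X,Y\}$ of $V(G)$ the edges between $X$ and $Y$ have odd weight and the edges inside $X$ or inside $Y$ have even weight. $(G,w)$ has the all $k$-good property if for any edge $uv$ of weight $p$ and any integers $q,r$ such that $(p,q,r)$ is a $k$-good triple, there is a vertex $z$ such that $uz,vz$ are edges of $G$ with either $w(uz)=q$ and $w(vz)=r$, or $w(uz)=-q$ and $w(vz)=-r$. Algorithm $\mathcal{A}$. Input: an integer $k$ and a signed bipartite graph $(B,\Pi)$ of unbalanced-girth $2k$. Step 1. Compute the set $\mathcal{T}_k$ of $k$-good triples. Step 2. Compute the algebraic distance function $ad_{(B,\Pi)}$. Step 3. Let $(\widetilde{B},ad_{(B,\Pi)})$ be the $k$-partial signed distance graph obtained from the complete signed distance graph of $(B,\Pi)$ by removing all edges of weight more than $k$ or less than $-k$. Step 4.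 If $E(\widetilde{B})=\emptyset$, return NO. Step 5. For each edge $e=xy$ in $E(\widetilde{B})$: let $p=ad_{(B,\Pi)}(xy)$; for each $k$-good triple $\{p,q,r\}\in\mathcal{T}_k$ containing $p$: if there is no pair $z,z'$ of vertices of $V(B)$ with either $ad_{(B,\Pi)}(xz)=ad_{(B,\Pi)}(yz')=q$ and $ad_{(B,\Pi)}(yz)=ad_{(B,\Pi)}(xz')=r$, or $ad_{(B,\Pi)}(xz)=ad_{(B,\Pi)}(yz')=-q$ and $ad_{(B,\Pi)}(yz)=ad_{(B,\Pi)}(xz')=-r$ (the edge $e$ fails for the all $k$-good property), then replace $\widetilde{B}$ by $\widetilde{B}-xy$ and go to Step 4 (restart the loop). Step 6. Return YES ($\widetilde{B}$ is a certificate).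
   Formalization: In Step 5 weights are compared modulo 2k (k and -k identified), the witnesses z, z' must be joined to x and y by edges of the current B~, and the sign is chosen separately for z and z'; as literally written the algorithm answers wrongly for some (B,Π). *)

theory Defs
  imports
    "HOL-Library.Extended_Nat"
    "HOL-Library.Monad_Syntax"
    "HOL-Number_Theory.Cong"
begin

section \<open>Signed graphs\<close>

record 'a sgraph =
  verts :: "'a set"
  edges :: "'a set set"
  negs :: "'a set set"

definition signed_graph :: "'a sgraph \<Rightarrow> bool" where
  "signed_graph G \<longleftrightarrow>
     finite (verts G) \<and>
     edges G \<subseteq> {{x, y} | x y. x \<in> verts G \<and> y \<in> verts G \<and> x \<noteq> y} \<and>
     negs G \<subseteq> edges G"

definition signed_bipartite :: "'a sgraph \<Rightarrow> bool" where
  "signed_bipartite G \<longleftrightarrow>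
     signed_graph G \<and>
     (\<exists>X Y. X \<union> Y = verts G \<and> X \<inter> Y = {} \<and> (\<forall>e\<in>edges G. \<exists>x\<in>X. \<exists>y\<in>Y. e = {x, y}))"

text \<open>A walk is the nonempty list of the vertices it visits.\<close>

definition walk_edges :: "'a list \<Rightarrow> 'a set list" where
  "walk_edges c = map (\<lambda>(x, y). {x, y}) (zip c (tl c))"

definition walk :: "'a sgraph \<Rightarrow> 'a list \<Rightarrow> bool" where
  "walk G c \<longleftrightarrow> c \<noteq> [] \<and> set c \<subseteq> verts G \<and> set (walk_edges c) \<subseteq> edges G"

definition walk_length :: "'a list \<Rightarrow> nat" where
  "walk_length c = length (walk_edges c)"

definition balanced :: "'a sgraph \<Rightarrow> 'a list \<Rightarrow> bool" where
  "balanced G c \<longleftrightarrow> even (length (filter (\<lambda>e. e \<in> negs G) (walk_edges c)))"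

definition closed_walk :: "'a sgraph \<Rightarrow> 'a list \<Rightarrow> bool" where
  "closed_walk G c \<longleftrightarrow> walk G c \<and> hd c = last c"

definition cycle :: "'a sgraph \<Rightarrow> 'a list \<Rightarrow> bool" where
  "cycle G c \<longleftrightarrow> closed_walk G c \<and> 3 \<le> walk_length c \<and> distinct (tl c)"

definition path :: "'a sgraph \<Rightarrow> 'a \<Rightarrow> 'a \<Rightarrow> 'a list \<Rightarrow> bool" where
  "path G x y c \<longleftrightarrow> walk G c \<and> distinct c \<and> hd c = x \<and> last c = y"

text \<open>The infimum of the empty set is \<open>\<infinity>\<close> in \<open>enat\<close>.\<close>

definition unbalanced_girth :: "'a sgraph \<Rightarrow> enat" where
  "unbalanced_girth G = (INF c\<in>{c. cycle G c \<and> \<not> balanced G c}. enat (walk_length c))"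

definition sg_hom :: "'a sgraph \<Rightarrow> 'b sgraph \<Rightarrow> ('a \<Rightarrow> 'b) \<Rightarrow> bool" where
  "sg_hom G H \<phi> \<longleftrightarrow>
     \<phi> ` verts G \<subseteq> verts H \<and>
     (\<forall>c. closed_walk G c \<longrightarrow>
        closed_walk H (map \<phi> c) \<and> balanced H (map \<phi> c) = balanced G c)"

text \<open>\<open>K4\<close> is a minor of the underlying graph iff there are four pairwise disjoint nonempty
  connected branch sets with an edge between any two of them.\<close>

definition connected_in :: "'a sgraph \<Rightarrow> 'a set \<Rightarrow> bool" where
  "connected_in G S \<longleftrightarrow> (\<forall>x\<in>S. \<forall>y\<in>S. \<exists>c. path G x y c \<and> set c \<subseteq> S)"

definition K4_minor_free :: "'a sgraph \<Rightarrow> bool" where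
  "K4_minor_free G \<longleftrightarrow>
     \<not> (\<exists>S :: nat \<Rightarrow> 'a set.
          (\<forall>i<4. S i \<noteq> {} \<and> S i \<subseteq> verts G \<and> connected_in G (S i)) \<and>
          (\<forall>i<4. \<forall>j<4. i \<noteq> j \<longrightarrow>
             S i \<inter> S j = {} \<and> (\<exists>x\<in>S i. \<exists>y\<in>S j. {x, y} \<in> edges G)))"

text \<open>Every finite graph is isomorphic to one whose vertices are natural numbers.\<close>

definition bounds :: "nat \<Rightarrow> 'b sgraph \<Rightarrow> bool" where
  "bounds k B \<longleftrightarrow>
     (\<forall>G :: nat sgraph.
        signed_bipartite G \<and> enat (2 * k) \<le> unbalanced_girth G \<and> K4_minor_free G \<longrightarrow>
        (\<exists>\<phi>. sg_hom G B \<phi>))"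

section \<open>Algebraic distance and partial signed distance graphs\<close>

definition gdist :: "'a sgraph \<Rightarrow> 'a \<Rightarrow> 'a \<Rightarrow> enat" where
  "gdist G x y = (INF c\<in>{c. path G x y c}. enat (walk_length c))"

text \<open>Only meaningful for vertices at finite distance.\<close>

definition ad :: "'a sgraph \<Rightarrow> 'a \<Rightarrow> 'a \<Rightarrow> int" where
  "ad G x y =
     (if \<exists>c. path G x y c \<and> enat (walk_length c) = gdist G x y \<and> balanced G c
      then int (the_enat (gdist G x y)) else - int (the_enat (gdist G x y)))"

text \<open>The edges that remain after Step 3.  Two vertices in different components are at infinite
  distance, so the edge between them is removed.\<close>

definition sdg_edges :: "nat \<Rightarrow> 'a sgraph \<Rightarrow> 'a set set" where
  "sdg_edges k B =
     {{x, y} | x y. x \<in> verts B \<and> y \<in> verts B \<and> x \<noteq> y \<and>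
                    gdist B x y \<noteq> \<infinity> \<and> \<bar>ad B x y\<bar> \<le> int k}"

section \<open>k-good triples\<close>

text \<open>\<open>Corner 0, 1, 2\<close> are \<open>u, v, w\<close>.  Pair \<open>i\<close> of paths joins \<open>fst (arc_ends i)\<close> to
  \<open>snd (arc_ends i)\<close>; its path \<open>False\<close> has length \<open>|s|\<close>, its path \<open>True\<close> has length \<open>2k - |s|\<close>.
  The single negative edge of a pair is placed first on its path.\<close>

datatype tvert = Corner nat | Inner nat bool nat

definition arc_ends :: "nat \<Rightarrow> nat \<times> nat" where
  "arc_ends i = (if i = 0 then (0, 1) else if i = 1 then (0, 2) else (1, 2))"

definition arc_length :: "nat \<Rightarrow> int \<Rightarrow> bool \<Rightarrow> nat" where
  "arc_length k s long = (if long then 2 * k - nat \<bar>s\<bar> else nat \<bar>s\<bar>)"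

definition arc_vertex :: "nat \<Rightarrow> int \<Rightarrow> nat \<Rightarrow> bool \<Rightarrow> nat \<Rightarrow> tvert" where
  "arc_vertex k s i long j =
     (if j = 0 then Corner (fst (arc_ends i))
      else if j = arc_length k s long then Corner (snd (arc_ends i))
      else Inner i long j)"

definition arc_edge :: "nat \<Rightarrow> int \<Rightarrow> nat \<Rightarrow> bool \<Rightarrow> nat \<Rightarrow> tvert set" where
  "arc_edge k s i long j = {arc_vertex k s i long j, arc_vertex k s i long (Suc j)}"

definition T_graph :: "nat \<Rightarrow> int \<Rightarrow> int \<Rightarrow> int \<Rightarrow> tvert sgraph" where
  "T_graph k p q r =
     (let s = (\<lambda>i::nat. if i = 0 then p else if i = 1 then q else r) in
      \<lparr> verts = {arc_vertex k (s i) i b j | i b j. i < 3 \<and> j \<le> arc_length k (s i) b},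
        edges = {arc_edge k (s i) i b j | i b j. i < 3 \<and> j < arc_length k (s i) b},
        negs = {arc_edge k (s i) i (s i > 0) 0 | i. i < 3} \<rparr>)"

definition k_good :: "nat \<Rightarrow> int \<Rightarrow> int \<Rightarrow> int \<Rightarrow> bool" where
  "k_good k p q r \<longleftrightarrow>
     p \<noteq> 0 \<and> q \<noteq> 0 \<and> r \<noteq> 0 \<and> \<bar>p\<bar> \<le> int k \<and> \<bar>q\<bar> \<le> int k \<and> \<bar>r\<bar> \<le> int k \<and>
     even (p + q + r) \<and> unbalanced_girth (T_graph k p q r) = enat (2 * k)"

section \<open>The algorithm\<close>

text \<open>Weights between \<open>-k\<close> and \<open>k\<close> are compared modulo \<open>2k\<close>.  This identifies \<open>k\<close> with \<open>-k\<close> and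
  nothing else: a pair of paths of lengths \<open>k\<close> and \<open>2k - k\<close>, exactly one of them negative, is the
  same for both weights, so a triple with an entry \<open>k\<close> and the one with \<open>-k\<close> instead describe the
  same signed graph, and \<open>ad\<close> is \<open>k\<close> on every such pair.  If the two were told apart, Step 5 would
  discard edges that are needed, and the answer NO would be wrong for some \<open>B\<close> for every \<open>k\<close>.\<close>

definition witnessed ::
    "nat \<Rightarrow> 'a set set \<Rightarrow> ('a \<Rightarrow> 'a \<Rightarrow> int) \<Rightarrow> 'a \<Rightarrow> 'a \<Rightarrow> int \<Rightarrow> int \<Rightarrow> bool" where
  "witnessed k E w x y q r \<longleftrightarrow>
     (\<exists>z. {x, z} \<in> E \<and> {y, z} \<in> E \<and>
        ([w x z = q] (mod 2 * int k) \<and> [w y z = r] (mod 2 * int k) \<or>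
         [w x z = - q] (mod 2 * int k) \<and> [w y z = - r] (mod 2 * int k)))"

text \<open>The edge \<open>e\<close> fails for the all k-good property of the current graph \<open>(E, w)\<close>: the witnesses
  have to be joined to the ends of \<open>e\<close> by edges of \<open>E\<close>, and the common sign is chosen for each
  witness separately.\<close>

definition fails_all_k_good ::
    "nat \<Rightarrow> 'a set set \<Rightarrow> ('a \<Rightarrow> 'a \<Rightarrow> int) \<Rightarrow> 'a set \<Rightarrow> bool" where
  "fails_all_k_good k E w e \<longleftrightarrow>
     (\<exists>x y q r. e = {x, y} \<and> k_good k (w x y) q r \<and>
        \<not> (witnessed k E w x y q r \<and> witnessed k E w x y r q))"

text \<open>Steps 4 to 6 started with the edge set \<open>E\<close>, removing the listed edges in this order; any
  failing edge may be the one that is found.  The outcome is \<open>None\<close> for NO and the certificate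
  for YES.\<close>

inductive run_from ::
    "nat \<Rightarrow> 'a sgraph \<Rightarrow> 'a set set \<Rightarrow> 'a set list \<Rightarrow> 'a set set option \<Rightarrow> bool"
  for k :: nat and B :: "'a sgraph" where
  answer_no: "E = {} \<Longrightarrow> run_from k B E [] None"
| restart: "e \<in> E \<Longrightarrow> fails_all_k_good k E (ad B) e \<Longrightarrow> run_from k B (E - {e}) es out
             \<Longrightarrow> run_from k B E (e # es) out"
| answer_yes: "E \<noteq> {} \<Longrightarrow> \<forall>e\<in>E. \<not> fails_all_k_good k E (ad B) e \<Longrightarrow> run_from k B E [] (Some E)"

definition algorithm_run ::
    "nat \<Rightarrow> 'a sgraph \<Rightarrow> 'a set list \<Rightarrow> 'a set set option \<Rightarrow> bool" where
  "algorithm_run k B es out \<longleftrightarrow> run_from k B (sdg_edges k B) es out"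

section \<open>A unit-cost implementation\<close>

text \<open>A computation is a result together with a number of time units on a random access machine
  with unit cost.  \<open>ret\<close> is one time unit; it always stands for a bounded number of
  arithmetic operations and reads and writes of single table entries and list heads.  Tables are
  functions, used in such a way that they can be updated in place; a constant function is untouched
  memory.\<close>

datatype 'a tm = TM (val: 'a) (time: nat)

definition ret :: "'a \<Rightarrow> 'a tm" where
  "ret x = TM x 1"

definition bind_tm :: "'a tm \<Rightarrow> ('a \<Rightarrow> 'b tm) \<Rightarrow> 'b tm" where
  "bind_tm m f = (case f (val m) of TM y t \<Rightarrow> TM y (time m + t))"

adhoc_overloading bind \<rightleftharpoons> bind_tm

fun for_each :: "'a list \<Rightarrow> ('a \<Rightarrow> 's \<Rightarrow> 's tm) \<Rightarrow> 's \<Rightarrow> 's tm" where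
  "for_each [] f s = ret s"
| "for_each (x # xs) f s = do { s' \<leftarrow> f x s; for_each xs f s' }"

fun all_tm :: "('a \<Rightarrow> bool) \<Rightarrow> 'a list \<Rightarrow> bool tm" where
  "all_tm P [] = ret True"
| "all_tm P (x # xs) = do { b \<leftarrow> ret (P x); if b then all_tm P xs else ret False }"

subsection \<open>Step 1\<close>

text \<open>An unbalanced cycle of \<open>T_graph k p q r\<close> is one of the three pairs of paths, of length \<open>2k\<close>,
  or consists of one path of each pair.\<close>

definition arcs :: "nat \<Rightarrow> int \<Rightarrow> (int \<times> bool) list" where
  "arcs k s = [(\<bar>s\<bar>, s < 0), (2 * int k - \<bar>s\<bar>, s > 0)]"

definition good_test :: "nat \<Rightarrow> int \<Rightarrow> int \<Rightarrow> int \<Rightarrow> bool" where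
  "good_test k p q r \<longleftrightarrow>
     even (p + q + r) \<and>
     (\<forall>(a, na)\<in>set (arcs k p). \<forall>(b, nb)\<in>set (arcs k q). \<forall>(c, nc)\<in>set (arcs k r).
        (na \<noteq> (nb \<noteq> nc)) \<longrightarrow> 2 * int k \<le> a + b + c)"

type_synonym key = "int \<times> int"

definition key :: "nat \<Rightarrow> int \<Rightarrow> int \<Rightarrow> key" where
  "key k q r = (q mod (2 * int k), r mod (2 * int k))"

definition weights :: "nat \<Rightarrow> int list" where
  "weights k = [- int k .. -1] @ [1 .. int k]"

text \<open>For each \<open>p\<close> the list of all \<open>(q, r)\<close> such that \<open>(p, q, r)\<close> is k-good, and a table of their
  residues.\<close>

type_synonym good_lists = "int \<Rightarrow> (int \<times> int) list"
type_synonym good_table = "int \<times> key \<Rightarrow> bool"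

definition good_triples :: "nat \<Rightarrow> (good_lists \<times> good_table) tm" where
  "good_triples k =
     for_each (weights k) (\<lambda>p. for_each (weights k) (\<lambda>q. for_each (weights k) (\<lambda>r (T, R).
       ret (if good_test k p q r
            then (T(p := (q, r) # T p), R((p, key k q r) := True))
            else (T, R)))))
     (\<lambda>_. [], \<lambda>_. False)"

subsection \<open>Step 2\<close>

text \<open>The graph is given by its number of vertices and the list of its edges; the flag marks the
  negative ones.\<close>

type_synonym edge_list = "(nat \<times> nat \<times> bool) list"

definition is_edge_list :: "nat sgraph \<Rightarrow> edge_list \<Rightarrow> bool" where
  "is_edge_list B es \<longleftrightarrow>
     length es = card (edges B) \<and>
     edges B = (\<lambda>(a, b, neg). {a, b}) ` set es \<and>
     (\<forall>(a, b, neg)\<in>set es. neg \<longleftrightarrow> {a, b} \<in> negs B)"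

definition non_isolated :: "nat \<Rightarrow> edge_list \<Rightarrow> nat list tm" where
  "non_isolated n es = do {
     t \<leftarrow> for_each es (\<lambda>(a, b, neg) t. ret (t(a := True, b := True))) (\<lambda>_. False);
     for_each [0..<n] (\<lambda>x vs. ret (if t x then x # vs else vs)) []
   }"

text \<open>\<open>L (x, neg)\<close> is the length of a shortest walk of sign \<open>neg\<close> from the source to \<open>x\<close> found so
  far.\<close>

type_synonym walk_table = "nat \<times> bool \<Rightarrow> enat"

definition extend :: "nat \<Rightarrow> nat \<Rightarrow> bool \<Rightarrow> bool \<Rightarrow> walk_table \<Rightarrow> walk_table" where
  "extend a b neg s L = L((b, s \<noteq> neg) := min (L (b, s \<noteq> neg)) (L (a, s) + 1))"

definition relax :: "nat \<times> nat \<times> bool \<Rightarrow> walk_table \<Rightarrow> walk_table" where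
  "relax e L = (case e of (a, b, neg) \<Rightarrow>
     extend b a neg True (extend b a neg False (extend a b neg True (extend a b neg False L))))"

definition walk_lengths :: "edge_list \<Rightarrow> nat \<Rightarrow> walk_table tm" where
  "walk_lengths es x =
     for_each es (\<lambda>_. for_each es (\<lambda>e L. ret (relax e L))) ((\<lambda>_. \<infinity>)((x, False) := 0))"

definition ad_entry :: "walk_table \<Rightarrow> nat \<Rightarrow> int option" where
  "ad_entry L y =
     (if L (y, False) = \<infinity> \<and> L (y, True) = \<infinity> then None
      else if L (y, False) \<le> L (y, True) then Some (int (the_enat (L (y, False))))
      else Some (- int (the_enat (L (y, True)))))"

type_synonym weight_table = "nat \<times> nat \<Rightarrow> int option"

definition ad_table :: "nat list \<Rightarrow> edge_list \<Rightarrow> weight_table tm" where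
  "ad_table vs es =
     for_each vs (\<lambda>x A. do {
       L \<leftarrow> walk_lengths es x;
       for_each vs (\<lambda>y A. ret (A((x, y) := ad_entry L y))) A
     }) (\<lambda>_. None)"

subsection \<open>Step 3\<close>

text \<open>The current graph is the table \<open>W\<close> of the weights of its edges; \<open>F\<close> lists the edges it has
  initially.\<close>

definition partial_graph ::
    "nat \<Rightarrow> nat list \<Rightarrow> weight_table \<Rightarrow> ((nat \<times> nat) list \<times> weight_table) tm" where
  "partial_graph k vs A =
     for_each vs (\<lambda>x. for_each vs (\<lambda>y (F, W). ret (case A (x, y) of
         None \<Rightarrow> (F, W)
       | Some p \<Rightarrow> if x \<noteq> y \<and> \<bar>p\<bar> \<le> int k
                  then (if x < y then (x, y) # F else F, W((x, y) := Some p))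
                  else (F, W))))
     ([], \<lambda>_. None)"

subsection \<open>Steps 4 to 6\<close>

text \<open>After each removal the loop over the edges is restarted with an edge that fails, as long as there
  is one; such an edge is known without another pass through all edges, because the witnesses are
  counted.\<close>

text \<open>For \<open>x < y\<close> the counter at \<open>((x, y), key k q r)\<close> tells for how many \<open>z\<close> the edges \<open>xz\<close> and
  \<open>yz\<close> have weights \<open>(q, r)\<close> or \<open>(-q, -r)\<close>, modulo \<open>2k\<close>; \<open>z\<close> counts twice if it has both.\<close>

type_synonym counters = "(nat \<times> nat) \<times> key \<Rightarrow> nat"

definition count_up :: "nat \<Rightarrow> nat \<times> nat \<Rightarrow> int \<Rightarrow> int \<Rightarrow> counters \<Rightarrow> counters" where
  "count_up k e q r c =
     (let c' = c((e, key k q r) := c (e, key k q r) + 1)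
      in c'((e, key k (- q) (- r)) := c' (e, key k (- q) (- r)) + 1))"

definition count_down :: "nat \<Rightarrow> nat \<times> nat \<Rightarrow> int \<Rightarrow> int \<Rightarrow> counters \<Rightarrow> counters" where
  "count_down k e q r c =
     (let c' = c((e, key k q r) := c (e, key k q r) - 1)
      in c'((e, key k (- q) (- r)) := c' (e, key k (- q) (- r)) - 1))"

definition count_witnesses ::
    "nat \<Rightarrow> nat list \<Rightarrow> (nat \<times> nat) list \<Rightarrow> weight_table \<Rightarrow> counters tm" where
  "count_witnesses k vs F W =
     for_each F (\<lambda>(x, y). for_each vs (\<lambda>z c. ret (case (W (x, z), W (y, z)) of
         (Some q, Some r) \<Rightarrow> count_up k (x, y) q r c
       | _ \<Rightarrow> c)))
     (\<lambda>_. 0)"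

definition failing_edges ::
    "nat \<Rightarrow> good_lists \<Rightarrow> (nat \<times> nat) list \<Rightarrow> weight_table \<Rightarrow> counters \<Rightarrow> (nat \<times> nat) list tm" where
  "failing_edges k T F W c =
     for_each F (\<lambda>e Q. do {
       ok \<leftarrow> all_tm (\<lambda>(q, r). c (e, key k q r) > 0 \<and> c (e, key k r q) > 0) (T (the (W e)));
       ret (if ok then Q else e # Q)
     }) []"

text \<open>The edge \<open>xy\<close> loses a witness with weights \<open>(q, r)\<close>; it is added to the failing edges if it
  needs one and none is left.\<close>

definition lose_witness ::
    "nat \<Rightarrow> good_table \<Rightarrow> weight_table \<Rightarrow> nat \<Rightarrow> nat \<Rightarrow> int \<Rightarrow> int
       \<Rightarrow> counters \<times> (nat \<times> nat) list \<Rightarrow> counters \<times> (nat \<times> nat) list" where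
  "lose_witness k R W x y q r cQ =
     (case cQ of (c, Q) \<Rightarrow>
       let (e, q', r') = (if x < y then ((x, y), q, r) else ((y, x), r, q));
           c' = count_down k e q' r' c
       in (c', if R (the (W e), key k q' r') \<and> c' (e, key k q' r') = 0 then e # Q else Q))"

text \<open>Here \<open>W\<close> is the table after the removal of the edge \<open>xy\<close>, of weight \<open>p\<close>.\<close>

definition remove_edge ::
    "nat \<Rightarrow> good_table \<Rightarrow> nat list \<Rightarrow> weight_table \<Rightarrow> nat \<Rightarrow> nat \<Rightarrow> int
       \<Rightarrow> counters \<times> (nat \<times> nat) list \<Rightarrow> (counters \<times> (nat \<times> nat) list) tm" where
  "remove_edge k R vs W x y p =
     for_each vs (\<lambda>z cQ. ret (case (W (x, z), W (y, z)) of
         (Some q, Some r) \<Rightarrow> lose_witness k R W y z p q (lose_witness k R W x z p r cQ)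
       | _ \<Rightarrow> cQ))"

text \<open>The arguments are the number of edges left, a list of failing edges which contains all those
  that have not been removed yet, the current graph, the counters, and the removed edges in
  reverse order.\<close>

fun main_loop ::
    "nat \<Rightarrow> good_table \<Rightarrow> nat list \<Rightarrow> nat \<Rightarrow> (nat \<times> nat) list \<Rightarrow> weight_table \<Rightarrow> counters
       \<Rightarrow> (nat \<times> nat) list \<Rightarrow> ((nat \<times> nat) list \<times> weight_table option) tm" where
  "main_loop k R vs 0 Q W c D = ret (D, None)"
| "main_loop k R vs (Suc m) [] W c D = ret (D, Some W)"
| "main_loop k R vs (Suc m) ((x, y) # Q) W c D = do {
     w \<leftarrow> ret (W (x, y));
     case w of
       None \<Rightarrow> main_loop k R vs (Suc m) Q W c D
     | Some p \<Rightarrow> do {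
         W' \<leftarrow> ret (W((x, y) := None, (y, x) := None));
         (c', Q') \<leftarrow> remove_edge k R vs W' x y p (c, Q);
         main_loop k R vs m Q' W' c' ((x, y) # D)
       }
   }"

definition algorithm ::
    "nat \<Rightarrow> nat \<Rightarrow> edge_list \<Rightarrow> ((nat \<times> nat) list \<times> weight_table option) tm" where
  "algorithm k n es = do {
     (T, R) \<leftarrow> good_triples k;
     vs \<leftarrow> non_isolated n es;
     A \<leftarrow> ad_table vs es;
     (F, W) \<leftarrow> partial_graph k vs A;
     m \<leftarrow> for_each F (\<lambda>_ m. ret (Suc m)) 0;
     c \<leftarrow> count_witnesses k vs F W;
     Q \<leftarrow> failing_edges k T F W c;
     main_loop k R vs m Q W c []
   }"

definition removed_edges :: "(nat \<times> nat) list \<times> weight_table option \<Rightarrow> nat set list" where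
  "removed_edges res = rev (map (\<lambda>(x, y). {x, y}) (fst res))"

definition outcome :: "(nat \<times> nat) list \<times> weight_table option \<Rightarrow> nat set set option" where
  "outcome res = map_option (\<lambda>W. {{x, y} | x y. W (x, y) \<noteq> None}) (snd res)"

end

theory Submission
  imports Defs
begin

text \<open>A weight \<open>p\<close> is recorded by its residue \<open>a = p mod 2k\<close>, so that \<open>0 < a < 2k\<close>.  This is the length of
  the positive path in a pair of paths of \<open>T_graph\<close> belonging to \<open>p\<close>, and \<open>2k - a\<close> is the length of the
  negative one; the weights \<open>k\<close> and \<open>-k\<close> become equal, and switching at one end of the pair replaces
  \<open>a\<close> by \<open>2k - a\<close>.  In these terms the k-good triples are the triples of residues with even sum that
  satisfy the three triangle inequalities and have sum at most \<open>4k\<close> (\<open>k_good_iff\<close>).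

  The answer YES is right (\<open>stable_bounds\<close>).  Let \<open>S\<close> be the edges that remain, let \<open>G\<close> be
  \<open>K4\<close>-minor-free, bipartite and of unbalanced-girth at least \<open>2k\<close>, and give the edges of \<open>G\<close> the
  residues \<open>1\<close> and \<open>2k - 1\<close>.  A \<open>K4\<close>-minor-free graph has a vertex \<open>z\<close> of degree at most two
  (\<open>K4_minor_of_min_degree_3\<close>).  If its neighbours are \<open>u\<close> and \<open>v\<close>, an edge \<open>uv\<close> can be added with a
  residue that creates no unbalanced closed walk shorter than \<open>2k\<close> (\<open>weighted_add_edge\<close>); then \<open>uvz\<close>
  is a k-good triangle (\<open>weighted_triangle\<close>), and the graph without \<open>z\<close> is a minor of \<open>G\<close> again.
  Putting the vertices back in reverse order, a map to \<open>B\<close> that realizes all residues by pairs in \<open>S\<close>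
  is found: the all k-good property provides the image of \<open>z\<close> (\<open>realizes_exists\<close>).  It realizes
  the residues up to a switching of \<open>G\<close>, which is all that a homomorphism requires
  (\<open>sg_hom_switching\<close>).

  The answer NO is right because the current edge set \<open>E\<close> of a run is always forceable: every pair of
  vertices with a prescribed residue occurs in a gadget, \<open>K4\<close>-minor-free and of unbalanced-girth at
  least \<open>2k\<close>, all of whose homomorphisms to \<open>B\<close> map the pair into \<open>E\<close>.  Initially it suffices that the
  gadget contains two walks between the pair, of opposite signs and of lengths \<open>a\<close> and \<open>2k - a\<close>
  (\<open>forceable_sdg\<close>).  When the failing edge \<open>e\<close> is removed, third vertices for all k-good triples are
  attached to the pair, and their pairs are forced into \<open>E\<close>; a homomorphism that maps the pair to \<open>e\<close>
  would provide the witnesses that \<open>e\<close> lacks (\<open>forceable_remove\<close>).  When no edge is left, a gadget has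
  no homomorphism at all (\<open>not_bounds_of_forceable_empty\<close>).

  The gadgets are built by attaching vertices to edges, starting from a single edge, which never
  creates a \<open>K4\<close> minor (\<open>K4_minor_free_attach\<close>).  Their unbalanced-girth is controlled by
  labelling the vertices with 0/1 vectors of length \<open>2k\<close>.  The ends of a positive edge differ in
  exactly one coordinate, those of a negative edge in all but one.  Thus every edge changes a single
  coordinate, and the negative ones complement the vector in addition.  An unbalanced closed walk
  complements an odd number of times, so it returns to its first vector only if every coordinate has
  been changed, which takes at least \<open>2k\<close> edges (\<open>labelled_girth\<close>).  Two vectors at distance
  \<open>a\<close> have a third one at distances \<open>b\<close> and \<open>c\<close> when \<open>a\<close>, \<open>b\<close>, \<open>c\<close> satisfy the inequalities above
  (\<open>tri_third_label\<close>), which also gives the unbalanced-girth of \<open>T_graph\<close>.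

  The implementation performs one of these runs.  Its counters hold the numbers of witnesses, and its
  list contains all edges that fail (\<open>loop_inv\<close>, \<open>main_loop\<close>).  If \<open>v\<close> is the number of vertices that
  are not isolated, then \<open>v\<close> and \<open>2k\<close> are both at most \<open>n\<close> and at most \<open>2m\<close>, the latter since there
  is an unbalanced cycle of length \<open>2k\<close>.  The k-good triples cost \<open>O(k^3)\<close>, the distances
  \<open>O(v m^2)\<close>, and the at most \<open>v^2\<close> edges cost \<open>O(v)\<close> each to be counted, tested and
  removed.  For the tests this holds because a test stops at the first missing witness, and \<open>v\<close>
  vertices can be witnesses for at most \<open>8v\<close> pairs of weights (\<open>card_witnessed_pairs\<close>).  Every term is
  \<open>O(m^2 n)\<close> (\<open>cost_bound\<close>).\<close>

section \<open>Signed walks\<close>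

text \<open>The flag is \<open>True\<close> for unbalanced walks.  Only the ends, the sign and the length of a walk matter
  below, and steps are added at the end, as they are in the relaxation of edges.\<close>

inductive swalk :: "'a sgraph \<Rightarrow> 'a \<Rightarrow> 'a \<Rightarrow> bool \<Rightarrow> nat \<Rightarrow> bool" for G where
  swalk_nil: "x \<in> verts G \<Longrightarrow> swalk G x x False 0"
| swalk_step: "swalk G x y s l \<Longrightarrow> {y, z} \<in> edges G \<Longrightarrow>
    swalk G x z (s \<noteq> ({y, z} \<in> negs G)) (Suc l)"

lemma signed_graph_edgeD:
  assumes "signed_graph G" "{x, y} \<in> edges G"
  shows "x \<in> verts G" "y \<in> verts G" "x \<noteq> y"
proof -
  obtain a b where "{x, y} = {a, b}" "a \<in> verts G" "b \<in> verts G" "a \<noteq> b"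
    using assms unfolding signed_graph_def by blast
  then show "x \<in> verts G" "y \<in> verts G" "x \<noteq> y" by (auto simp: doubleton_eq_iff)
qed

lemma signed_graph_edge_obtain:
  assumes "signed_graph G" "e \<in> edges G"
  obtains x y where "e = {x, y}" "x \<in> verts G" "y \<in> verts G" "x \<noteq> y"
  using assms unfolding signed_graph_def by blast

lemma walk_edges_simps [simp]:
  "walk_edges [] = []" "walk_edges [x] = []"
  "walk_edges (x # y # c) = {x, y} # walk_edges (y # c)"
  by (auto simp: walk_edges_def)

lemma walk_edges_append:
  "c \<noteq> [] \<Longrightarrow> walk_edges (c @ x # d) = walk_edges c @ {last c, x} # walk_edges (x # d)"
  by (induction c rule: induct_list012) auto

lemma walk_length_eq: "walk_length c = length c - 1"
  by (simp add: walk_length_def walk_edges_def)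

text \<open>The complement of \<open>balanced\<close> is the one of the two that is additive under concatenation.\<close>

definition neg_parity :: "'a sgraph \<Rightarrow> 'a list \<Rightarrow> bool" where
  "neg_parity G c \<longleftrightarrow> \<not> balanced G c"

lemma neg_parity_simps [simp]:
  "\<not> neg_parity G []" "\<not> neg_parity G [x]"
  "neg_parity G (x # y # c) \<longleftrightarrow> (({x, y} \<in> negs G) \<noteq> neg_parity G (y # c))"
  by (auto simp: neg_parity_def balanced_def)

lemma neg_parity_append:
  "c \<noteq> [] \<Longrightarrow> neg_parity G (c @ x # d) \<longleftrightarrow>
     ((neg_parity G c \<noteq> ({last c, x} \<in> negs G)) \<noteq> neg_parity G (x # d))"
  by (auto simp: neg_parity_def balanced_def walk_edges_append)

lemma walk_single [simp]: "walk G [x] \<longleftrightarrow> x \<in> verts G"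
  by (simp add: walk_def)

lemma walk_Cons2 [simp]:
  "walk G (x # y # c) \<longleftrightarrow> x \<in> verts G \<and> {x, y} \<in> edges G \<and> walk G (y # c)"
  by (auto simp: walk_def)

lemma walk_append:
  "c \<noteq> [] \<Longrightarrow> walk G (c @ x # d) \<longleftrightarrow> walk G c \<and> {last c, x} \<in> edges G \<and> walk G (x # d)"
  by (induction c rule: induct_list012) (auto simp: walk_def)

lemma swalk_of_walk:
  assumes "walk G c"
  shows "swalk G (hd c) (last c) (neg_parity G c) (walk_length c)"
proof -
  have "c \<noteq> []" using assms by (simp add: walk_def)
  then show ?thesis using assms
  proof (induction c rule: rev_nonempty_induct)
    case (single x)
    then show ?case by (auto simp: walk_length_def intro: swalk_nil)
  next
    case (snoc x xs)
    then have "swalk G (hd xs) (last xs) (neg_parity G xs) (walk_length xs)" "{last xs, x} \<in> edges G"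
      by (auto simp: walk_append)
    from swalk_step[OF this] show ?case
      using snoc(1) by (simp add: neg_parity_append walk_length_eq)
  qed
qed

lemma swalk_verts:
  assumes "signed_graph G" "swalk G x y s l"
  shows "x \<in> verts G" "y \<in> verts G"
  using assms(2) by (induction) (auto dest: signed_graph_edgeD[OF assms(1)])

lemma walk_of_swalk:
  assumes "signed_graph G" "swalk G x y s l"
  obtains c where "walk G c" "hd c = x" "last c = y" "neg_parity G c = s" "walk_length c = l"
proof -
  from assms(2) have "\<exists>c. walk G c \<and> hd c = x \<and> last c = y \<and> neg_parity G c = s \<and> walk_length c = l"
  proof (induction)
    case (swalk_nil x)
    then show ?case by (intro exI[of _ "[x]"]) (auto simp: walk_length_def)
  next
    case (swalk_step x y s l z)
    then obtain c where c: "walk G c" "hd c = x" "last c = y" "neg_parity G c = s" "walk_length c = l"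
      by blast
    have "c \<noteq> []" using c(1) by (simp add: walk_def)
    moreover have "z \<in> verts G" using swalk_step assms(1) signed_graph_edgeD by metis
    ultimately show ?case using c swalk_step(2)
      by (intro exI[of _ "c @ [z]"])
        (auto simp: walk_append neg_parity_append walk_length_eq Suc_diff_le walk_def[of _ c])
  qed
  then show ?thesis using that by blast
qed

lemma swalk_trans:
  assumes "swalk G y z t m" "swalk G x y s l"
  shows "swalk G x z (s \<noteq> t) (l + m)"
  using assms
proof (induction arbitrary:)
  case (swalk_nil y)
  then show ?case by simp
next
  case (swalk_step y a t m b)
  have "swalk G x b ((s \<noteq> t) \<noteq> ({a, b} \<in> negs G)) (Suc (l + m))"
    using swalk_step by (intro swalk.swalk_step) auto
  moreover have "((s \<noteq> t) \<noteq> ({a, b} \<in> negs G)) = (s \<noteq> (t \<noteq> ({a, b} \<in> negs G)))" by blast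
  ultimately show ?case by simp
qed

lemma swalk_edge:
  assumes "signed_graph G" "{x, y} \<in> edges G"
  shows "swalk G x y ({x, y} \<in> negs G) 1"
  using swalk_step[OF swalk_nil assms(2)] signed_graph_edgeD(1)[OF assms] by simp

lemma swalk_sym:
  assumes "signed_graph G" "swalk G x y s l"
  shows "swalk G y x s l"
  using assms(2)
proof (induction)
  case (swalk_nil x)
  then show ?case by (rule swalk.swalk_nil)
next
  case (swalk_step x y s l z)
  have "swalk G z y ({y, z} \<in> negs G) 1"
    using swalk_edge[OF assms(1), of z y] swalk_step by (simp add: insert_commute)
  from swalk_trans[OF swalk_step(3) this] show ?case
    by (simp add: eq_commute[of s])
qed

lemma swalk_mono:
  assumes "swalk G x y s l" "verts G \<subseteq> verts H" "edges G \<subseteq> edges H"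
    "\<And>e. e \<in> edges G \<Longrightarrow> e \<in> negs H \<longleftrightarrow> e \<in> negs G"
  shows "swalk H x y s l"
  using assms(1)
proof (induction)
  case (swalk_nil x)
  then show ?case using assms by (auto intro: swalk.swalk_nil)
next
  case (swalk_step x y s l z)
  then show ?case using assms swalk.swalk_step[OF swalk_step(3), of z] by auto
qed

subsection \<open>Girth\<close>

text \<open>A closed walk that repeats a vertex splits there into two shorter closed walks, and one of the two
  is unbalanced if the whole walk is.\<close>

lemma unbalanced_cycle_of_closed_walk:
  assumes "signed_graph G" "closed_walk G c" "\<not> balanced G c"
  shows "\<exists>c'. cycle G c' \<and> \<not> balanced G c' \<and> walk_length c' \<le> walk_length c"
  using assms(2,3)
proof (induction "length c" arbitrary: c rule: less_induct)
  case less
  have w: "walk G c" "hd c = last c" and np: "neg_parity G c"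
    using less.prems by (auto simp: closed_walk_def neg_parity_def)
  have loop: "{x, x} \<notin> edges G" for x using signed_graph_edgeD(3)[OF assms(1)] by blast
  obtain h t where c: "c = h # t" using w by (cases c) (auto simp: walk_def)
  show ?case
  proof (cases "distinct t")
    case True
    have "3 \<le> walk_length c"
    proof (rule ccontr)
      assume "\<not> ?thesis"
      then consider "t = []" | x where "t = [x]" | x y where "t = [x, y]"
        unfolding c walk_length_eq by (cases t; cases "tl t"; cases "tl (tl t)") auto
      then show False
        using w np loop by cases (auto simp: c insert_commute)
    qed
    then have "cycle G c" using True less.prems by (auto simp: cycle_def c)
    then show ?thesis using less.prems by blast
  next
    case False
    then obtain a y b d where t: "t = a @ [y] @ b @ [y] @ d"
      using not_distinct_decomp by blast
    define c1 where "c1 = y # b @ [y]"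
    define c2 where "c2 = h # a @ y # d"
    have ha: "h # a \<noteq> []" by simp
    have cc: "c = (h # a) @ y # (b @ y # d)" by (simp add: c t)
    have e1: "y # b @ y # d = (y # b) @ y # d" by simp
    have "walk G (h # a)" "{last (h # a), y} \<in> edges G" "walk G (y # b @ y # d)"
      using w(1) unfolding cc walk_append[OF ha] by auto
    moreover from this(3) have "walk G (y # b)" "{last (y # b), y} \<in> edges G" "walk G (y # d)"
      using walk_append[of "y # b" G y d] unfolding e1 by auto
    moreover have "y \<in> verts G" using \<open>walk G (y # d)\<close> by (simp add: walk_def)
    ultimately have w1: "walk G c1" and w2: "walk G c2"
      unfolding c1_def c2_def using walk_append[OF ha, of G y d] walk_append[of "y # b" G y "[]"] by auto
    have p: "neg_parity G c \<longleftrightarrow> (neg_parity G c1 \<noteq> neg_parity G c2)"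
    proof -
      have "neg_parity G c \<longleftrightarrow> ((neg_parity G (h # a) \<noteq> ({last (h # a), y} \<in> negs G)) \<noteq>
          ((neg_parity G (y # b) \<noteq> ({last (y # b), y} \<in> negs G)) \<noteq> neg_parity G (y # d)))"
        unfolding cc 
        using neg_parity_append[of "y # b" G y d] neg_parity_append[OF ha, of G y "b @ y # d"] by simp
      moreover have "neg_parity G c1 \<longleftrightarrow> (neg_parity G (y # b) \<noteq> ({last (y # b), y} \<in> negs G))"
        unfolding c1_def using neg_parity_append[of "y # b" G y "[]"] by simp
      moreover have "neg_parity G c2 \<longleftrightarrow> ((neg_parity G (h # a) \<noteq> ({last (h # a), y} \<in> negs G)) \<noteq> neg_parity G (y # d))"
        unfolding c2_def using neg_parity_append[OF ha, of G y d] by simp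
      ultimately show ?thesis by argo
    qed
    have cl1: "closed_walk G c1" using w1 by (simp add: closed_walk_def c1_def)
    have cl2: "closed_walk G c2" using w2 w(2)
      by (auto simp: closed_walk_def c2_def c t split: if_splits)
    from p np have "neg_parity G c1 \<or> neg_parity G c2" by blast
    then show ?thesis
    proof
      assume "neg_parity G c1"
      moreover have "length c1 < length c" by (simp add: c1_def c t)
      ultimately obtain c' where "cycle G c' \<and> \<not> balanced G c' \<and> walk_length c' \<le> walk_length c1"
        using less.hyps[of c1] cl1 by (auto simp: neg_parity_def)
      then show ?thesis using \<open>length c1 < length c\<close>
        by (intro exI[of _ c']) (auto simp: walk_length_eq)
    next
      assume "neg_parity G c2"
      moreover have "length c2 < length c" by (simp add: c2_def c t)
      ultimately obtain c' where "cycle G c' \<and> \<not> balanced G c' \<and> walk_length c' \<le> walk_length c2"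
        using less.hyps[of c2] cl2 by (auto simp: neg_parity_def)
      then show ?thesis using \<open>length c2 < length c\<close>
        by (intro exI[of _ c']) (auto simp: walk_length_eq)
    qed
  qed
qed

text \<open>Closed walks can be composed and mapped, cycles cannot; from here on lower bounds for the
  unbalanced-girth are statements about closed walks.\<close>

lemma unbalanced_girth_ge_iff:
  assumes "signed_graph G"
  shows "enat N \<le> unbalanced_girth G \<longleftrightarrow> (\<forall>x l. swalk G x x True l \<longrightarrow> N \<le> l)"
proof
  assume L: "enat N \<le> unbalanced_girth G"
  show "\<forall>x l. swalk G x x True l \<longrightarrow> N \<le> l"
  proof (intro allI impI)
    fix x l assume "swalk G x x True l"
    then obtain c where c: "walk G c" "hd c = x" "last c = x" "neg_parity G c" "walk_length c = l"
      using walk_of_swalk[OF assms] by metis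
    then obtain c' where c': "cycle G c'" "\<not> balanced G c'" "walk_length c' \<le> l"
      using unbalanced_cycle_of_closed_walk[OF assms, of c] by (auto simp: closed_walk_def neg_parity_def)
    have "unbalanced_girth G \<le> enat (walk_length c')"
      unfolding unbalanced_girth_def using c' by (intro INF_lower) auto
    then show "N \<le> l" using L c'(3) by (metis enat_ord_simps(1) order_trans)
  qed
next
  assume R: "\<forall>x l. swalk G x x True l \<longrightarrow> N \<le> l"
  show "enat N \<le> unbalanced_girth G"
    unfolding unbalanced_girth_def
  proof (rule INF_greatest)
    fix c assume "c \<in> {c. cycle G c \<and> \<not> balanced G c}"
    then have "walk G c" "hd c = last c" "neg_parity G c"
      by (auto simp: cycle_def closed_walk_def neg_parity_def)
    with swalk_of_walk[of G c] have "swalk G (last c) (last c) True (walk_length c)" by simp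
    then show "enat N \<le> enat (walk_length c)" using R by simp
  qed
qed

lemma unbalanced_girth_attained:
  assumes "unbalanced_girth G = enat N"
  obtains c where "cycle G c" "\<not> balanced G c" "walk_length c = N"
proof -
  let ?A = "(\<lambda>c. enat (walk_length c)) ` {c. cycle G c \<and> \<not> balanced G c}"
  have "?A \<noteq> {}" using assms unfolding unbalanced_girth_def by (metis Inf_enat_def enat.distinct(1) infinity_enat_def)
  then have "Inf ?A \<in> ?A" by (meson wellorder_InfI ex_in_conv)
  then show ?thesis using assms that unfolding unbalanced_girth_def by auto
qed

subsection \<open>Algebraic distance\<close>

lemma shorter_walk:
  assumes "walk G c" "\<not> distinct c"
  shows "\<exists>c'. walk G c' \<and> hd c' = hd c \<and> last c' = last c \<and> length c' < length c \<and> set c' \<subseteq> set c"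
proof -
  obtain a y b d where c: "c = a @ [y] @ b @ [y] @ d"
    using assms not_distinct_decomp by blast
  have "walk G (a @ y # d)"
  proof (cases "a = []")
    case True
    then have "walk G ((y # b) @ y # d)" using assms c by simp
    then show ?thesis unfolding True by (subst (asm) walk_append) auto
  next
    case False
    then have "walk G a" "{last a, y} \<in> edges G" "walk G ((y # b) @ y # d)"
      using assms(1) unfolding c by (auto simp: walk_append)
    moreover from this(3) have "walk G (y # d)" by (subst (asm) walk_append) auto
    ultimately show ?thesis using False by (simp add: walk_append)
  qed
  then show ?thesis
    by (intro exI[of _ "a @ y # d"]) (auto simp: c hd_append)
qed

text \<open>A shortest walk is a path, so paths can be replaced by walks in the definition of the algebraic
  distance.\<close>

lemma ad_props:
  assumes G: "signed_graph G" and w: "swalk G x y s0 l0"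
  obtains d where "gdist G x y = enat d" "\<exists>s. swalk G x y s d"
    "\<And>s l. swalk G x y s l \<Longrightarrow> d \<le> l"
    "ad G x y = (if swalk G x y False d then int d else - int d)"
proof -
  define d where "d = (LEAST l. \<exists>s. swalk G x y s l)"
  have d1: "\<exists>s. swalk G x y s d" unfolding d_def 
    by (rule LeastI_ex) (use w in blast)
  have d2: "d \<le> l" if "swalk G x y s l" for s l
    unfolding d_def using that by (intro Least_le) auto
  have p: "path G x y c" if A: "walk G c" "hd c = x" "last c = y" "walk_length c = d" for c
  proof -
    have "distinct c"
    proof (rule ccontr)
      assume "\<not> distinct c"
      from shorter_walk[OF A(1) this] obtain c'
        where c': "walk G c'" "hd c' = x" "last c' = y" "length c' < length c"
        using A by auto
      from swalk_of_walk[OF c'(1)] d2 c' have "d \<le> walk_length c'" by auto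
      moreover have "c' \<noteq> []" using c'(1) by (simp add: walk_def)
      ultimately show False using c'(4) A(4) by (cases c') (auto simp: walk_length_eq)
    qed
    then show ?thesis using A by (simp add: path_def)
  qed
  have g: "gdist G x y = enat d"
    unfolding gdist_def
  proof (rule antisym)
    obtain s where "swalk G x y s d" using d1 by blast
    then obtain c where c: "walk G c" "hd c = x" "last c = y" "walk_length c = d"
      using walk_of_swalk[OF G] by metis
    show "(INF c\<in>{c. path G x y c}. enat (walk_length c)) \<le> enat d"
      using p[OF c] c by (intro INF_lower2[of c]) auto
    show "enat d \<le> (INF c\<in>{c. path G x y c}. enat (walk_length c))"
      using d2 swalk_of_walk by (intro INF_greatest) (fastforce simp: path_def)
  qed
  have "(\<exists>c. path G x y c \<and> enat (walk_length c) = gdist G x y \<and> balanced G c) \<longleftrightarrow> swalk G x y False d"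
  proof
    assume "\<exists>c. path G x y c \<and> enat (walk_length c) = gdist G x y \<and> balanced G c"
    then show "swalk G x y False d" using g swalk_of_walk[of G] by (force simp: path_def neg_parity_def)
  next
    assume "swalk G x y False d"
    then show "\<exists>c. path G x y c \<and> enat (walk_length c) = gdist G x y \<and> balanced G c"
      using walk_of_swalk[OF G] p g by (metis neg_parity_def)
  qed
  then have "ad G x y = (if swalk G x y False d then int d else - int d)"
    unfolding ad_def g by simp
  then show ?thesis using that g d1 d2 by blast
qed

lemma gdist_finiteD:
  assumes "gdist G x y \<noteq> \<infinity>"
  obtains s l where "swalk G x y s l"
proof -
  have "{c. path G x y c} \<noteq> {}" using assms unfolding gdist_def by (metis Inf_enat_def image_empty)
  then obtain c where "walk G c" "hd c = x" "last c = y" by (auto simp: path_def)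
  then show ?thesis using swalk_of_walk that by metis
qed

lemma gdist_finite_iff:
  "signed_graph G \<Longrightarrow> gdist G x y \<noteq> \<infinity> \<longleftrightarrow> (\<exists>s l. swalk G x y s l)"
  by (metis ad_props enat.distinct(1) gdist_finiteD infinity_enat_def)

lemma ad_sym:
  assumes "signed_graph G" shows "gdist G x y = gdist G y x" "ad G x y = ad G y x"
proof -
  have "gdist G x y = gdist G y x \<and> ad G x y = ad G y x"
  proof (cases "\<exists>s l. swalk G x y s l")
    case True
    then obtain s l where w: "swalk G x y s l" by blast
    obtain d where d: "gdist G x y = enat d" "\<exists>s. swalk G x y s d"
      "\<And>s l. swalk G x y s l \<Longrightarrow> d \<le> l"
      "ad G x y = (if swalk G x y False d then int d else - int d)" using ad_props[OF assms w] by metis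
    obtain d' where d': "gdist G y x = enat d'" "\<exists>s. swalk G y x s d'"
      "\<And>s l. swalk G y x s l \<Longrightarrow> d' \<le> l"
      "ad G y x = (if swalk G y x False d' then int d' else - int d')"
      using ad_props[OF assms swalk_sym[OF assms w]] by metis
    have "d = d'" using d d' swalk_sym[OF assms] by (meson order_antisym)
    then show ?thesis using d d' swalk_sym[OF assms] by auto
  next
    case False
    then have "\<not> (\<exists>s l. swalk G y x s l)" using swalk_sym[OF assms] by blast
    with False have "gdist G x y = \<infinity>" "gdist G y x = \<infinity>" by (metis gdist_finiteD)+
    then show ?thesis by (auto simp: ad_def)
  qed
  then show "gdist G x y = gdist G y x" "ad G x y = ad G y x" by auto
qed

section \<open>Labellings by 0/1 vectors\<close>

text \<open>The coordinates, among the first \<open>N\<close>, that a walk of sign \<open>s\<close> from a vertex labelled \<open>A\<close> to a vertex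
  labelled \<open>B\<close> has to change, where a negative edge is thought of as changing one coordinate and then
  complementing the whole vector.\<close>

definition differ :: "nat \<Rightarrow> (nat \<Rightarrow> bool) \<Rightarrow> (nat \<Rightarrow> bool) \<Rightarrow> bool \<Rightarrow> nat set" where
  "differ N A B s = {i\<in>{..<N}. (A i \<noteq> B i) \<noteq> s}"

definition labelled :: "nat \<Rightarrow> 'a sgraph \<Rightarrow> ('a \<Rightarrow> nat \<Rightarrow> bool) \<Rightarrow> bool" where
  "labelled N G f \<longleftrightarrow>
     (\<forall>x y. {x, y} \<in> edges G \<longrightarrow> (\<exists>d. differ N (f x) (f y) ({x, y} \<in> negs G) = {d}))"

lemma finite_differ [simp]: "finite (differ N A B s)"
  by (simp add: differ_def)

lemma card_differ_not: "card (differ N A B (\<not> s)) = N - card (differ N A B s)"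
proof -
  have "differ N A B (\<not> s) = {..<N} - differ N A B s" by (auto simp: differ_def)
  then show ?thesis by (simp add: card_Diff_subset differ_def subset_iff)
qed

lemma card_differ_le: "card (differ N A B s) \<le> N"
  using card_mono[of "{..<N}" "differ N A B s"] by (auto simp: differ_def)

lemma differ_commute: "differ N A B s = differ N B A s"
  by (auto simp: differ_def)

text \<open>Each edge changes one coordinate, up to complements.\<close>

lemma swalk_differ:
  assumes "labelled N G f" "swalk G x y s l"
  shows "card (differ N (f x) (f y) s) \<le> l"
  using assms(2)
proof (induction)
  case (swalk_nil x)
  then show ?case by (simp add: differ_def)
next
  case (swalk_step x y s l z)
  let ?t = "{y, z} \<in> negs G"
  obtain d where d: "differ N (f y) (f z) ?t = {d}"
    using assms(1) swalk_step(2) unfolding labelled_def by blast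
  have "differ N (f x) (f z) (s \<noteq> ?t) \<subseteq> differ N (f x) (f y) s \<union> differ N (f y) (f z) ?t"
    by (auto simp: differ_def)
  then have "card (differ N (f x) (f z) (s \<noteq> ?t)) \<le> card (differ N (f x) (f y) s \<union> differ N (f y) (f z) ?t)"
    by (intro card_mono) auto
  also have "\<dots> \<le> card (differ N (f x) (f y) s) + 1"
    using card_Un_le[of "differ N (f x) (f y) s" "differ N (f y) (f z) ?t"] d by simp
  finally show ?case using swalk_step.IH by linarith
qed

text \<open>A closed walk that ends with the complement of the label it started from has changed every
  coordinate.\<close>

lemma labelled_girth:
  assumes "signed_graph G" "labelled N G f"
  shows "enat N \<le> unbalanced_girth G"
  unfolding unbalanced_girth_ge_iff[OF assms(1)]
proof (intro allI impI)
  fix x l assume "swalk G x x True l"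
  from swalk_differ[OF assms(2) this] show "N \<le> l" by (simp add: differ_def)
qed

lemma even_card_sym_diff:
  assumes "finite A" "finite B"
  shows "even (card ((A - B) \<union> (B - A))) \<longleftrightarrow> (even (card A) \<longleftrightarrow> even (card B))"
proof -
  have "card ((A - B) \<union> (B - A)) = card (A - B) + card (B - A)"
    using assms by (intro card_Un_disjoint) auto
  moreover have "card A = card (A - B) + card (A \<inter> B)"
    using assms by (metis card_Diff_subset_Int card_mono finite_Int inf_le1 le_add_diff_inverse2)
  moreover have "card B = card (B - A) + card (A \<inter> B)"
    using assms by (metis card_Diff_subset_Int card_mono finite_Int inf_le1 inf_commute le_add_diff_inverse2)
  ultimately show ?thesis by presburger
qed

text \<open>A bipartition is given by the parity of the number of ones: positive edges change one coordinate,
  and negative edges change \<open>N - 1\<close>, which is odd as well.\<close>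

lemma labelled_bipartite:
  assumes "signed_graph G" "labelled N G f" "even N"
  shows "signed_bipartite G"
proof -
  define X where "X = {x \<in> verts G. even (card {i\<in>{..<N}. f x i})}"
  have "\<exists>x\<in>X. \<exists>y\<in>verts G - X. e = {x, y}" if e: "e \<in> edges G" for e
  proof -
    obtain x y where xy: "e = {x, y}" "x \<in> verts G" "y \<in> verts G"
      using signed_graph_edge_obtain[OF assms(1) e] by metis
    obtain d where d: "differ N (f x) (f y) (e \<in> negs G) = {d}"
      using assms(2) e unfolding labelled_def xy(1) by blast
    have "odd (card (differ N (f x) (f y) False))"
    proof (cases "e \<in> negs G")
      case True
      then have "card (differ N (f x) (f y) True) = 1" using d by simp
      moreover from this have "1 \<le> N" using card_differ_le[of N "f x" "f y" True] by simp
      ultimately show ?thesis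
        using card_differ_not[of N "f x" "f y" True] assms(3) by simp
    qed (use d in auto)
    moreover have "differ N (f x) (f y) False = ({i\<in>{..<N}. f x i} - {i\<in>{..<N}. f y i}) \<union> ({i\<in>{..<N}. f y i} - {i\<in>{..<N}. f x i})"
      by (auto simp: differ_def)
    ultimately have "even (card {i\<in>{..<N}. f x i}) \<noteq> even (card {i\<in>{..<N}. f y i})"
      using even_card_sym_diff[of "{i\<in>{..<N}. f x i}" "{i\<in>{..<N}. f y i}"] by simp
    then show ?thesis using xy unfolding X_def by (auto simp: insert_commute)
  qed
  then show ?thesis unfolding signed_bipartite_def using assms(1)
    by (intro conjI exI[of _ X] exI[of _ "verts G - X"]) (auto simp: X_def)
qed

section \<open>k-good triples as metric triangles\<close>

text \<open>The inequalities say that the triangle with positive lengths \<open>a\<close>, \<open>b\<close>, \<open>c\<close> and negative lengths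
  \<open>N - a\<close>, \<open>N - b\<close>, \<open>N - c\<close> has no unbalanced closed walk around it that is shorter than \<open>N\<close>: three of
  them concern the walks with one negative side, the last one the walk with three.\<close>

definition tri :: "int \<Rightarrow> int \<Rightarrow> int \<Rightarrow> int \<Rightarrow> bool" where
  "tri N a b c \<longleftrightarrow> a \<in> {0<..<N} \<and> b \<in> {0<..<N} \<and> c \<in> {0<..<N} \<and> even (a + b + c) \<and>
     a \<le> b + c \<and> b \<le> a + c \<and> c \<le> a + b \<and> a + b + c \<le> 2 * N"

text \<open>The label \<open>Z\<close> is obtained from \<open>A\<close> by changing \<open>(a + b - c) / 2\<close> of the \<open>a\<close> coordinates in which \<open>A\<close> and
  \<open>B\<close> differ, and \<open>(b + c - a) / 2\<close> of the other \<open>N - a\<close>.  The four inequalities of \<open>tri\<close> say that both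
  numbers are possible.\<close>

lemma tri_third_label:
  assumes "tri (int N) a b c" "int (card (differ N A B False)) = a"
  obtains Z where "int (card (differ N A Z False)) = b" "int (card (differ N B Z False)) = c"
proof -
  let ?D = "differ N A B False"
  define i where "i = nat ((a + b - c) div 2)"
  define j where "j = nat ((b + c - a) div 2)"
  have ij: "int i = (a + b - c) div 2" "int j = (b + c - a) div 2"
    using assms(1) by (auto simp: i_def j_def tri_def)
  have ij': "2 * int i = a + b - c" "2 * int j = b + c - a"
  proof -
    have "even (a + b + c)" using assms(1) by (simp only: tri_def)
    then obtain m where "a + b + c = 2 * m" by (rule evenE)
    then have "a + b - c = 2 * (m - c)" "b + c - a = 2 * (m - a)" by auto
    then show "2 * int i = a + b - c" "2 * int j = b + c - a" unfolding ij by presburger+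
  qed
  have "i \<le> card ?D" using assms ij' by (auto simp: tri_def)
  then obtain I where I: "I \<subseteq> ?D" "card I = i" "finite I" by (metis obtain_subset_with_card_n)
  have "j \<le> card ({..<N} - ?D)"
    using assms ij' card_differ_le[of N A B False]
    by (subst card_Diff_subset) (auto simp: tri_def differ_def)
  then obtain J where J: "J \<subseteq> {..<N} - ?D" "card J = j" "finite J" by (metis obtain_subset_with_card_n)
  define Z where "Z x = (A x \<noteq> (x \<in> I \<union> J))" for x
  have "differ N A Z False = I \<union> J" using I J by (auto simp: differ_def Z_def)
  moreover have "card (I \<union> J) = i + j" using I J by (subst card_Un_disjoint) auto
  moreover have "differ N B Z False = (?D - I) \<union> J" using I J by (auto simp: differ_def Z_def)
  moreover have "card ((?D - I) \<union> J) = (card ?D - i) + j" using I J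
    by (subst card_Un_disjoint) (auto simp: card_Diff_subset)
  ultimately show ?thesis using ij' assms(2) \<open>i \<le> card ?D\<close> by (intro that[of Z]) auto
qed

definition is_weight :: "nat \<Rightarrow> int \<Rightarrow> bool" where
  "is_weight k p \<longleftrightarrow> p \<noteq> 0 \<and> \<bar>p\<bar> \<le> int k"

lemma weight_mod:
  assumes "is_weight k p" "2 \<le> k"
  shows "p mod (2 * int k) = (if 0 < p then p else p + 2 * int k)"
proof (cases "0 < p")
  case True
  then show ?thesis using assms by (auto simp: is_weight_def)
next
  case False
  then have "(p + 2 * int k) mod (2 * int k) = p + 2 * int k"
    using assms by (intro mod_pos_pos_trivial) (auto simp: is_weight_def)
  then show ?thesis using False by simp
qed

text \<open>The graph of a triple, with the three weights as a function of the index of the pair of paths.\<close>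

locale T_arcs =
  fixes k :: nat and s :: "nat \<Rightarrow> int"
  assumes k: "2 \<le> k" and s: "\<And>i. i < 3 \<Longrightarrow> is_weight k (s i)"
begin

abbreviation len :: "nat \<Rightarrow> bool \<Rightarrow> nat" where "len i b \<equiv> arc_length k (s i) b"
abbreviation vx :: "nat \<Rightarrow> bool \<Rightarrow> nat \<Rightarrow> tvert" where "vx i b j \<equiv> arc_vertex k (s i) i b j"
abbreviation ed :: "nat \<Rightarrow> bool \<Rightarrow> nat \<Rightarrow> tvert set" where "ed i b j \<equiv> arc_edge k (s i) i b j"

definition G :: "tvert sgraph" where
  "G = \<lparr> verts = {vx i b j | i b j. i < 3 \<and> j \<le> len i b},
        edges = {ed i b j | i b j. i < 3 \<and> j < len i b},
        negs = {ed i (s i > 0) 0 | i. i < 3} \<rparr>"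

lemma len_pos: "i < 3 \<Longrightarrow> 0 < len i b"
  using k s[of i] by (auto simp: arc_length_def is_weight_def)

lemma len_sum: "i < 3 \<Longrightarrow> len i False + len i True = 2 * k"
  using k s[of i] by (auto simp: arc_length_def is_weight_def)

lemma ends: "i < 3 \<Longrightarrow> fst (arc_ends i) \<noteq> snd (arc_ends i)"
  by (auto simp: arc_ends_def)

lemma vx_0: "vx i b 0 = Corner (fst (arc_ends i))"
  by (simp add: arc_vertex_def)

lemma vx_len: "i < 3 \<Longrightarrow> vx i b (len i b) = Corner (snd (arc_ends i))"
  using len_pos[of i b] by (simp add: arc_vertex_def)

lemma vx_inner: "0 < j \<Longrightarrow> j < len i b \<Longrightarrow> vx i b j = Inner i b j"
  by (simp add: arc_vertex_def)

lemma ed_cases: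
  assumes "i < 3" "j < len i b"
  obtains "j = 0" "len i b = 1" "ed i b j = {Corner (fst (arc_ends i)), Corner (snd (arc_ends i))}"
  | "j = 0" "len i b > 1" "ed i b j = {Corner (fst (arc_ends i)), Inner i b 1}"
  | "0 < j" "Suc j = len i b" "ed i b j = {Inner i b j, Corner (snd (arc_ends i))}"
  | "0 < j" "Suc j < len i b" "ed i b j = {Inner i b j, Inner i b (Suc j)}"
proof -
  consider "j = 0 \<and> len i b = 1" | "j = 0 \<and> len i b > 1" | "0 < j \<and> Suc j = len i b" | "0 < j \<and> Suc j < len i b"
    using assms by linarith
  then show ?thesis
  proof cases
    case 1 then show ?thesis using that(1) assms by (simp add: arc_edge_def arc_vertex_def)
  next
    case 2 then show ?thesis using that(2) assms by (simp add: arc_edge_def arc_vertex_def)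
  next
    case 3 then show ?thesis using that(3) assms by (simp add: arc_edge_def arc_vertex_def)
  next
    case 4 then show ?thesis using that(4) assms by (simp add: arc_edge_def arc_vertex_def)
  qed
qed

lemma len_1_unique: "i < 3 \<Longrightarrow> len i b = 1 \<Longrightarrow> len i b' = 1 \<Longrightarrow> b = b'"
  using len_sum[of i] k by (cases b; cases b') auto

lemma arc_ends_inj:
  "i < 3 \<Longrightarrow> i' < 3 \<Longrightarrow> {fst (arc_ends i), snd (arc_ends i)} = {fst (arc_ends i'), snd (arc_ends i')} \<Longrightarrow> i = i'"
  by (auto simp: arc_ends_def doubleton_eq_iff split: if_splits)

text \<open>This is where at most one of the two paths of a pair has length one: two of them would be the same
  edge.\<close>

lemma ed_inj:
  assumes "i < 3" "j < len i b" "i' < 3" "j' < len i' b'" "ed i b j = ed i' b' j'"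
  shows "i = i' \<and> b = b' \<and> j = j'"
  using assms(1,2)
proof (cases rule: ed_cases)
  case 1
  from assms(3,4) show ?thesis
  proof (cases rule: ed_cases)
    case A: 1
    then have "{Corner (fst (arc_ends i)), Corner (snd (arc_ends i))} = {Corner (fst (arc_ends i')), Corner (snd (arc_ends i'))}"
      using 1(3) assms(5) by simp
    then have "{fst (arc_ends i), snd (arc_ends i)} = {fst (arc_ends i'), snd (arc_ends i')}"
      unfolding doubleton_eq_iff by simp
    then have "i = i'" by (rule arc_ends_inj[OF assms(1,3)])
    then show ?thesis using 1(1,2) A(1,2) len_1_unique[of i b b'] assms(1) by simp
  qed (use 1(3) assms(5) in \<open>simp_all add: doubleton_eq_iff\<close>)
next
  case 2
  from assms(3,4) show ?thesis
    by (cases rule: ed_cases)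
      (use 2(1,3) assms(5) ends[OF assms(1)] ends[OF assms(3)] in \<open>auto simp: doubleton_eq_iff\<close>)
next
  case 3
  from assms(3,4) show ?thesis
    by (cases rule: ed_cases)
      (use 3(3) assms(5) ends[OF assms(1)] ends[OF assms(3)] in \<open>auto simp: doubleton_eq_iff\<close>)
next
  case 4
  from assms(3,4) show ?thesis
  proof (cases rule: ed_cases)
    case A: 4
    have "{Inner i b j, Inner i b (Suc j)} = {Inner i' b' j', Inner i' b' (Suc j')}"
      using 4(3) A(3) assms(5) by simp
    then consider "i = i'" "b = b'" "j = j'" | "j = Suc j'" "Suc j = j'"
      unfolding doubleton_eq_iff tvert.inject by blast
    then show ?thesis by cases (blast, linarith)
  qed (use 4(3) assms(5) in \<open>auto simp: doubleton_eq_iff\<close>)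
qed

lemma ed_negs: "i < 3 \<Longrightarrow> j < len i b \<Longrightarrow> ed i b j \<in> negs G \<longleftrightarrow> (b \<longleftrightarrow> s i > 0) \<and> j = 0"
proof -
  assume i: "i < 3" "j < len i b"
  have "ed i b j \<in> negs G \<longleftrightarrow> (\<exists>i'<3. ed i b j = ed i' (s i' > 0) 0)" by (auto simp: G_def)
  also have "\<dots> \<longleftrightarrow> (b \<longleftrightarrow> s i > 0) \<and> j = 0"
  proof
    assume "\<exists>i'<3. ed i b j = ed i' (s i' > 0) 0"
    then obtain i' where i': "i' < 3" "ed i b j = ed i' (s i' > 0) 0" by blast
    from ed_inj[OF i i'(1) len_pos[OF i'(1)] i'(2)] show "(b \<longleftrightarrow> s i > 0) \<and> j = 0" by simp
  qed (use i in auto)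
  finally show ?thesis .
qed

lemma signed_graph_G: "signed_graph G"
proof -
  have "verts G \<subseteq> (\<Union>i\<in>{..<3}. \<Union>b\<in>UNIV. vx i b ` {..len i b})" by (auto simp: G_def)
  then have "finite (verts G)" by (rule finite_subset) auto
  moreover have "e \<in> {{x, y} | x y. x \<in> verts G \<and> y \<in> verts G \<and> x \<noteq> y}" if e: "e \<in> edges G" for e
  proof -
    obtain i b j where i: "i < 3" "j < len i b" "e = ed i b j" using e by (auto simp: G_def)
    have "vx i b j \<noteq> vx i b (Suc j)" using i ends[of i] by (auto simp: arc_vertex_def)
    moreover have "vx i b j \<in> verts G" "vx i b (Suc j) \<in> verts G"
      using i by (auto simp: G_def) (metis Suc_leI less_imp_le_nat)+
    ultimately show ?thesis using i by (auto simp: arc_edge_def)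
  qed
  moreover have "negs G \<subseteq> edges G" using len_pos by (fastforce simp: G_def)
  ultimately show ?thesis by (auto simp: signed_graph_def)
qed

lemma arc_swalk:
  assumes "i < 3" "j \<le> len i b"
  shows "swalk G (vx i b 0) (vx i b j) (0 < j \<and> (b \<longleftrightarrow> s i > 0)) j"
  using assms(2)
proof (induction j)
  case 0
  have "vx i b 0 \<in> verts G" using assms(1) by (auto simp: G_def)
  then show ?case using swalk_nil by simp
next
  case (Suc j)
  have "j < len i b" using Suc by simp
  then have "ed i b j \<in> edges G" using assms(1) unfolding G_def sgraph.simps by blast
  then have e: "{vx i b j, vx i b (Suc j)} \<in> edges G" "ed i b j = {vx i b j, vx i b (Suc j)}"
    by (simp_all add: arc_edge_def)
  have "((0 < j \<and> (b \<longleftrightarrow> s i > 0)) \<noteq> ({vx i b j, vx i b (Suc j)} \<in> negs G)) = (b \<longleftrightarrow> s i > 0)"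
    using ed_negs[of i j b] Suc assms(1) e(2) by auto
  then show ?case using swalk_step[OF Suc.IH e(1)] Suc by simp
qed

text \<open>The length of the positive path of a pair.\<close>

definition pos_len :: "nat \<Rightarrow> nat" where "pos_len i = nat (s i mod (2 * int k))"

lemma pos_len: "i < 3 \<Longrightarrow> int (pos_len i) = s i mod (2 * int k)"
  using k by (simp add: pos_len_def)

lemma pos_len_le: "pos_len i \<le> 2 * k"
  using pos_mod_bound[of "2 * int k" "s i"] k unfolding pos_len_def nat_le_iff by linarith

lemma sign_swalk:
  assumes "i < 3"
  shows "swalk G (Corner (fst (arc_ends i))) (Corner (snd (arc_ends i))) t
     (if t then 2 * k - pos_len i else pos_len i)"
proof -
  let ?b = "t \<longleftrightarrow> s i > 0"
  have l: "len i ?b = (if t then 2 * k - pos_len i else pos_len i)"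
    using s[OF assms] weight_mod[OF s[OF assms] k]
    by (auto simp: arc_length_def is_weight_def pos_len_def)
  have "(0 < len i ?b \<and> (?b \<longleftrightarrow> s i > 0)) = t" using len_pos[OF assms] by auto
  then show ?thesis using arc_swalk[OF assms, of "len i ?b" ?b]
    unfolding l vx_0 vx_len[OF assms, symmetric, of ?b] by (simp add: l)
qed

lemma girth_le: "unbalanced_girth G \<le> enat (2 * k)"
proof (rule ccontr)
  assume "\<not> ?thesis"
  then have "enat (Suc (2 * k)) \<le> unbalanced_girth G"
    by (metis Suc_ile_eq not_le)
  moreover have "swalk G (Corner (fst (arc_ends 0))) (Corner (fst (arc_ends 0))) (True \<noteq> False) (2 * k - pos_len 0 + pos_len 0)"
    using swalk_trans[OF swalk_sym[OF signed_graph_G sign_swalk[of 0 False]] sign_swalk[of 0 True]] by simp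
  moreover have "pos_len 0 \<le> 2 * k" by (rule pos_len_le)
  ultimately show False using unbalanced_girth_ge_iff[OF signed_graph_G, of "Suc (2 * k)"] by fastforce
qed

text \<open>Each inequality is the length of an unbalanced closed walk around the triangle.\<close>

lemma tri_of_girth:
  assumes g: "enat (2 * k) \<le> unbalanced_girth G" and ev: "even (s 0 + s 1 + s 2)"
  shows "tri (2 * int k) (s 0 mod (2 * int k)) (s 1 mod (2 * int k)) (s 2 mod (2 * int k))"
proof -
  have w: "2 * int k \<le> (if t0 then 2 * int k - s 0 mod (2 * int k) else s 0 mod (2 * int k)) +
      (if t1 then 2 * int k - s 1 mod (2 * int k) else s 1 mod (2 * int k)) +
      (if t2 then 2 * int k - s 2 mod (2 * int k) else s 2 mod (2 * int k))"
    if t: "(t0 \<noteq> t1) \<noteq> t2" for t0 t1 t2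
  proof -
    let ?l = "\<lambda>i t. if t then 2 * k - pos_len i else pos_len i"
    have w0: "swalk G (Corner 0) (Corner 1) t0 (?l 0 t0)" using sign_swalk[of 0 t0] by (simp add: arc_ends_def)
    have w1: "swalk G (Corner 0) (Corner 2) t1 (?l 1 t1)" using sign_swalk[of 1 t1] by (simp add: arc_ends_def)
    have w2: "swalk G (Corner 1) (Corner 2) t2 (?l 2 t2)" using sign_swalk[of 2 t2] by (simp add: arc_ends_def)
    have "swalk G (Corner 0) (Corner 0) ((t0 \<noteq> t2) \<noteq> t1) (?l 0 t0 + ?l 2 t2 + ?l 1 t1)"
      by (rule swalk_trans[OF swalk_sym[OF signed_graph_G w1] swalk_trans[OF w2 w0]])
    moreover have eq: "((t0 \<noteq> t2) \<noteq> t1) = True" using t by auto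
    ultimately have "swalk G (Corner 0) (Corner 0) True (?l 0 t0 + ?l 2 t2 + ?l 1 t1)"
      by (simp only: eq)
    then have "2 * k \<le> ?l 0 t0 + ?l 2 t2 + ?l 1 t1"
      by (rule g[unfolded unbalanced_girth_ge_iff[OF signed_graph_G], rule_format])
    then have "int (2 * k) \<le> int (?l 0 t0 + ?l 2 t2 + ?l 1 t1)" by (rule of_nat_mono)
    then have "2 * int k \<le> int (?l 0 t0) + int (?l 2 t2) + int (?l 1 t1)"
      by (simp only: of_nat_add of_nat_mult of_nat_numeral)
    moreover have "int (?l i t) = (if t then 2 * int k - s i mod (2 * int k) else s i mod (2 * int k))" if "i < 3" for i t
      using pos_len[OF that] of_nat_diff[OF pos_len_le[of i], where 'a = int] by (cases t) simp_all
    ultimately show ?thesis by (simp only: add.assoc add.commute add.left_commute)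
  qed
  have r: "s i mod (2 * int k) \<in> {0<..<2 * int k}" if "i < 3" for i
    using weight_mod[OF s[OF that] k] s[OF that] k by (auto simp: is_weight_def)
  have e: "even (s i mod (2 * int k)) = even (s i)" for i
    using dvd_mod_iff[of 2 "2 * int k" "s i"] by simp
  show ?thesis unfolding tri_def
    using w[of True False False] w[of False True False] w[of False False True] w[of True True True]
      r[of 0] r[of 1] r[of 2] ev e[of 0] e[of 1] e[of 2] by simp
qed

text \<open>The graph of a triple is given a labelling.  The corners are labelled by three vectors with the
  prescribed distances; along each path the coordinates in which its ends differ, up to the sign of the
  path, are changed one after the other.\<close>

lemma girth_of_tri:
  assumes tri: "tri (2 * int k) (s 0 mod (2 * int k)) (s 1 mod (2 * int k)) (s 2 mod (2 * int k))"
  shows "enat (2 * k) \<le> unbalanced_girth G"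
proof -
  let ?N = "2 * k"
  have iN: "int ?N = 2 * int k" by simp
  define A where "A = (\<lambda>_::nat. False)"
  define B where "B = (\<lambda>x. x < pos_len 0)"
  have pl: "pos_len i \<le> ?N" for i by (rule pos_len_le)
  have "differ ?N A B False = {..<pos_len 0}" using pl[of 0] by (auto simp: differ_def A_def B_def)
  then have AB: "int (card (differ ?N A B False)) = s 0 mod (2 * int k)" using pos_len[of 0] by simp
  obtain Z where Z: "int (card (differ ?N A Z False)) = s 1 mod (2 * int k)"
    "int (card (differ ?N B Z False)) = s 2 mod (2 * int k)"
    using tri_third_label[OF tri[folded iN]] AB by auto
  define lab where "lab = (\<lambda>c::nat. if c = 0 then A else if c = 1 then B else Z)"
  let ?A = "\<lambda>i. lab (fst (arc_ends i))" and ?B = "\<lambda>i. lab (snd (arc_ends i))"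
  have lab: "card (differ ?N (?A i) (?B i) False) = pos_len i" if "i < 3" for i
  proof -
    consider "i = 0" | "i = 1" | "i = 2" using \<open>i < 3\<close> by linarith
    then show ?thesis
      using AB Z pos_len[of 0] pos_len[of 1] pos_len[of 2] by cases (auto simp: lab_def arc_ends_def)
  qed
  have D: "card (differ ?N (?A i) (?B i) (b \<longleftrightarrow> s i > 0)) = len i b" if i: "i < 3" for i b
    using lab[OF i] card_differ_not[of ?N "?A i" "?B i" False] weight_mod[OF s[OF i] k] s[OF i]
    by (cases b; cases "s i > 0") (auto simp: arc_length_def is_weight_def pos_len_def)
  have "\<exists>h. i < 3 \<longrightarrow> bij_betw h {..<len i b} (differ ?N (?A i) (?B i) (b \<longleftrightarrow> s i > 0))" for i b
    using ex_bij_betw_nat_finite[OF finite_differ, of ?N "?A i" "?B i" "b \<longleftrightarrow> s i > 0"] D[of i b]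
    by (auto simp: atLeast0LessThan)
  then obtain h where h: "\<And>i b. i < 3 \<Longrightarrow> bij_betw (h i b) {..<len i b} (differ ?N (?A i) (?B i) (b \<longleftrightarrow> s i > 0))"
    by metis
  \<comment> \<open>The negative edge of a negative path is its first one, so all later labels are complemented.\<close>
  define L where "L = (\<lambda>i b j x. (?A i x \<noteq> (x \<in> h i b ` {..<j})) \<noteq> (j > 0 \<and> (b \<longleftrightarrow> s i > 0)))"
  define f where "f = (\<lambda>v. case v of Corner c \<Rightarrow> lab c | Inner i b j \<Rightarrow> L i b j)"
  have f: "f (vx i b j) x = L i b j x" if A: "i < 3" "j \<le> len i b" "x < ?N" for i b j x
  proof -
    consider "j = 0" | "j = len i b" "j > 0" | "0 < j" "j < len i b" using A by linarith
    then show ?thesis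
    proof cases
      case 1 then show ?thesis by (simp add: vx_0 f_def L_def)
    next
      case 2
      have "h i b ` {..<j} = differ ?N (?A i) (?B i) (b \<longleftrightarrow> s i > 0)"
        using h[OF A(1)] 2 by (auto simp: bij_betw_def)
      then show ?thesis using 2 A vx_len[OF A(1)] by (auto simp: f_def L_def differ_def)
    next
      case 3 then show ?thesis by (simp add: vx_inner f_def)
    qed
  qed
  have "labelled ?N G f" unfolding labelled_def
  proof (intro allI impI)
    fix x y assume xy: "{x, y} \<in> edges G"
    then obtain i b j where i: "i < 3" "j < len i b" and e: "{x, y} = ed i b j" by (auto simp: G_def)
    let ?n = "(b \<longleftrightarrow> s i > 0) \<and> j = 0"
    have hN: "h i b j < ?N" using h[OF i(1), of b] i(2) by (auto simp: bij_betw_def differ_def)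
    have "h i b j \<notin> h i b ` {..<j}"
    proof
      assume "h i b j \<in> h i b ` {..<j}"
      then obtain j' where "j' < j" "h i b j = h i b j'" by auto
      then show False using h[OF i(1), of b] i(2) inj_onD[of "h i b" "{..<len i b}" j j']
        by (simp add: bij_betw_def)
    qed
    then have step: "((L i b j x \<noteq> L i b (Suc j) x) \<noteq> ?n) = (x = h i b j)" for x
      unfolding L_def lessThan_Suc image_insert insert_iff
      by (cases "x = h i b j"; cases "x \<in> h i b ` {..<j}"; cases "j = 0"; cases "b \<longleftrightarrow> s i > 0") simp_all
    have "((f (vx i b j) x \<noteq> f (vx i b (Suc j)) x) \<noteq> ?n) = (x = h i b j)" if "x < ?N" for x
    proof -
      have "f (vx i b j) x = L i b j x" "f (vx i b (Suc j)) x = L i b (Suc j) x"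
        using f[OF i(1) _ that] i(2) by simp_all
      then show ?thesis using step[of x] by (simp only:)
    qed
    then have "differ ?N (f (vx i b j)) (f (vx i b (Suc j))) ?n = {x\<in>{..<?N}. x = h i b j}"
      unfolding differ_def by (intro Collect_cong conj_cong refl) (simp only: lessThan_iff)
    then have d: "differ ?N (f (vx i b j)) (f (vx i b (Suc j))) ?n = {h i b j}"
      using hN by auto
    have "f x = f (vx i b j) \<and> f y = f (vx i b (Suc j)) \<or> f y = f (vx i b j) \<and> f x = f (vx i b (Suc j))"
      using e by (auto simp: arc_edge_def doubleton_eq_iff)
    then show "\<exists>d. differ ?N (f x) (f y) ({x, y} \<in> negs G) = {d}"
    proof -
      have "({x, y} \<in> negs G) = ?n" using ed_negs[OF i] e by simp
      then show ?thesis
        using \<open>f x = _ \<and> _ \<or> _\<close> d differ_commute[of ?N "f x" "f y" ?n] by (elim disjE) auto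
    qed
  qed
  then show ?thesis by (rule labelled_girth[OF signed_graph_G])
qed

end

text \<open>The upper bound \<open>2k\<close> for the unbalanced-girth always holds, because the two paths of a pair form an
  unbalanced cycle of length \<open>2k\<close>.\<close>

lemma k_good_iff:
  assumes "2 \<le> k"
  shows "k_good k p q r \<longleftrightarrow> is_weight k p \<and> is_weight k q \<and> is_weight k r \<and>
    tri (2 * int k) (p mod (2 * int k)) (q mod (2 * int k)) (r mod (2 * int k))"
proof (cases "is_weight k p \<and> is_weight k q \<and> is_weight k r")
  case True
  define s where "s = (\<lambda>i::nat. if i = 0 then p else if i = 1 then q else r)"
  interpret T_arcs k s by unfold_locales (use assms True in \<open>auto simp: s_def\<close>)
  have G: "T_graph k p q r = G" unfolding G_def unfolding T_graph_def Let_def s_def by (rule refl)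
  have s: "s 0 = p" "s 1 = q" "s 2 = r" by (auto simp: s_def)
  have e: "even (x mod (2 * int k)) = even x" for x
    using dvd_mod_iff[of 2 "2 * int k" x] by simp
  have "k_good k p q r \<longleftrightarrow> even (p + q + r) \<and> unbalanced_girth G = enat (2 * k)"
    using True by (auto simp: k_good_def is_weight_def G)
  also have "\<dots> \<longleftrightarrow> tri (2 * int k) (p mod (2 * int k)) (q mod (2 * int k)) (r mod (2 * int k))"
  proof
    assume "even (p + q + r) \<and> unbalanced_girth G = enat (2 * k)"
    then show "tri (2 * int k) (p mod (2 * int k)) (q mod (2 * int k)) (r mod (2 * int k))"
      using tri_of_girth unfolding s by auto
  next
    assume t: "tri (2 * int k) (p mod (2 * int k)) (q mod (2 * int k)) (r mod (2 * int k))"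
    then have "even (p + q + r)" by (simp add: tri_def e)
    then show "even (p + q + r) \<and> unbalanced_girth G = enat (2 * k)"
      using girth_of_tri girth_le t unfolding s by auto
  qed
  finally show ?thesis using True by simp
qed (auto simp: k_good_def is_weight_def)

text \<open>For a weight \<open>s\<close> the list \<open>arcs k s\<close> consists of the positive length \<open>s mod 2k\<close> and its complement, in one
  of the two orders.\<close>

lemma good_test_iff:
  assumes "2 \<le> k" "is_weight k p" "is_weight k q" "is_weight k r"
  shows "good_test k p q r \<longleftrightarrow>
    tri (2 * int k) (p mod (2 * int k)) (q mod (2 * int k)) (r mod (2 * int k))"
proof -
  have e: "even (x mod (2 * int k)) = even x" for x
    using dvd_mod_iff[of 2 "2 * int k" x] by simp
  have "tri (2 * int k) (p mod (2 * int k)) (q mod (2 * int k)) (r mod (2 * int k)) \<longleftrightarrow>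
    even (p + q + r) \<and> tri (2 * int k) (p mod (2 * int k)) (q mod (2 * int k)) (r mod (2 * int k))"
  proof -
    have "even (p + q + r)"
      if "tri (2 * int k) (p mod (2 * int k)) (q mod (2 * int k)) (r mod (2 * int k))"
      using that by (simp add: tri_def e)
    then show ?thesis by blast
  qed
  also have "\<dots> \<longleftrightarrow> good_test k p q r"
  proof -
    have A: "set (arcs k x) = {(x mod (2 * int k), False), (2 * int k - x mod (2 * int k), True)}"
      if "is_weight k x" for x
      unfolding weight_mod[OF that assms(1)] using that by (cases "0 < x") (auto simp: arcs_def is_weight_def)
    have R: "x mod (2 * int k) \<in> {0<..<2 * int k}" if "is_weight k x" for x
      using weight_mod[OF that assms(1)] that assms(1) by (auto simp: is_weight_def)
    have ineqs: "(\<forall>(a, na)\<in>set (arcs k p). \<forall>(b, nb)\<in>set (arcs k q). \<forall>(c, nc)\<in>set (arcs k r).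
        (na \<noteq> (nb \<noteq> nc)) \<longrightarrow> 2 * int k \<le> a + b + c) \<longleftrightarrow>
      P \<le> Q + R' \<and> Q \<le> P + R' \<and> R' \<le> P + Q \<and> P + Q + R' \<le> 2 * (2 * int k)"
      if "P = p mod (2 * int k)" "Q = q mod (2 * int k)" "R' = r mod (2 * int k)" for P Q R'
      unfolding A[OF assms(2)] A[OF assms(3)] A[OF assms(4)] that[symmetric] by auto
    show ?thesis
      unfolding tri_def good_test_def ineqs[OF refl refl refl]
      using R[OF assms(2)] R[OF assms(3)] R[OF assms(4)] by (auto simp: e)
  qed
  finally show ?thesis by simp
qed

section \<open>K4 minors and vertices of degree at most two\<close>

definition conn_rel :: "'a sgraph \<Rightarrow> 'a set \<Rightarrow> ('a \<times> 'a) set" where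
  "conn_rel G S = {(x, y). x \<in> S \<and> y \<in> S \<and> {x, y} \<in> edges G}"

definition conn :: "'a sgraph \<Rightarrow> 'a set \<Rightarrow> bool" where
  "conn G S \<longleftrightarrow> (\<forall>x\<in>S. \<forall>y\<in>S. (x, y) \<in> (conn_rel G S)\<^sup>*)"

lemma conn_rel_mono: "S \<subseteq> S' \<Longrightarrow> edges G \<subseteq> edges G' \<Longrightarrow> conn_rel G S \<subseteq> conn_rel G' S'"
  by (auto simp: conn_rel_def)

lemma conn_rel_rtrancl_sym: "(x, y) \<in> (conn_rel G S)\<^sup>* \<Longrightarrow> (y, x) \<in> (conn_rel G S)\<^sup>*"
  by (rule symD[OF sym_rtrancl]) (auto simp: conn_rel_def sym_def insert_commute)

lemma conn_rel_of_walk: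
  "walk G c \<Longrightarrow> set c \<subseteq> S \<Longrightarrow> (hd c, last c) \<in> (conn_rel G S)\<^sup>*"
proof (induction c rule: induct_list012)
  case 1
  then show ?case by (simp add: walk_def)
next
  case (3 x y c)
  then have "(x, y) \<in> conn_rel G S" "(y, last (y # c)) \<in> (conn_rel G S)\<^sup>*"
    by (auto simp: conn_rel_def)
  then show ?case by auto
qed simp

lemma walk_of_conn_rel:
  assumes "(x, y) \<in> (conn_rel G S)\<^sup>*" "x \<in> S" "S \<subseteq> verts G"
  shows "\<exists>c. walk G c \<and> hd c = x \<and> last c = y \<and> set c \<subseteq> S"
  using assms(1)
proof (induction)
  case base
  then show ?case using assms by (intro exI[of _ "[x]"]) auto
next
  case (step y z)
  then obtain c where c: "walk G c" "hd c = x" "last c = y" "set c \<subseteq> S" by blast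
  then have "c \<noteq> []" by (simp add: walk_def)
  then show ?case using c step(2) assms(3)
    by (intro exI[of _ "c @ [z]"]) (auto simp: walk_append conn_rel_def)
qed

lemma connected_in_iff:
  assumes "S \<subseteq> verts G"
  shows "connected_in G S \<longleftrightarrow> conn G S"
proof
  assume "connected_in G S"
  then have "\<exists>c. walk G c \<and> hd c = x \<and> last c = y \<and> set c \<subseteq> S" if "x \<in> S" "y \<in> S" for x y
    using that by (fastforce simp: connected_in_def path_def)
  then show "conn G S"
    unfolding conn_def by (metis conn_rel_of_walk)
next
  assume C: "conn G S"
  show "connected_in G S" unfolding connected_in_def
  proof (intro ballI)
    fix x y assume xy: "x \<in> S" "y \<in> S"
    let ?P = "\<lambda>c. walk G c \<and> hd c = x \<and> last c = y \<and> set c \<subseteq> S"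
    have "\<exists>c. ?P c" using walk_of_conn_rel[OF _ xy(1) assms] C xy by (auto simp: conn_def)
    then obtain c where c: "?P c" "\<And>c'. ?P c' \<Longrightarrow> length c \<le> length c'"
      using ex_has_least_nat[of ?P _ length] by blast
    have "distinct c"
    proof (rule ccontr)
      assume "\<not> distinct c"
      then obtain c' where "walk G c'" "hd c' = hd c" "last c' = last c" "length c' < length c" "set c' \<subseteq> set c"
        using shorter_walk[of G c] c(1) by blast
      then show False using c(1) c(2)[of c'] by auto
    qed
    then show "\<exists>c. path G x y c \<and> set c \<subseteq> S" using c(1) by (auto simp: path_def)
  qed
qed

definition touching :: "'a sgraph \<Rightarrow> 'a set \<Rightarrow> 'a set \<Rightarrow> bool" where
  "touching G A B \<longleftrightarrow> (\<exists>a\<in>A. \<exists>b\<in>B. {a, b} \<in> edges G)"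

lemma touching_sym: "touching G A B \<Longrightarrow> touching G B A"
  unfolding touching_def by (metis insert_commute)

lemma conn_Un:
  assumes "conn G A" "conn G B" "touching G A B"
  shows "conn G (A \<union> B)"
proof -
  let ?R = "(conn_rel G (A \<union> B))\<^sup>*"
  have A: "(x, y) \<in> ?R" if "x \<in> A" "y \<in> A" for x y
    using assms(1) that rtrancl_mono[OF conn_rel_mono[of A "A \<union> B" G G]] by (auto simp: conn_def)
  have B: "(x, y) \<in> ?R" if "x \<in> B" "y \<in> B" for x y
    using assms(2) that rtrancl_mono[OF conn_rel_mono[of B "A \<union> B" G G]] by (auto simp: conn_def)
  obtain a b where ab: "a \<in> A" "b \<in> B" "(a, b) \<in> ?R"
    using assms(3) by (auto simp: touching_def conn_rel_def)
  have AB: "(x, y) \<in> ?R" if "x \<in> A" "y \<in> B" for x y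
    using A[OF that(1) ab(1)] ab(3) B[OF ab(2) that(2)] by simp
  then show ?thesis unfolding conn_def using A B AB conn_rel_rtrancl_sym by (metis Un_iff)
qed

text \<open>The relation \<open>E\<close> is any graph all of whose edges are realized by branch sets that touch.  Edges of the
  minor may be deleted at will, and it is not fixed in advance which minor is considered; both are
  needed for inductions over minors of \<open>G\<close>.\<close>

definition minor_model :: "'a sgraph \<Rightarrow> nat set \<Rightarrow> (nat \<Rightarrow> 'a set) \<Rightarrow> (nat \<Rightarrow> nat \<Rightarrow> bool) \<Rightarrow> bool" where
  "minor_model G V f E \<longleftrightarrow>
     finite V \<and>
     (\<forall>x\<in>V. f x \<noteq> {} \<and> f x \<subseteq> verts G \<and> conn G (f x)) \<and>
     (\<forall>x\<in>V. \<forall>y\<in>V. x \<noteq> y \<longrightarrow> f x \<inter> f y = {}) \<and>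
     (\<forall>x y. E x y \<longrightarrow> x \<in> V \<and> y \<in> V \<and> x \<noteq> y \<and> E y x \<and> touching G (f x) (f y))"

lemma minor_modelD:
  assumes "minor_model G V f E"
  shows "finite V" "x \<in> V \<Longrightarrow> f x \<noteq> {}" "x \<in> V \<Longrightarrow> f x \<subseteq> verts G" "x \<in> V \<Longrightarrow> conn G (f x)"
    "x \<in> V \<Longrightarrow> y \<in> V \<Longrightarrow> x \<noteq> y \<Longrightarrow> f x \<inter> f y = {}"
    "E x y \<Longrightarrow> x \<in> V" "E x y \<Longrightarrow> y \<in> V" "E x y \<Longrightarrow> x \<noteq> y" "E x y \<Longrightarrow> E y x"
    "E x y \<Longrightarrow> touching G (f x) (f y)"
  using assms unfolding minor_model_def by blast+

lemma K4_minorI: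
  assumes "\<And>S. S \<in> {A, B, C, D} \<Longrightarrow> S \<noteq> {} \<and> S \<subseteq> verts G \<and> conn G S"
    "A \<inter> B = {}" "A \<inter> C = {}" "A \<inter> D = {}" "B \<inter> C = {}" "B \<inter> D = {}" "C \<inter> D = {}"
    "touching G A B" "touching G A C" "touching G A D" "touching G B C" "touching G B D" "touching G C D"
  shows "\<not> K4_minor_free G"
proof -
  define S where "S = (\<lambda>i::nat. if i = 0 then A else if i = 1 then B else if i = 2 then C else D)"
  have 1: "S i \<noteq> {} \<and> S i \<subseteq> verts G \<and> connected_in G (S i)" for i
    using assms(1)[of "S i"] connected_in_iff[of "S i" G] by (auto simp: S_def)
  have lt4: "i < 4 \<Longrightarrow> i = 0 \<or> i = 1 \<or> i = 2 \<or> i = (3::nat)" for i by auto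
  have 2: "S i \<inter> S j = {} \<and> touching G (S i) (S j)" if "i < 4" "j < 4" "i \<noteq> j" for i j
    using lt4[OF that(1)] lt4[OF that(2)] that(3) assms(2-13) assms(8-13)[THEN touching_sym]
    by (elim disjE) (simp_all add: S_def Int_commute)
  show ?thesis unfolding K4_minor_free_def not_not
    using 1 2 by (intro exI[of _ S]) (auto simp: touching_def)
qed

text \<open>The branch sets over a connected set of vertices of the minor form one branch set.\<close>

lemma conn_UN:
  assumes m: "minor_model G V f E" and C: "C \<subseteq> V" "c \<in> C"
    and r: "\<And>w. w \<in> C \<Longrightarrow> (c, w) \<in> {(x, y). x \<in> C \<and> y \<in> C \<and> E x y}\<^sup>*"
  shows "conn G (\<Union>w\<in>C. f w)"
proof -
  let ?U = "\<Union>w\<in>C. f w"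
  let ?R = "(conn_rel G ?U)\<^sup>*"
  have f: "(x, y) \<in> ?R" if "w \<in> C" "x \<in> f w" "y \<in> f w" for x y w
  proof -
    have "(x, y) \<in> (conn_rel G (f w))\<^sup>*"
      using minor_modelD(4)[OF m] that C unfolding conn_def by blast
    moreover have "conn_rel G (f w) \<subseteq> conn_rel G ?U" using that by (intro conn_rel_mono) auto
    ultimately show ?thesis using rtrancl_mono by blast
  qed
  have 1: "\<forall>x\<in>f c. \<forall>y\<in>f w. (x, y) \<in> ?R" if "w \<in> C" for w
    using r[OF that]
  proof (induction)
    case base
    then show ?case using f C by blast
  next
    case (step v w)
    then have vw: "v \<in> C" "w \<in> C" "E v w" by auto
    then obtain a b where ab: "a \<in> f v" "b \<in> f w" "{a, b} \<in> edges G"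
      using minor_modelD(10)[OF m] unfolding touching_def by blast
    then have "(a, b) \<in> ?R" using vw by (intro r_into_rtrancl) (auto simp: conn_rel_def)
    then show ?case using step(3) ab(1) f[OF vw(2) ab(2)] by (meson rtrancl_trans)
  qed
  have "f c \<noteq> {}" using minor_modelD(2)[OF m] C by blast
  then obtain z where "z \<in> f c" by blast
  then have z: "(z, y) \<in> ?R" if "y \<in> ?U" for y using 1 that by blast
  show ?thesis unfolding conn_def
  proof (intro ballI)
    fix x y assume "x \<in> ?U" "y \<in> ?U"
    then show "(x, y) \<in> ?R" using z[of x] z[of y] conn_rel_rtrancl_sym by (meson rtrancl_trans)
  qed
qed

text \<open>The vertex \<open>x\<close> disappears into \<open>y\<close>.\<close>

definition contract :: "(nat \<Rightarrow> nat \<Rightarrow> bool) \<Rightarrow> nat \<Rightarrow> nat \<Rightarrow> nat \<Rightarrow> nat \<Rightarrow> bool" where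
  "contract E x y a b \<longleftrightarrow>
     a \<noteq> x \<and> b \<noteq> x \<and> a \<noteq> b \<and> (E a b \<or> a = y \<and> E x b \<or> b = y \<and> E a x)"

lemma minor_model_contract:
  assumes m: "minor_model G V f E" and e: "E x y"
  shows "minor_model G (V - {x}) (f(y := f x \<union> f y)) (contract E x y)"
proof -
  note D = minor_modelD[OF m]
  have xy: "x \<in> V" "y \<in> V" "x \<noteq> y" "touching G (f x) (f y)" using D(6-8,10)[OF e] by simp_all
  let ?f = "f(y := f x \<union> f y)"
  have c: "conn G (f x \<union> f y)" using D xy by (intro conn_Un) auto
  have t: "touching G (?f a) (?f b)" if "contract E x y a b" for a b
  proof -
    have "touching G (f a) (f b) \<or> a = y \<and> touching G (f x) (f b) \<or> b = y \<and> touching G (f a) (f x)"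
      using that D(10) by (auto simp: contract_def)
    then show ?thesis by (auto simp: touching_def)
  qed
  have E: "a \<in> V - {x} \<and> b \<in> V - {x} \<and> a \<noteq> b \<and> contract E x y b a" if "contract E x y a b" for a b
    using that D(6,7,9) xy unfolding contract_def by blast
  show ?thesis unfolding minor_model_def
  proof (intro conjI ballI allI impI)
    fix a assume a: "a \<in> V - {x}"
    then show "?f a \<noteq> {}" "?f a \<subseteq> verts G" "conn G (?f a)" using D(2-4) xy c by auto
    fix b assume b: "b \<in> V - {x}" "a \<noteq> b"
    have "f a \<inter> f b = {}" "f a \<inter> f x = {}" "f x \<inter> f b = {}" using D(5) a b xy by blast+
    then show "?f a \<inter> ?f b = {}" using b by auto
  qed (use D(1) E t in blast)+
qed

lemma minor_model_restrict:
  "minor_model G V f E \<Longrightarrow> A \<subseteq> V \<Longrightarrow> minor_model G A f (\<lambda>x y. E x y \<and> x \<in> A \<and> y \<in> A)"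
  unfolding minor_model_def by (intro conjI) (blast intro: finite_subset)+

text \<open>Cutting a path at its first visit to \<open>a\<close>.\<close>

lemma rtrancl_last_step_into:
  assumes "(c, y) \<in> R\<^sup>*" "c \<noteq> a"
  shows "(\<exists>w. (c, w) \<in> {(x, y). (x, y) \<in> R \<and> x \<noteq> a \<and> y \<noteq> a}\<^sup>* \<and> w \<noteq> a \<and> (w, a) \<in> R) \<or>
    y \<noteq> a \<and> (c, y) \<in> {(x, y). (x, y) \<in> R \<and> x \<noteq> a \<and> y \<noteq> a}\<^sup>*" (is "?A \<or> ?B y")
  using assms(1)
proof (induction)
  case base
  then show ?case using assms(2) by simp
next
  case (step y z)
  from step(3) show ?case
  proof
    assume B: "?B y"
    show ?thesis
    proof (cases "z = a")
      case True
      then show ?thesis using B step(2) by blast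
    next
      case False
      then have "(y, z) \<in> {(x, y). (x, y) \<in> R \<and> x \<noteq> a \<and> y \<noteq> a}" using B step(2) by simp
      then show ?thesis using B False by (meson rtrancl.rtrancl_into_rtrancl)
    qed
  qed blast
qed

text \<open>Every graph of minimum degree at least three has a \<open>K4\<close> minor.  The exceptional vertex \<open>v0\<close>, whose degree is
  arbitrary, makes the induction on the number of vertices work; it need not belong to the graph.

  Suppose there is no \<open>K4\<close> minor.  Then no contraction of an edge \<open>xy\<close> with \<open>x \<noteq> v0\<close> preserves the
  assumption on the degrees: either \<open>x\<close> and \<open>y\<close> have a common neighbour of degree exactly three, or the
  merged vertex has degree at most two.  This gives a vertex \<open>z \<noteq> v0\<close> of degree three, with two
  nonadjacent neighbours \<open>a\<close>, \<open>c\<close>, and it turns out that the third neighbour \<open>b\<close> has the neighbours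
  \<open>z\<close>, \<open>a\<close>, \<open>c\<close>.  If \<open>a\<close> and \<open>c\<close> are connected outside \<open>z\<close> and \<open>b\<close>, contracting all that \<open>c\<close> reaches
  there without \<open>a\<close> gives a \<open>K4\<close>.  Otherwise \<open>{z, b}\<close> separates \<open>a\<close> from \<open>c\<close>, and on the side that does not contain \<open>v0\<close> only
  \<open>a\<close> (or \<open>c\<close>) loses neighbours; this smaller graph has it as its exceptional vertex.\<close>

lemma K4_minor_of_min_degree_3:
  assumes "minor_model G V f E" "w0 \<in> V" "w0 \<noteq> v0"
    "\<And>w. w \<in> V \<Longrightarrow> w \<noteq> v0 \<Longrightarrow> 3 \<le> card {y. E w y}"
  shows "\<not> K4_minor_free G"
  using assms
proof (induction "card V" arbitrary: V f E v0 w0 rule: less_induct)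
  case less
  note m = less.prems(1) and deg = less.prems(4)
  have fV: "finite V" by (rule minor_modelD(1)[OF m])
  have E: "x \<in> V \<and> y \<in> V \<and> x \<noteq> y \<and> E y x" if "E x y" for x y
    using minor_modelD(6-9)[OF m that] by simp
  have fN: "finite {y. E x y}" for x by (rule finite_subset[OF _ fV]) (use E in auto)
  have contracting: ?thesis
    if xy: "x \<noteq> v0" "E x y" and c1: "\<And>w. w \<noteq> v0 \<Longrightarrow> E w x \<Longrightarrow> E w y \<Longrightarrow> 4 \<le> card {u. E w u}"
      and c2: "y \<noteq> v0 \<Longrightarrow> 3 \<le> card ({u. E x u} \<union> {u. E y u} - {x, y})" for x y
  proof -
    let ?E = "contract E x y"
    have xV: "x \<in> V" "y \<in> V" "x \<noteq> y" using E xy by auto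
    have "3 \<le> card {u. E x u}" using deg xV xy by auto
    then have "\<exists>w. E x w \<and> w \<noteq> v0"
    proof (rule_tac ccontr)
      assume "3 \<le> card {u. E x u}" "\<nexists>w. E x w \<and> w \<noteq> v0"
      then have "{u. E x u} \<subseteq> {v0}" by auto
      from card_mono[OF _ this] show False using \<open>3 \<le> _\<close> by simp
    qed
    then obtain w1 where w1: "w1 \<in> V - {x}" "w1 \<noteq> v0" using E by blast
    have d: "3 \<le> card {u. ?E w u}" if w: "w \<in> V - {x}" "w \<noteq> v0" for w
    proof (cases "w = y")
      case True
      have "{u. ?E y u} = {u. E x u} \<union> {u. E y u} - {x, y}"
        using xV E by (auto simp: contract_def)
      then show ?thesis using c2 True w by simp
    next
      case False
      have fN': "finite {u. ?E w u}"
        using minor_modelD(7)[OF minor_model_contract[OF m xy(2)]] by (intro finite_subset[OF _ fV]) auto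
      show ?thesis
      proof (cases "E w x")
        case wx: True
        show ?thesis
        proof (cases "E w y")
          case True
          have "{u. E w u} \<subseteq> insert x {u. ?E w u}"
            using w E by (auto simp: contract_def)
          from card_mono[OF _ this] fN' have "card {u. E w u} \<le> Suc (card {u. ?E w u})"
            by (auto simp: card_insert_if split: if_splits)
          then show ?thesis using c1[OF w(2) wx True] by simp
        next
          case nwy: False
          have "insert y ({u. E w u} - {x}) \<subseteq> {u. ?E w u}"
            using w False wx E xV by (auto simp: contract_def)
          from card_mono[OF fN' this] have "card {u. E w u} \<le> card {u. ?E w u}"
            using nwy wx fN[of w] by (simp add: card_Diff_singleton)
          then show ?thesis using deg[of w] w by simp
        qed
      next
        case nwx: False
        have "{u. E w u} \<subseteq> {u. ?E w u}" using w E nwx by (auto simp: contract_def)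
        from card_mono[OF fN' this] show ?thesis using deg[of w] w by simp
      qed
    qed
    have "card (V - {x}) < card V" using xV fV by (meson card_Diff1_less)
    from less.hyps[OF this minor_model_contract[OF m xy(2)] w1] d show ?thesis by blast
  qed
  show ?case
  proof (rule ccontr)
    assume free: "\<not> \<not> K4_minor_free G"
    \<comment> \<open>The two reasons for which a contraction can fail.\<close>
    have fail: "(\<exists>w. w \<noteq> v0 \<and> E w x \<and> E w y \<and> card {u. E w u} = 3) \<or>
        (y \<noteq> v0 \<and> card ({u. E x u} \<union> {u. E y u} - {x, y}) \<le> 2)" if "x \<noteq> v0" "E x y" for x y
    proof (rule ccontr)
      assume A: "\<not> ?thesis"
      have "4 \<le> card {u. E w u}" if "w \<noteq> v0" "E w x" "E w y" for w
      proof -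
        have "card {u. E w u} \<noteq> 3" using A that by blast
        moreover have "3 \<le> card {u. E w u}" using deg that E by blast
        ultimately show ?thesis by simp
      qed
      moreover have "3 \<le> card ({u. E x u} \<union> {u. E y u} - {x, y})" if "y \<noteq> v0" using A that by auto
      ultimately show False using contracting[OF that] free by blast
    qed
    obtain z where z: "z \<noteq> v0" "z \<in> V" "card {u. E z u} = 3"
    proof -
      have "3 \<le> card {u. E w0 u}" using less.prems by blast
      then obtain y where y: "E w0 y" by (metis Collect_empty_eq card.empty not_numeral_le_zero)
      from fail[OF less.prems(3) y] show ?thesis
      proof
        assume "\<exists>w. w \<noteq> v0 \<and> E w w0 \<and> E w y \<and> card {u. E w u} = 3"
        then show ?thesis using that E by blast
      next
        assume A: "y \<noteq> v0 \<and> card ({u. E w0 u} \<union> {u. E y u} - {w0, y}) \<le> 2"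
        have "{u. E w0 u} \<subseteq> insert y ({u. E w0 u} \<union> {u. E y u} - {w0, y})" using E by auto
        from card_mono[OF _ this] have "card {u. E w0 u} \<le> 3"
          using A fN by (auto simp: card_insert_if split: if_splits)
        then show ?thesis using that[of w0] less.prems(2,3) \<open>3 \<le> _\<close> by simp
      qed
    qed
    have nb: "(\<exists>w. w \<noteq> v0 \<and> E z w \<and> E w a \<and> card {u. E w u} = 3) \<or> (\<forall>w. E z w \<longrightarrow> w \<noteq> a \<longrightarrow> E a w)"
      if a: "E z a" for a
    proof -
      from fail[OF z(1) a] show ?thesis
      proof
        assume A: "a \<noteq> v0 \<and> card ({u. E z u} \<union> {u. E a u} - {z, a}) \<le> 2"
        have "{u. E z u} - {a} \<subseteq> {u. E z u} \<union> {u. E a u} - {z, a}" using E by auto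
        moreover have c2: "card ({u. E z u} - {a}) = 2" using z(3) a by simp
        ultimately have eq: "{u. E z u} - {a} = {u. E z u} \<union> {u. E a u} - {z, a}"
          using A fN by (intro card_seteq) auto
        have "{u. E a u} - {z} \<subseteq> {u. E z u} - {a}" using eq E by auto
        moreover have "3 \<le> card {u. E a u}" using deg a A E by blast
        then have "card ({u. E z u} - {a}) \<le> card ({u. E a u} - {z})"
          using c2 card_Diff_singleton[of z "{u. E a u}"] a E by auto
        ultimately have "{u. E a u} - {z} = {u. E z u} - {a}" using fN by (intro card_seteq) auto
        then show ?thesis by blast
      qed (use E in blast)
    qed
    have f: "f x \<noteq> {} \<and> f x \<subseteq> verts G \<and> conn G (f x)" if "x \<in> V" for x
      using minor_modelD(2-4)[OF m that] by simp
    have dis: "f x \<inter> f y = {}" if "x \<in> V" "y \<in> V" "x \<noteq> y" for x y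
      by (rule minor_modelD(5)[OF m that])
    have tou: "touching G (f x) (f y)" if "E x y" for x y by (rule minor_modelD(10)[OF m that])
    have noK4: "\<not> (E z a \<and> E z b \<and> E z c \<and> E a b \<and> E a c \<and> E b c)" for a b c
    proof
      assume A: "E z a \<and> E z b \<and> E z c \<and> E a b \<and> E a c \<and> E b c"
      then have "z \<in> V \<and> a \<in> V \<and> b \<in> V \<and> c \<in> V \<and> z \<noteq> a \<and> z \<noteq> b \<and> z \<noteq> c \<and> a \<noteq> b \<and> a \<noteq> c \<and> b \<noteq> c"
        using E by blast
      then have "\<not> K4_minor_free G"
        using A f dis tou by (intro K4_minorI[of "f z" "f a" "f b" "f c" G]) auto
      then show False using free by blast
    qed
    obtain a c where ac: "E z a" "E z c" "a \<noteq> c" "\<not> E a c"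
    proof -
      obtain x1 x2 x3 where N: "{u. E z u} = {x1, x2, x3}" "x1 \<noteq> x2" "x1 \<noteq> x3" "x2 \<noteq> x3"
        using z(3) by (auto simp: card_3_iff)
      then have "E z x1" "E z x2" "E z x3" by auto
      then show ?thesis using noK4[of x1 x2 x3] that N by blast
    qed
    then have "card ({u. E z u} - {a, c}) = 1" using z(3) by (subst card_Diff_subset) auto
    then obtain b where b: "{u. E z u} - {a, c} = {b}" by (auto simp: card_1_singleton_iff)
    then have Nz: "{u. E z u} = {a, b, c}" using ac by auto
    have abc: "a \<noteq> b" "b \<noteq> c" "E z b" using b by auto
    have Nz': "w = a \<or> w = b \<or> w = c" if "E z w" for w using Nz that by blast
    have irr: "\<not> E w w" for w using E[of w w] by blast
    have ca: "\<not> E c a" using E[of c a] ac(4) by blast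
    have "b \<noteq> v0 \<and> E b a \<and> card {u. E b u} = 3"
      using nb[OF ac(1)]
    proof
      assume "\<exists>w. w \<noteq> v0 \<and> E z w \<and> E w a \<and> card {u. E w u} = 3"
      then obtain w where w: "w \<noteq> v0" "E z w" "E w a" "card {u. E w u} = 3" by blast
      then have "w = b" using Nz'[OF w(2)] irr ca by metis
      then show ?thesis using w by simp
    qed (use ac in auto)
    moreover have "E b c"
      using nb[OF ac(2)]
    proof
      assume "\<exists>w. w \<noteq> v0 \<and> E z w \<and> E w c \<and> card {u. E w u} = 3"
      then obtain w where w: "E z w" "E w c" by blast
      then have "w = b" using Nz'[OF w(1)] irr ac(4) by metis
      then show ?thesis using w by simp
    qed (use ac ca in auto)
    ultimately have bp: "b \<noteq> v0" "E b a" "E b c" "card {u. E b u} = 3" by auto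
    have "{z, a, c} = {u. E b u}" using bp abc ac E
      by (intro card_subset_eq fN) (auto simp: card_insert_if)
    then have Nb: "{u. E b u} = {z, a, c}" by simp
    have V: "z \<in> V" "a \<in> V" "b \<in> V" "c \<in> V" "z \<noteq> a" "z \<noteq> b" "z \<noteq> c"
      using E[OF ac(1)] E[OF ac(2)] E[OF abc(3)] by simp_all
    define R where "R = {(x, y). E x y \<and> x \<notin> {z, b} \<and> y \<notin> {z, b}}"
    have symR: "(x, y) \<in> R\<^sup>* \<Longrightarrow> (y, x) \<in> R\<^sup>*" for x y
      by (rule symD[OF sym_rtrancl]) (use E in \<open>auto simp: R_def sym_def\<close>)
    have RV: "y \<in> V \<and> y \<notin> {z, b}" if "(x, y) \<in> R\<^sup>*" "x \<in> V" "x \<notin> {z, b}" for x y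
      using that(1) by (induction) (use that E in \<open>auto simp: R_def\<close>)
    have side: False
      if a: "a' \<in> {a, c}" and c: "{a', c'} = {a, c}" and v0: "(a', v0) \<notin> R\<^sup>*" and sep: "(a', c') \<notin> R\<^sup>*" for a' c'
    proof -
      define A where "A = {w. (a', w) \<in> R\<^sup>*}"
      have a'V: "a' \<in> V" "a' \<notin> {z, b}" using a V abc by auto
      have AV: "A \<subseteq> V" "z \<notin> A" "b \<notin> A" "c' \<notin> A" "v0 \<notin> A" "a' \<in> A"
        using RV[OF _ a'V] sep v0 by (auto simp: A_def)
      have cl: "y \<in> A" if "w \<in> A" "E w y" "y \<notin> {z, b}" for w y
      proof -
        have "(w, y) \<in> R" using that AV by (auto simp: R_def)
        then show ?thesis using that(1) unfolding A_def by (auto intro: rtrancl_into_rtrancl)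
      qed
      let ?E = "\<lambda>x y. E x y \<and> x \<in> A \<and> y \<in> A"
      have "a' \<noteq> v0" using AV by auto
      then have "3 \<le> card {u. E a' u}" using deg a'V by blast
      moreover have "card ({u. E a' u} - {z, b}) \<ge> card {u. E a' u} - card {z, b}"
        by (rule diff_card_le_card_Diff) simp
      ultimately have "card ({u. E a' u} - {z, b}) \<noteq> 0" using V by simp
      then obtain d where d: "E a' d" "d \<notin> {z, b}" by (metis Diff_iff card.empty ex_in_conv mem_Collect_eq)
      then have dA: "d \<in> A" "d \<noteq> a'" using cl AV E by auto
      have "3 \<le> card {u. ?E w u}" if w: "w \<in> A" "w \<noteq> a'" for w
      proof -
        have wv: "w \<notin> {a, c}" using w AV c by (auto simp: doubleton_eq_iff)
        have "w \<noteq> z" "w \<noteq> b" using AV w by auto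
        have "\<not> E w z" using Nz' E[of w z] wv \<open>w \<noteq> b\<close> by auto
        moreover have "\<not> E w b"
        proof
          assume "E w b"
          then have "w \<in> {u. E b u}" using E[of w b] by blast
          then show False using wv \<open>w \<noteq> z\<close> unfolding Nb by simp
        qed
        ultimately have "{u. ?E w u} = {u. E w u}" using cl[OF w(1)] w by auto
        then show ?thesis using deg[of w] w AV by auto
      qed
      moreover have "card A < card V" using AV V fV by (intro psubset_card_mono) auto
      ultimately have "\<not> K4_minor_free G"
        using less.hyps[OF _ minor_model_restrict[OF m AV(1)] dA] by blast
      then show False using free by blast
    qed
    show False
    proof (cases "(c, a) \<in> R\<^sup>*")
      case True
      \<comment> \<open>The vertices that \<open>c\<close> reaches without \<open>a\<close>, \<open>z\<close>, \<open>b\<close> form one branch set; the others are those of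
        \<open>z\<close>, \<open>b\<close> and \<open>a\<close>.\<close>
      define Ra where "Ra = {(x, y). (x, y) \<in> R \<and> x \<noteq> a \<and> y \<noteq> a}"
      define C where "C = {w. (c, w) \<in> Ra\<^sup>*}"
      from rtrancl_last_step_into[OF True, of a] ac(3)
      obtain w where w: "w \<in> C" "(w, a) \<in> R" unfolding C_def Ra_def by auto
      have Cc: "c \<in> C" by (simp add: C_def)
      have CV: "x \<in> V \<and> x \<noteq> z \<and> x \<noteq> b \<and> x \<noteq> a" if "x \<in> C" for x
        using that unfolding C_def mem_Collect_eq
        by (induction) (use V abc ac E in \<open>auto simp: Ra_def R_def\<close>)
      let ?U = "\<Union>x\<in>C. f x"
      have "(c, x) \<in> {(x, y). x \<in> C \<and> y \<in> C \<and> E x y}\<^sup>*" if "x \<in> C" for x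
        using that unfolding C_def mem_Collect_eq
      proof (induction)
        case (step x y)
        then have "(x, y) \<in> {(x, y). (c, x) \<in> Ra\<^sup>* \<and> (c, y) \<in> Ra\<^sup>* \<and> E x y}"
          by (auto simp: Ra_def R_def intro: rtrancl_into_rtrancl)
        then show ?case using step(3) by (meson rtrancl.rtrancl_into_rtrancl)
      qed simp
      then have "conn G ?U" using CV Cc by (intro conn_UN[OF m]) auto
      moreover have "?U \<noteq> {}" using Cc f[OF V(4)] by blast
      moreover have "?U \<subseteq> verts G" using CV f by blast
      moreover have "touching G (f z) ?U" "touching G (f b) ?U" "touching G (f a) ?U"
      proof -
        have "touching G (f a) (f w)" using w(2) E tou unfolding R_def by blast
        then show "touching G (f z) ?U" "touching G (f b) ?U" "touching G (f a) ?U"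
          using tou[OF ac(2)] tou[OF bp(3)] Cc w(1) unfolding touching_def by blast+
      qed
      moreover have "f z \<inter> ?U = {}" "f b \<inter> ?U = {}" "f a \<inter> ?U = {}"
      proof -
        have "f v \<inter> ?U = {}" if "v \<in> V" "v \<notin> C" for v using CV dis that by fastforce
        then show "f z \<inter> ?U = {}" "f b \<inter> ?U = {}" "f a \<inter> ?U = {}" using CV V by blast+
      qed
      moreover have "f z \<inter> f b = {}" "f z \<inter> f a = {}" "f b \<inter> f a = {}"
        using dis V abc by simp_all
      moreover have "touching G (f z) (f b)" "touching G (f z) (f a)" "touching G (f b) (f a)"
        using tou abc(3) ac(1) bp(2) by simp_all
      ultimately have "\<not> K4_minor_free G"
        using f[OF V(1)] f[OF V(2)] f[OF V(3)]
        by (intro K4_minorI[of "f z" "f b" "f a" ?U G]) auto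
      then show False using free by blast
    next
      case False
      show False
      proof (cases "(a, v0) \<in> R\<^sup>*")
        case True
        then have "(c, v0) \<notin> R\<^sup>*" using False symR by (meson rtrancl_trans)
        then show False using side[of c a] False by auto
      next
        case nv: False
        then show False using side[of a c] False symR by auto
      qed
    qed
  qed
qed

lemma minor_model_degree_le_2:
  assumes "minor_model G V f E" "V \<noteq> {}" "K4_minor_free G"
  obtains z where "z \<in> V" "card {y. E z y} \<le> 2"
proof (rule ccontr)
  assume A: "\<not> thesis"
  obtain v0 where "v0 \<notin> V" using assms(1) ex_new_if_finite[of V] infinite_UNIV_nat
    minor_modelD(1)[OF assms(1)] by blast
  moreover obtain w0 where "w0 \<in> V" using assms(2) by blast
  ultimately have "\<not> K4_minor_free G"
    using A that by (intro K4_minor_of_min_degree_3[OF assms(1), of w0 v0]) force+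
  then show False using assms(3) by blast
qed

section \<open>Weighted graphs without short unbalanced closed walks\<close>

text \<open>An edge of residue \<open>a\<close> stands for a positive path of length \<open>a\<close> and a negative path of length \<open>N - a\<close>
  between its ends; a weighted walk chooses one of the two each time it uses the edge.\<close>

definition elen :: "int \<Rightarrow> int \<Rightarrow> bool \<Rightarrow> int" where
  "elen N a t = (if t then N - a else a)"

inductive wwalk :: "int \<Rightarrow> (nat \<Rightarrow> nat \<Rightarrow> bool) \<Rightarrow> (nat \<Rightarrow> nat \<Rightarrow> int) \<Rightarrow> nat \<Rightarrow> nat \<Rightarrow> bool \<Rightarrow> int \<Rightarrow> bool"
  for N E d where
  wwalk_nil: "wwalk N E d x x False 0"
| wwalk_step: "wwalk N E d x y s l \<Longrightarrow> E y z \<Longrightarrow> wwalk N E d x z (s \<noteq> t) (l + elen N (d y z) t)"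

text \<open>No unbalanced closed walk is shorter than \<open>N\<close>.  For even \<open>N\<close> the
  colouring is the bipartition of the graph in which every edge is replaced by its two paths,
  restricted to the original vertices.\<close>

definition weighted :: "int \<Rightarrow> (nat \<Rightarrow> bool) \<Rightarrow> (nat \<Rightarrow> nat \<Rightarrow> bool) \<Rightarrow> (nat \<Rightarrow> nat \<Rightarrow> int) \<Rightarrow> bool" where
  "weighted N col E d \<longleftrightarrow>
     (\<forall>x y. E x y \<longrightarrow> E y x \<and> d y x = d x y \<and> 0 < d x y \<and> d x y < N \<and> (odd (d x y) \<longleftrightarrow> col x \<noteq> col y)) \<and>
     (\<forall>x l. wwalk N E d x x True l \<longrightarrow> N \<le> l)"

lemma weightedD:
  assumes "weighted N col E d"
  shows "E x y \<Longrightarrow> E y x" "E x y \<Longrightarrow> d y x = d x y" "E x y \<Longrightarrow> 0 < d x y" "E x y \<Longrightarrow> d x y < N"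
    "E x y \<Longrightarrow> odd (d x y) \<longleftrightarrow> col x \<noteq> col y" "wwalk N E d x x True l \<Longrightarrow> N \<le> l"
  using assms unfolding weighted_def by blast+

lemma wwalk_trans:
  assumes "wwalk N E d y z t m" "wwalk N E d x y s l"
  shows "wwalk N E d x z (s \<noteq> t) (l + m)"
  using assms
proof (induction)
  case (wwalk_nil y)
  then show ?case by simp
next
  case (wwalk_step y a t m b t')
  have "wwalk N E d x b ((s \<noteq> t) \<noteq> t') (l + m + elen N (d a b) t')"
    using wwalk_step by (intro wwalk.wwalk_step) auto
  moreover have "((s \<noteq> t) \<noteq> t') = (s \<noteq> (t \<noteq> t'))" by blast
  ultimately show ?case by (simp only: add.assoc)
qed

lemma wwalk_edge: "E x y \<Longrightarrow> wwalk N E d x y t (elen N (d x y) t)"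
  using wwalk_step[OF wwalk_nil, of E x y N d t] by simp

lemma wwalk_sym:
  assumes "weighted N col E d" "wwalk N E d x y s l"
  shows "wwalk N E d y x s l"
  using assms(2)
proof (induction)
  case (wwalk_nil x)
  then show ?case by (rule wwalk.wwalk_nil)
next
  case (wwalk_step x y s l z t)
  have "wwalk N E d z y t (elen N (d y z) t)"
    using wwalk_edge[of E z y N d t] weightedD(1,2)[OF assms(1) wwalk_step(2)] by simp
  from wwalk_trans[OF wwalk_step(3) this] show ?case by (simp add: eq_commute[of s] add.commute)
qed

lemma wwalk_mono:
  assumes "wwalk N E d x y s l" "\<And>x y. E x y \<Longrightarrow> E' x y \<and> d' x y = d x y"
  shows "wwalk N E' d' x y s l"
  using assms(1)
proof (induction)
  case (wwalk_step x y s l z t)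
  then show ?case using wwalk.wwalk_step[OF wwalk_step(3), of z t] assms(2)[OF wwalk_step(2)] by simp
qed (rule wwalk_nil)

lemma weighted_mono:
  assumes "weighted N col E' d'" "\<And>x y. E x y \<Longrightarrow> E' x y \<and> d' x y = d x y" "\<And>x y. E x y \<Longrightarrow> E y x"
  shows "weighted N col E d"
  unfolding weighted_def
proof (intro conjI allI impI)
  fix x y assume e: "E x y"
  note e' = assms(2)[OF e] assms(2)[OF assms(3)[OF e]]
  show "E y x" by (rule assms(3)[OF e])
  show "d y x = d x y" "0 < d x y" "d x y < N" "odd (d x y) \<longleftrightarrow> col x \<noteq> col y"
    using weightedD(2-5)[OF assms(1), of x y] e' by simp_all
next
  fix x l assume "wwalk N E d x x True l"
  from wwalk_mono[OF this assms(2)] show "N \<le> l" by (rule weightedD(6)[OF assms(1)])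
qed

lemma wwalk_length:
  assumes "weighted N col E d" "even N" "wwalk N E d x y s l"
  shows "0 \<le> l" "x \<noteq> y \<Longrightarrow> 0 < l" "odd l \<longleftrightarrow> col x \<noteq> col y"
proof -
  from assms(3) have "0 \<le> l \<and> (x \<noteq> y \<longrightarrow> 0 < l) \<and> (odd l \<longleftrightarrow> col x \<noteq> col y)"
  proof (induction)
    case (wwalk_step x y s l z t)
    have "0 < elen N (d y z) t" "odd (elen N (d y z) t) \<longleftrightarrow> col y \<noteq> col z"
      using weightedD(3-5)[OF assms(1) wwalk_step(2)] assms(2) by (auto simp: elen_def)
    then show ?case using wwalk_step(3) by auto
  qed simp
  then show "0 \<le> l" "x \<noteq> y \<Longrightarrow> 0 < l" "odd l \<longleftrightarrow> col x \<noteq> col y" by auto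
qed

text \<open>The two paths of an edge and a path between its ends that is not shorter than the one of the same
  sign: walking along all three in turn is no shorter than one passage with the same total sign.\<close>

lemma elen_tri:
  assumes "0 < a" "a < N" "elen N a s \<le> l"
  shows "elen N a (t \<noteq> (s \<noteq> t')) \<le> elen N a t + l + elen N a t'"
  using assms by (cases s; cases t; cases t') (auto simp: elen_def)

text \<open>Bounds are used instead of the exact length, since replacing three passages by one may shorten a
  walk.\<close>

definition wwalk_through ::
    "int \<Rightarrow> (nat \<Rightarrow> nat \<Rightarrow> bool) \<Rightarrow> (nat \<Rightarrow> nat \<Rightarrow> int) \<Rightarrow> nat \<Rightarrow> nat \<Rightarrow> int \<Rightarrow> nat \<Rightarrow> nat \<Rightarrow> bool \<Rightarrow> int \<Rightarrow> bool" where
  "wwalk_through N E d u v a x y s l \<longleftrightarrow>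
    (\<exists>p q s1 l1 t s2 l2. {p, q} = {u, v} \<and> wwalk N E d x p s1 l1 \<and> wwalk N E d q y s2 l2 \<and>
       l1 + elen N a t + l2 \<le> l \<and> s = (s1 \<noteq> (t \<noteq> s2)))"

lemma wwalk_throughI:
  "{p, q} = {u, v} \<Longrightarrow> wwalk N E d x p s1 l1 \<Longrightarrow> wwalk N E d q y s2 l2 \<Longrightarrow>
    l1 + elen N a t + l2 \<le> l \<Longrightarrow> s = (s1 \<noteq> (t \<noteq> s2)) \<Longrightarrow> wwalk_through N E d u v a x y s l"
  unfolding wwalk_through_def by blast

text \<open>One use of a new edge suffices.  If it is used twice in the same direction, the two uses together
  with the old walk from its end back to its start are no shorter than a single use (\<open>elen_tri\<close>).  If
  it is used in both directions, then either both passages have the same sign and the closed part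
  can be omitted or is unbalanced, hence long, or they have opposite signs and lengths that sum to \<open>N\<close>.\<close>

lemma wwalk_with_new_edge:
  assumes w: "weighted N col E d" "even N" and a: "0 < a" "a < N"
    and U: "\<And>t l. wwalk N E d u v t l \<Longrightarrow> elen N a t \<le> l"
    and E': "\<And>x y. E' x y \<Longrightarrow> E x y \<and> d' x y = d x y \<or> {x, y} = {u, v} \<and> d' x y = a"
    and walk: "wwalk N E' d' x y s l"
  shows "N \<le> l \<or> (\<exists>l'\<le>l. wwalk N E d x y s l') \<or> wwalk_through N E d u v a x y s l"
  using walk
proof (induction)
  case (wwalk_nil x)
  then show ?case using wwalk.wwalk_nil by blast
next
  case (wwalk_step x y s l z t)
  let ?W = "wwalk N E d"
  let ?l = "elen N (d' y z) t"
  have pos: "0 \<le> elen N a t" for t using a by (auto simp: elen_def)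
  have U': "elen N a t \<le> l" if "?W p q t l" "{p, q} = {u, v}" for p q t l
    using that U wwalk_sym[OF w(1)] by (metis doubleton_eq_iff)
  note len = wwalk_length(1)[OF w]
  from E'[OF wwalk_step(2)] show ?case
  proof
    assume e: "E y z \<and> d' y z = d y z"
    then have l0: "0 \<le> ?l" using weightedD(3,4)[OF w(1), of y z] by (auto simp: elen_def)
    have st: "?W x' z (s' \<noteq> t) (l' + ?l)" if "?W x' y s' l'" for x' s' l'
      using wwalk.wwalk_step[OF that, of z t] e by simp
    from wwalk_step(3) show ?thesis unfolding wwalk_through_def[of _ _ _ _ _ _ x y]
    proof (elim disjE exE conjE)
      assume "N \<le> l" then show ?thesis using l0 by auto
    next
      fix l' assume "l' \<le> l" "?W x y s l'"
      then show ?thesis using st[of x s l'] by (intro disjI2 disjI1 exI[of _ "l' + ?l"]) auto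
    next
      fix p q s1 l1 t1 s2 l2
      assume A: "{p, q} = {u, v}" "?W x p s1 l1" "?W q y s2 l2" "l1 + elen N a t1 + l2 \<le> l" "s = (s1 \<noteq> (t1 \<noteq> s2))"
      have "(s \<noteq> t) = (s1 \<noteq> (t1 \<noteq> (s2 \<noteq> t)))" using A(5) by blast
      moreover have "l1 + elen N a t1 + (l2 + ?l) \<le> l + ?l" using A(4) by simp
      ultimately have "wwalk_through N E d u v a x z (s \<noteq> t) (l + ?l)"
        by (intro wwalk_throughI[OF A(1,2) st[OF A(3)]])
      then show ?thesis by blast
    qed
  next
    assume e: "{y, z} = {u, v} \<and> d' y z = a"
    from wwalk_step(3) show ?thesis unfolding wwalk_through_def[of _ _ _ _ _ _ x y]
    proof (elim disjE exE conjE)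
      assume "N \<le> l" then show ?thesis using pos[of t] e by auto
    next
      fix l' assume "l' \<le> l" "?W x y s l'"
      then have "wwalk_through N E d u v a x z (s \<noteq> t) (l + ?l)"
        using e by (intro wwalk_throughI[OF _ \<open>?W x y s l'\<close> wwalk.wwalk_nil[of N E d z], where t = t]) auto
      then show ?thesis by blast
    next
      fix p q s1 l1 t1 s2 l2
      assume A: "{p, q} = {u, v}" "?W x p s1 l1" "?W q y s2 l2" "l1 + elen N a t1 + l2 \<le> l" "s = (s1 \<noteq> (t1 \<noteq> s2))"
      have "p = y \<and> q = z \<or> p = z \<and> q = y" using A(1) e by (metis doubleton_eq_iff)
      then show ?thesis
      proof
        assume pq: "p = y \<and> q = z"
        have "elen N a s2 \<le> l2" using U'[OF A(3)] pq e by (simp add: insert_commute)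
        from elen_tri[OF a this, of t1 t] have "elen N a (t1 \<noteq> (s2 \<noteq> t)) \<le> elen N a t1 + l2 + elen N a t" .
        moreover have "(s \<noteq> t) = (s1 \<noteq> ((t1 \<noteq> (s2 \<noteq> t)) \<noteq> False))" using A(5) by blast
        moreover have "?W x y s1 l1" using A(2) pq by simp
        ultimately have "wwalk_through N E d u v a x z (s \<noteq> t) (l + ?l)"
          using e A(4) by (intro wwalk_throughI[OF _ _ wwalk.wwalk_nil[of N E d z], where t = "t1 \<noteq> (s2 \<noteq> t)"]) auto
        then show ?thesis by blast
      next
        assume pq: "p = z \<and> q = y"
        have l: "l1 + elen N a t1 + l2 + elen N a t \<le> l + ?l" using A(4) e by simp
        have nn: "0 \<le> l1" "0 \<le> l2" using len A(2,3) by auto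
        consider "(s \<noteq> t) = s1" | "s2" | "t1 \<noteq> t" using A(5) by blast
        then show ?thesis
        proof cases
          case 1
          have "?W x z s1 l1" using A(2) pq by simp
          then have "?W x z (s \<noteq> t) l1" unfolding 1 .
          moreover have "l1 \<le> l + ?l" using l nn pos[of t1] pos[of t] by linarith
          ultimately show ?thesis by blast
        next
          case 2
          then have "N \<le> l2" using A(3) pq weightedD(6)[OF w(1)] by simp
          then show ?thesis using l nn pos[of t1] pos[of t] by linarith
        next
          case 3
          then have "elen N a t1 + elen N a t = N" by (auto simp: elen_def)
          then show ?thesis using l nn by linarith
        qed
      qed
    qed
  qed
qed

definition add_edge :: "nat \<Rightarrow> nat \<Rightarrow> (nat \<Rightarrow> nat \<Rightarrow> bool) \<Rightarrow> nat \<Rightarrow> nat \<Rightarrow> bool" where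
  "add_edge u v E x y \<longleftrightarrow> E x y \<or> x = u \<and> y = v \<or> x = v \<and> y = u"

text \<open>The residue \<open>a\<close> of the new edge has to be at most the length of every positive walk from \<open>u\<close> to \<open>v\<close>,
  and at least \<open>N - l\<close> for every negative one of length \<open>l\<close>.  These bounds are compatible, since a
  positive and a negative walk together have length at least \<open>N\<close>; the largest lower bound is taken.\<close>

lemma weighted_add_edge:
  assumes w: "weighted N col E d" "even N" "4 \<le> N" and uv: "u \<noteq> v"
  obtains d' where "weighted N col (add_edge u v E) d'" "\<And>x y. E x y \<Longrightarrow> d' x y = d x y"
proof (cases "E u v")
  case True
  then have "add_edge u v E = E" using weightedD(1)[OF w(1)] unfolding add_edge_def by blast
  then show ?thesis using that w(1) by simp
next
  case False
  let ?W = "wwalk N E d"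
  \<comment> \<open>The least positive residue of the right parity keeps \<open>a\<close> positive when there is no negative
    walk.\<close>
  define m where "m = (if col u \<noteq> col v then 1 else 2 :: int)"
  define L where "L = {x. (x = m \<or> (\<exists>l. ?W u v True l \<and> x = N - l)) \<and> m \<le> x \<and> x \<le> N}"
  have m: "m \<in> L" using w(3) by (auto simp: L_def m_def)
  have fL: "finite L" by (rule finite_subset[of _ "{m..N}"]) (auto simp: L_def)
  define a where "a = Max L"
  have aL: "a \<in> L" unfolding a_def using fL m by (intro Max_in) auto
  have pos: "0 < l" if "?W u v t l" for t l using wwalk_length(2)[OF w(1,2) that uv] .
  have par: "odd l \<longleftrightarrow> col u \<noteq> col v" if "?W u v t l" for t l using wwalk_length(3)[OF w(1,2) that] .
  have "m \<le> a" using aL by (simp add: L_def)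
  then have a0: "0 < a" by (simp add: m_def split: if_splits)
  have aN: "a < N" using aL pos w(3) by (auto simp: L_def m_def)
  have "odd m \<longleftrightarrow> col u \<noteq> col v" by (simp add: m_def)
  then have apar: "odd a \<longleftrightarrow> col u \<noteq> col v" using aL par w(2) by (auto simp: L_def)
  have U: "elen N a t \<le> l" if W: "?W u v t l" for t l
  proof (cases t)
    case True
    have "N - l \<le> a"
    proof (cases "m \<le> N - l")
      case True
      then have "N - l \<in> L" using W \<open>t\<close> pos[OF W] by (auto simp: L_def)
      then show ?thesis unfolding a_def using fL by simp
    qed (use \<open>m \<le> a\<close> in simp)
    then show ?thesis using True by (simp add: elen_def)
  next
    case False
    have "m \<le> l" using pos[OF W] par[OF W] by (cases "l = 1") (auto simp: m_def)
    moreover have "N - l' \<le> l" if "?W u v True l'" for l'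
      using weightedD(6)[OF w(1), of v "l' + l"] wwalk_trans[OF W wwalk_sym[OF w(1) that]] False
      by simp
    ultimately have "a \<le> l" using aL by (auto simp: L_def)
    then show ?thesis using False by (simp add: elen_def)
  qed
  define d' where "d' x y = (if {x, y} = {u, v} then a else d x y)" for x y
  have old: "d' x y = d x y" if "E x y" for x y
    using that False weightedD(1)[OF w(1)] by (auto simp: d'_def doubleton_eq_iff)
  have new: "E x y \<and> d' x y = d x y \<or> {x, y} = {u, v} \<and> d' x y = a" if "add_edge u v E x y" for x y
    using that old by (auto simp: add_edge_def d'_def doubleton_eq_iff)
  have "weighted N col (add_edge u v E) d'" unfolding weighted_def
  proof (intro conjI allI impI)
    fix x y assume e: "add_edge u v E x y"
    then show "add_edge u v E y x" using weightedD(1)[OF w(1)] by (auto simp: add_edge_def)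
    show "d' y x = d' x y"
      using e old weightedD(1,2)[OF w(1)] by (auto simp: add_edge_def d'_def insert_commute)
    show "0 < d' x y" "d' x y < N" "odd (d' x y) \<longleftrightarrow> col x \<noteq> col y"
      using new[OF e] weightedD(3-5)[OF w(1), of x y] a0 aN apar by (auto simp: doubleton_eq_iff)
  next
    fix x l assume "wwalk N (add_edge u v E) d' x x True l"
    then have "N \<le> l \<or> (\<exists>l'\<le>l. ?W x x True l') \<or> wwalk_through N E d u v a x x True l"
      by (intro wwalk_with_new_edge[where E' = "add_edge u v E" and d' = d', OF w(1,2) a0 aN]) (use U new in blast)+
    then show "N \<le> l" unfolding wwalk_through_def
    proof (elim disjE exE conjE)
      fix l' assume "l' \<le> l" "?W x x True l'"
      then show ?thesis using weightedD(6)[OF w(1)] by fastforce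
    next
      fix p q s1 l1 t s2 l2
      assume A: "{p, q} = {u, v}" "?W x p s1 l1" "?W q x s2 l2" "l1 + elen N a t + l2 \<le> l" "True = (s1 \<noteq> (t \<noteq> s2))"
      have W: "?W q p (s2 \<noteq> s1) (l2 + l1)" by (rule wwalk_trans[OF A(2,3)])
      have "p = u \<and> q = v \<or> p = v \<and> q = u" using A(1) by (auto simp: doubleton_eq_iff)
      then have "elen N a (s2 \<noteq> s1) \<le> l2 + l1" using U W wwalk_sym[OF w(1) W] by blast
      moreover have "elen N a (s2 \<noteq> s1) + elen N a t = N" using A(5) by (auto simp: elen_def)
      ultimately show ?thesis using A(4) by linarith
    qed
  qed
  then show ?thesis using that old by blast
qed

text \<open>The inequalities of \<open>tri\<close> are bounds for unbalanced closed walks around the triangle.\<close>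

lemma weighted_triangle:
  assumes w: "weighted N col E d" "even N" and e: "E u v" "E u z" "E v z"
  shows "tri N (d u v) (d u z) (d v z)"
proof -
  have c: "N \<le> elen N (d u v) t1 + elen N (d v z) t2 + elen N (d u z) t3" if "t1 \<noteq> (t2 \<noteq> t3)" for t1 t2 t3
  proof -
    note W = wwalk_edge[of E u v N d t1, OF e(1)] wwalk_edge[of E v z N d t2, OF e(3)]
      wwalk_sym[OF w(1) wwalk_edge[of E u z N d t3, OF e(2)]]
    have "wwalk N E d u u (t1 \<noteq> (t2 \<noteq> t3)) (elen N (d u v) t1 + (elen N (d v z) t2 + elen N (d u z) t3))"
      by (rule wwalk_trans[OF wwalk_trans[OF W(3,2)] W(1)])
    moreover have "(t1 \<noteq> (t2 \<noteq> t3)) = True" using that by blast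
    ultimately have "N \<le> elen N (d u v) t1 + (elen N (d v z) t2 + elen N (d u z) t3)"
      using weightedD(6)[OF w(1)] by (simp only:)
    then show ?thesis by simp
  qed
  have "even (d u v + d u z + d v z)"
    using weightedD(5)[OF w(1) e(1)] weightedD(5)[OF w(1) e(2)] weightedD(5)[OF w(1) e(3)] by auto
  then show ?thesis
    using c[of True False False] c[of False True False] c[of False False True] c[of True True True]
      weightedD(3,4)[OF w(1) e(1)] weightedD(3,4)[OF w(1) e(2)] weightedD(3,4)[OF w(1) e(3)]
    by (simp add: tri_def elen_def)
qed

definition graph_weight :: "nat \<Rightarrow> nat sgraph \<Rightarrow> nat \<Rightarrow> nat \<Rightarrow> int" where
  "graph_weight N G x y = (if {x, y} \<in> negs G then int N - 1 else 1)"

text \<open>Choosing for an edge the path of the sign that the edge has in \<open>G\<close> costs \<open>1\<close>; the other choice costs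
  \<open>N - 1\<close>, and then one further step makes the length at least \<open>N\<close>.  A closed walk needs a further step,
  as there are no loops.\<close>

lemma weighted_graph:
  assumes G: "signed_graph G" and g: "enat N \<le> unbalanced_girth G" and N: "even N" "2 \<le> N"
    and col: "\<And>x y. {x, y} \<in> edges G \<Longrightarrow> col x \<noteq> col y"
  shows "weighted (int N) col (\<lambda>x y. {x, y} \<in> edges G) (graph_weight N G)"
proof -
  let ?E = "\<lambda>x y. {x, y} \<in> edges G"
  have "(x = y \<and> \<not> s \<and> l = 0) \<or> (\<exists>n. l = int n \<and> swalk G x y s n) \<or> int N \<le> l \<or> (l = int N - 1 \<and> {x, y} \<in> edges G)"
    if "wwalk (int N) ?E (graph_weight N G) x y s l" for x y s l
    using that
  proof (induction)
    case (wwalk_step x y s l z t)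
    let ?n = "{y, z} \<in> negs G"
    have l: "elen (int N) (graph_weight N G y z) t = (if t = ?n then 1 else int N - 1)"
      by (auto simp: elen_def graph_weight_def)
    have v: "y \<in> verts G" using signed_graph_edgeD[OF G wwalk_step(2)] by simp
    have step: "swalk G x z (s \<noteq> t) (Suc n)" if "swalk G x y s n" "t = ?n" for n
      using swalk_step[OF that(1) wwalk_step(2)] that(2) by simp
    from wwalk_step(3) show ?case
    proof (elim disjE exE conjE)
      assume A: "x = y" "\<not> s" "l = 0"
      show ?thesis
      proof (cases "t = ?n")
        case True
        then have "swalk G x z (s \<noteq> t) 1" using step[of 0] A v by (simp add: swalk_nil)
        then show ?thesis using l True A by (intro disjI2 disjI1 exI[of _ 1]) simp
      next
        case False
        then show ?thesis using l A wwalk_step(2) by simp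
      qed
    next
      fix n assume A: "l = int n" "swalk G x y s n"
      show ?thesis
      proof (cases "t = ?n")
        case True
        then show ?thesis using step A l by (intro disjI2 disjI1 exI[of _ "Suc n"]) simp
      next
        case False
        show ?thesis
        proof (cases "n = 0")
          case True
          then have "x = y" using A(2) by (auto elim: swalk.cases)
          then show ?thesis using l False A True wwalk_step(2) by simp
        next
          case n: False
          then have "int N \<le> l + elen (int N) (graph_weight N G y z) t" using l False A by simp
          then show ?thesis by blast
        qed
      qed
    qed (use l N in auto)
  qed simp
  note cases = this
  show ?thesis unfolding weighted_def
  proof (intro conjI allI impI)
    fix x y assume e: "{x, y} \<in> edges G"
    then show "{y, x} \<in> edges G" by (simp add: insert_commute)
    show "graph_weight N G y x = graph_weight N G x y" by (simp add: graph_weight_def insert_commute)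
    show "0 < graph_weight N G x y" "graph_weight N G x y < int N" using N by (auto simp: graph_weight_def)
    show "odd (graph_weight N G x y) \<longleftrightarrow> col x \<noteq> col y" using col[OF e] N by (auto simp: graph_weight_def)
  next
    fix x l assume "wwalk (int N) ?E (graph_weight N G) x x True l"
    from cases[OF this] show "int N \<le> l"
      using g signed_graph_edgeD(3)[OF G, of x x] unfolding unbalanced_girth_ge_iff[OF G] by auto
  qed
qed

section \<open>Homomorphisms to a graph with a certificate\<close>

text \<open>Permuting the sides, and switching at a corner, which replaces two residues by their complements.\<close>

lemma tri_residues:
  assumes "tri N a b c"
  shows "tri N b a c" "tri N a c b" "tri N (N - a) b (N - c)" "tri N (N - a) (N - b) c" "tri N a (N - b) (N - c)"
  using assms by (auto simp: tri_def)

text \<open>Every pair of weights belongs to a k-good triple.  The third residue is \<open>\<bar>a - b\<bar>\<close>, or \<open>2\<close>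
  if \<open>a = b\<close>, as residues of weights are not \<open>0\<close>.\<close>

lemma tri_third:
  assumes "a \<in> {0<..<N}" "b \<in> {0<..<N}" "even N" "4 \<le> N"
  obtains c where "tri N a b c"
proof (cases "a = b")
  case True
  then show ?thesis using that[of 2] assms by (auto simp: tri_def)
next
  case False
  show ?thesis
  proof (cases "a < b")
    case True
    then show ?thesis using that[of "b - a"] assms by (auto simp: tri_def)
  next
    case False
    then show ?thesis using that[of "a - b"] assms \<open>a \<noteq> b\<close> by (auto simp: tri_def)
  qed
qed

lemma sdg_edgeD:
  assumes B: "signed_graph B" and e: "{x, y} \<in> sdg_edges k B"
  shows "gdist B x y \<noteq> \<infinity>" "is_weight k (ad B x y)" "x \<in> verts B" "y \<in> verts B" "x \<noteq> y"
proof -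
  obtain a b where ab: "{x, y} = {a, b}" "a \<in> verts B" "b \<in> verts B" "a \<noteq> b" "gdist B a b \<noteq> \<infinity>" "\<bar>ad B a b\<bar> \<le> int k"
    using e unfolding sdg_edges_def by blast
  then have "x = a \<and> y = b \<or> x = b \<and> y = a" by (simp add: doubleton_eq_iff)
  then have 1: "gdist B x y \<noteq> \<infinity>" "\<bar>ad B x y\<bar> \<le> int k" "x \<in> verts B" "y \<in> verts B" "x \<noteq> y"
    using ab ad_sym[OF B, of a b] by auto
  then show "gdist B x y \<noteq> \<infinity>" "x \<in> verts B" "y \<in> verts B" "x \<noteq> y" by auto
  obtain s l where "swalk B x y s l" using gdist_finiteD[OF 1(1)] .
  from ad_props[OF B this] obtain d where d: "\<exists>s. swalk B x y s d" "ad B x y = (if swalk B x y False d then int d else - int d)"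
    by metis
  have "d \<noteq> 0"
  proof
    assume "d = 0"
    then obtain s where "swalk B x y s 0" using d by blast
    then show False using 1(5) by (auto elim: swalk.cases)
  qed
  then show "is_weight k (ad B x y)" using 1(2) d(2) by (auto simp: is_weight_def split: if_splits)
qed

lemma cong_2k_weight:
  assumes "2 \<le> k" "is_weight k p" "a \<in> {0<..<2 * int k}"
  shows "[p = a] (mod 2 * int k) \<longleftrightarrow> p mod (2 * int k) = a"
  using assms by (simp add: cong_def)

lemma weight_of_residue:
  assumes "a \<in> {0<..<2 * int k}"
  obtains p where "is_weight k p" "p mod (2 * int k) = a"
proof (cases "a \<le> int k")
  case True
  then show ?thesis using assms by (intro that[of a]) (auto simp: is_weight_def)
next
  case False
  have "(a - 2 * int k) mod (2 * int k) = a" using assms by (simp add: mod_diff_right_eq[symmetric])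
  then show ?thesis using assms False by (intro that[of "a - 2 * int k"]) (auto simp: is_weight_def)
qed

text \<open>The certificates of the answer YES.\<close>

definition stable :: "nat \<Rightarrow> 'a sgraph \<Rightarrow> 'a set set \<Rightarrow> bool" where
  "stable k B S \<longleftrightarrow> S \<noteq> {} \<and> S \<subseteq> sdg_edges k B \<and> (\<forall>e\<in>S. \<not> fails_all_k_good k S (ad B) e)"

text \<open>The all k-good property for residues.\<close>

lemma stable_witness:
  assumes S: "stable k B S" and k: "2 \<le> k" and B: "signed_graph B"
    and e: "{x, y} \<in> S" "[ad B x y = a] (mod 2 * int k)" and t: "tri (2 * int k) a b c"
  obtains z where "{x, z} \<in> S" "{y, z} \<in> S"
    "[ad B x z = b] (mod 2 * int k) \<and> [ad B y z = c] (mod 2 * int k) \<or>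
     [ad B x z = - b] (mod 2 * int k) \<and> [ad B y z = - c] (mod 2 * int k)"
proof -
  have r: "a \<in> {0<..<2 * int k}" "b \<in> {0<..<2 * int k}" "c \<in> {0<..<2 * int k}"
    using t by (simp_all add: tri_def)
  have w: "is_weight k (ad B x y)" using sdg_edgeD(2)[OF B] S e(1) by (auto simp: stable_def)
  obtain q where q: "is_weight k q" "q mod (2 * int k) = b" using weight_of_residue[OF r(2)] .
  obtain s where s: "is_weight k s" "s mod (2 * int k) = c" using weight_of_residue[OF r(3)] .
  have "k_good k (ad B x y) q s"
    unfolding k_good_iff[OF k] using w q s t e(2) r(1) by (simp add: cong_2k_weight[OF k w r(1)])
  then have "witnessed k S (ad B) x y q s"
    using S e(1) unfolding stable_def fails_all_k_good_def by blast
  then obtain z where z: "{x, z} \<in> S" "{y, z} \<in> S"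
     "[ad B x z = q] (mod 2 * int k) \<and> [ad B y z = s] (mod 2 * int k) \<or>
      [ad B x z = - q] (mod 2 * int k) \<and> [ad B y z = - s] (mod 2 * int k)"
    unfolding witnessed_def by blast
  have "[q = b] (mod 2 * int k)" "[s = c] (mod 2 * int k)" using q s r by (auto simp: cong_def)
  then have "[ad B x z = b] (mod 2 * int k) \<and> [ad B y z = c] (mod 2 * int k) \<or>
     [ad B x z = - b] (mod 2 * int k) \<and> [ad B y z = - c] (mod 2 * int k)"
    using z(3) by (meson cong_minus_minus_iff cong_trans)
  then show ?thesis using that z by blast
qed

text \<open>The map \<open>\<phi>\<close> realizes the residues after switching the weighted graph at the vertices \<open>x\<close> with \<open>s x\<close>.
  The first condition is what allows the map to be extended to a vertex with a single neighbour.\<close>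

definition realizes ::
    "nat \<Rightarrow> 'b sgraph \<Rightarrow> 'b set set \<Rightarrow> nat set \<Rightarrow> (nat \<Rightarrow> nat \<Rightarrow> bool) \<Rightarrow> (nat \<Rightarrow> nat \<Rightarrow> int) \<Rightarrow>
      (nat \<Rightarrow> 'b) \<Rightarrow> (nat \<Rightarrow> bool) \<Rightarrow> bool" where
  "realizes k B S V E d \<phi> s \<longleftrightarrow> (\<forall>x\<in>V. \<exists>y. {\<phi> x, y} \<in> S) \<and>
     (\<forall>x y. E x y \<longrightarrow> {\<phi> x, \<phi> y} \<in> S \<and>
        [ad B (\<phi> x) (\<phi> y) = (if s x = s y then d x y else - d x y)] (mod 2 * int k))"

lemma realizesD:
  assumes "realizes k B S V E d \<phi> s"
  shows "x \<in> V \<Longrightarrow> \<exists>y. {\<phi> x, y} \<in> S"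
    "E x y \<Longrightarrow> {\<phi> x, \<phi> y} \<in> S"
    "E x y \<Longrightarrow> [ad B (\<phi> x) (\<phi> y) = (if s x = s y then d x y else - d x y)] (mod 2 * int k)"
  using assms unfolding realizes_def by blast+

lemma realizes_extend:
  assumes r: "realizes k B S (V - {z}) (\<lambda>x y. E x y \<and> x \<noteq> z \<and> y \<noteq> z) d \<phi> s"
    and B: "signed_graph B" and E: "\<And>x y. E x y \<Longrightarrow> E y x \<and> d y x = d x y \<and> x \<noteq> y"
    and z0: "{z', y0} \<in> S"
    and z': "\<And>u. E u z \<Longrightarrow> {\<phi> u, z'} \<in> S \<and>
      [ad B (\<phi> u) z' = (if s u = t then d u z else - d u z)] (mod 2 * int k)"
  shows "realizes k B S V E d (\<phi>(z := z')) (s(z := t))"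
  unfolding realizes_def
proof (intro conjI ballI allI impI)
  fix x assume "x \<in> V"
  then show "\<exists>y. {(\<phi>(z := z')) x, y} \<in> S" using r z0 by (auto simp: realizes_def)
next
  fix x y assume e: "E x y"
  note e' = E[OF e]
  let ?\<phi> = "\<phi>(z := z')" and ?s = "s(z := t)"
  have "{?\<phi> x, ?\<phi> y} \<in> S \<and>
     [ad B (?\<phi> x) (?\<phi> y) = (if ?s x = ?s y then d x y else - d x y)] (mod 2 * int k)"
  proof -
    consider "x \<noteq> z" "y \<noteq> z" | "x \<noteq> z" "y = z" | "x = z" "y \<noteq> z" using e' by blast
    then show ?thesis
    proof cases
      case 1 then show ?thesis using r e by (simp add: realizes_def)
    next
      case 2 then show ?thesis using z'[of x] e by (cases "s x = t") simp_all
    next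
      case 3
      then show ?thesis using z'[of y] e' ad_sym(2)[OF B, of z' "\<phi> y"] 
        by (cases "s y = t") (auto simp: insert_commute)
    qed
  qed
  then show "{?\<phi> x, ?\<phi> y} \<in> S"
    "[ad B (?\<phi> x) (?\<phi> y) = (if ?s x = ?s y then d x y else - d x y)] (mod 2 * int k)" by auto
qed

text \<open>A witness has either both prescribed weights or both of their negatives; the sign is the value of
  the switching at the new vertex.\<close>

lemma common_sign:
  fixes p q a b n :: int and \<sigma> \<tau> :: bool
  assumes "[p = a] (mod n) \<and> [q = (if \<sigma> = \<tau> then b else - b)] (mod n) \<or>
    [p = - a] (mod n) \<and> [q = - (if \<sigma> = \<tau> then b else - b)] (mod n)"
  obtains t where "[p = (if \<sigma> = t then a else - a)] (mod n)" "[q = (if \<tau> = t then b else - b)] (mod n)"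
  using assms
proof
  assume "[p = a] (mod n) \<and> [q = (if \<sigma> = \<tau> then b else - b)] (mod n)"
  then show ?thesis using that[of \<sigma>] by (cases \<sigma>; cases \<tau>) simp_all
next
  assume "[p = - a] (mod n) \<and> [q = - (if \<sigma> = \<tau> then b else - b)] (mod n)"
  then show ?thesis using that[of "\<not> \<sigma>"] by (cases \<sigma>; cases \<tau>) simp_all
qed

lemma cong_minus_residue: "[- a = n - a] (mod n)" for a n :: int
  by (simp add: cong_iff_dvd_diff)

text \<open>Induction on the number of vertices of the minor; a vertex \<open>z\<close> of degree at most two is removed.

  If it has two neighbours \<open>u\<close> and \<open>v\<close>, they are joined by an edge first: contracting \<open>z\<close> into \<open>u\<close>
  yields this graph, so it is a minor of \<open>G\<close> as well.  The new edge has been realized by a pair in \<open>S\<close>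
  when \<open>z\<close> is put back, and its image is a witness for this pair.  With one neighbour \<open>u\<close>, any pair in \<open>S\<close>
  that contains the image of \<open>u\<close> is extended by a triple instead, and without neighbours any vertex of
  a pair in \<open>S\<close> will do.\<close>

lemma realizes_exists:
  assumes S: "stable k B S" and k: "2 \<le> k" and B: "signed_graph B"
    and G: "K4_minor_free G"
    and m: "minor_model G V f E" and w: "weighted (2 * int k) col E d"
  shows "\<exists>\<phi> s. realizes k B S V E d \<phi> s"
  using m w
proof (induction "card V" arbitrary: V f E d rule: less_induct)
  case less
  note m = less.prems(1) and w = less.prems(2)
  let ?N = "2 * int k"
  have ev: "even ?N" "4 \<le> ?N" using k by auto
  have fV: "finite V" using minor_modelD(1)[OF m] .
  have E: "x \<in> V \<and> y \<in> V \<and> x \<noteq> y \<and> E y x \<and> d y x = d x y" if "E x y" for x y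
    using minor_modelD(6-9)[OF m that] weightedD(2)[OF w that] by simp
  show ?case
  proof (cases "V = {}")
    case True
    then have "\<not> E x y" for x y using E by blast
    then have "realizes k B S V E d (\<lambda>_. undefined) (\<lambda>_. True)" using True by (simp add: realizes_def)
    then show ?thesis by blast
  next
    case False
    obtain z where z: "z \<in> V" "card {y. E z y} \<le> 2"
      by (rule minor_model_degree_le_2[OF m False G])
    have cV: "card (V - {z}) < card V" using z(1) fV by (meson card_Diff1_less)
    have fN: "finite {y. E z y}" by (rule finite_subset[OF _ fV]) (use E in auto)
    let ?E0 = "\<lambda>x y. E x y \<and> x \<noteq> z \<and> y \<noteq> z"
    have "minor_model G (V - {z}) f (\<lambda>x y. E x y \<and> x \<in> V - {z} \<and> y \<in> V - {z})"
      by (rule minor_model_restrict[OF m]) auto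
    moreover have "(\<lambda>x y. E x y \<and> x \<in> V - {z} \<and> y \<in> V - {z}) = ?E0"
      by (intro ext) (use E in auto)
    ultimately have m0: "minor_model G (V - {z}) f ?E0" by simp
    have w0: "weighted ?N col ?E0 d" by (rule weighted_mono[OF w]) (use E in auto)
    obtain \<phi>0 s0 where r0: "realizes k B S (V - {z}) ?E0 d \<phi>0 s0" using less.hyps[OF cV m0 w0] by blast
    obtain x0 y0 where xy0: "{x0, y0} \<in> S"
    proof -
      obtain e where "e \<in> S" using S by (auto simp: stable_def)
      moreover then have "e \<in> sdg_edges k B" using S by (auto simp: stable_def)
      ultimately show ?thesis using that unfolding sdg_edges_def by auto
    qed
    have Eq: "\<And>x y. E x y \<Longrightarrow> E y x \<and> d y x = d x y \<and> x \<noteq> y" using E by simp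
    have Esym: "E x y \<longleftrightarrow> E y x" for x y using Eq by metis
    have EV: "x \<in> V" "y \<in> V" "x \<noteq> y" if "E x y" for x y using E[OF that] by simp_all
    have "card {y. E z y} = 0 \<or> card {y. E z y} = 1 \<or> card {y. E z y} = 2" using z(2) by linarith
    then consider "{y. E z y} = {}" | u where "{y. E z y} = {u}" | u v where "{y. E z y} = {u, v}" "u \<noteq> v"
      using fN by (auto simp: card_1_singleton_iff card_2_iff)
    then show ?thesis
    proof cases
      case 1
      then have "\<not> E u z" for u using Esym[of u z] by simp
      then show ?thesis using realizes_extend[OF r0 B Eq xy0, of True] by blast
    next
      case (2 u)
      then have u: "E z u" "E u z" "u \<in> V - {z}"
        using Esym[of u z] EV[of z u] by auto
      have only: "x = u" if "E x z" for x
        using 2 that Esym[of x z] by blast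
      obtain y where y: "{\<phi>0 u, y} \<in> S" using r0 u(3) unfolding realizes_def by blast
      have yw: "is_weight k (ad B (\<phi>0 u) y)" using sdg_edgeD(2)[OF B] y S by (auto simp: stable_def)
      define a where "a = ad B (\<phi>0 u) y mod ?N"
      have a: "a \<in> {0<..<?N}" using weight_mod[OF yw k] yw k by (auto simp: a_def is_weight_def)
      have b: "d u z \<in> {0<..<?N}" using weightedD(3,4)[OF w u(2)] by simp
      obtain c where c: "tri ?N a (d u z) c" using tri_third[OF a b ev] .
      have "[ad B (\<phi>0 u) y = a] (mod ?N)" by (simp add: a_def)
      from stable_witness[OF S k B y this c] obtain z' where z': "{\<phi>0 u, z'} \<in> S"
        "[ad B (\<phi>0 u) z' = d u z] (mod ?N) \<or> [ad B (\<phi>0 u) z' = - d u z] (mod ?N)" by metis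
      define t where "t \<longleftrightarrow> (s0 u \<longleftrightarrow> [ad B (\<phi>0 u) z' = d u z] (mod ?N))"
      have "{z', \<phi>0 u} \<in> S" using z' by (simp add: insert_commute)
      moreover have "{\<phi>0 x, z'} \<in> S \<and> [ad B (\<phi>0 x) z' = (if s0 x = t then d x z else - d x z)] (mod ?N)"
        if "E x z" for x
        using only[OF that] z' by (auto simp: t_def)
      ultimately show ?thesis using realizes_extend[OF r0 B Eq, of z' "\<phi>0 u" t] by blast
    next
      case (3 u v)
      then have uv: "E z u" "E u z" "E z v" "E v z" "u \<in> V - {z}" "v \<in> V - {z}"
        using Esym[of u z] Esym[of v z] EV[of z u] EV[of z v] by auto
      have only: "E z x \<longleftrightarrow> x = u \<or> x = v" "E x z \<longleftrightarrow> x = u \<or> x = v" for x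
        using 3 Esym[of x z] by blast+
      obtain d1 where d1: "weighted ?N col (add_edge u v E) d1" "\<And>x y. E x y \<Longrightarrow> d1 x y = d x y"
        using weighted_add_edge[OF w ev 3(2)] by blast
      let ?E' = "contract E z u"
      have E'1: "add_edge u v E x y" if "?E' x y" for x y
        using that unfolding contract_def add_edge_def only by blast
      have m': "minor_model G (V - {z}) (f(u := f z \<union> f u)) ?E'"
        by (rule minor_model_contract[OF m uv(1)])
      have w': "weighted ?N col ?E' d1"
        by (rule weighted_mono[OF d1(1)]) (use E'1 minor_modelD(9)[OF m'] in blast)+
      obtain \<phi> s where r: "realizes k B S (V - {z}) ?E' d1 \<phi> s" using less.hyps[OF cV m' w'] by blast
      have "?E' u v" using 3(2) uv by (simp add: contract_def)
      then have ad: "{\<phi> u, \<phi> v} \<in> S" "[ad B (\<phi> u) (\<phi> v) = (if s u = s v then d1 u v else - d1 u v)] (mod ?N)"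
        using realizesD(2,3)[OF r] by blast+
      have t: "tri ?N (d1 u v) (d u z) (d v z)"
        using weighted_triangle[OF d1(1) ev(1), of u v z] d1(2)[OF uv(2)] d1(2)[OF uv(4)] uv
        by (simp add: add_edge_def)
      have r1: "realizes k B S (V - {z}) ?E0 d \<phi> s"
        unfolding realizes_def
      proof (intro conjI ballI allI impI)
        fix x assume "x \<in> V - {z}" then show "\<exists>y. {\<phi> x, y} \<in> S" using r unfolding realizes_def by blast
      next
        fix x y assume e: "E x y \<and> x \<noteq> z \<and> y \<noteq> z"
        then have "?E' x y" using EV(3)[of x y] by (simp add: contract_def)
        note R = realizesD(2,3)[OF r this]
        have dd: "d1 x y = d x y" using d1(2) e by blast
        show "{\<phi> x, \<phi> y} \<in> S" by (rule R(1))
        show "[ad B (\<phi> x) (\<phi> y) = (if s x = s y then d x y else - d x y)] (mod ?N)"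
          using R(2) unfolding dd .
      qed
      \<comment> \<open>Switching at one end replaces the weight \<open>a\<close> by \<open>2k - a\<close>.\<close>
      obtain a c where ac: "tri ?N a (d u z) c" "[ad B (\<phi> u) (\<phi> v) = a] (mod ?N)"
        "[c = (if s u = s v then d v z else - d v z)] (mod ?N)"
      proof (cases "s u = s v")
        case True
        then show ?thesis using that[OF t] ad(2)[unfolded if_P[OF True]] by simp
      next
        case False
        have "[?N - d v z = - d v z] (mod ?N)" by (rule cong_sym[OF cong_minus_residue])
        then show ?thesis using that[OF tri_residues(3)[OF t]] False
            cong_trans[OF ad(2)[unfolded if_not_P[OF False]] cong_minus_residue] by simp
      qed
      obtain z' where z': "{\<phi> u, z'} \<in> S" "{\<phi> v, z'} \<in> S"
          "[ad B (\<phi> u) z' = d u z] (mod ?N) \<and> [ad B (\<phi> v) z' = c] (mod ?N) \<or>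
           [ad B (\<phi> u) z' = - d u z] (mod ?N) \<and> [ad B (\<phi> v) z' = - c] (mod ?N)"
        by (rule stable_witness[OF S k B ad(1) ac(2,1)])
      have "[- c = - (if s u = s v then d v z else - d v z)] (mod ?N)"
        using ac(3) by (simp only: cong_minus_minus_iff)
      with z'(3) ac(3) have "[ad B (\<phi> u) z' = d u z] (mod ?N) \<and>
            [ad B (\<phi> v) z' = (if s u = s v then d v z else - d v z)] (mod ?N) \<or>
          [ad B (\<phi> u) z' = - d u z] (mod ?N) \<and>
            [ad B (\<phi> v) z' = - (if s u = s v then d v z else - d v z)] (mod ?N)"
        by (meson cong_trans)
      then obtain t where t: "[ad B (\<phi> u) z' = (if s u = t then d u z else - d u z)] (mod ?N)"
        "[ad B (\<phi> v) z' = (if s v = t then d v z else - d v z)] (mod ?N)"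
        by (rule common_sign)
      have "{z', \<phi> u} \<in> S" using z' by (simp add: insert_commute)
      moreover have "{\<phi> x, z'} \<in> S \<and> [ad B (\<phi> x) z' = (if s x = t then d x z else - d x z)] (mod ?N)"
        if "E x z" for x
        using that z'(1,2) t unfolding only by (elim disjE; blast)
      ultimately have "realizes k B S V E d (\<phi>(z := z')) (s(z := t))"
        by (intro realizes_extend[OF r1 B Eq])
      then show ?thesis by blast
    qed
  qed
qed

lemma ad_one_edge:
  assumes B: "signed_graph B" and e: "{x, y} \<in> sdg_edges k B" and a: "\<bar>ad B x y\<bar> = 1"
  shows "{x, y} \<in> edges B" "{x, y} \<in> negs B \<longleftrightarrow> ad B x y = - 1"
proof -
  obtain s l where "swalk B x y s l" using gdist_finiteD[OF sdg_edgeD(1)[OF B e]] .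
  from ad_props[OF B this] obtain d where d: "\<exists>s. swalk B x y s d"
    "ad B x y = (if swalk B x y False d then int d else - int d)" by metis
  then have d1: "d = 1" using a by (auto split: if_splits)
  have one: "{x, y} \<in> edges B \<and> s = ({x, y} \<in> negs B)" if "swalk B x y s 1" for s
  proof -
    from that have "swalk B x y s (Suc 0)" by simp
    then obtain w s' where w: "swalk B x w s' 0" "{w, y} \<in> edges B" "s = (s' \<noteq> ({w, y} \<in> negs B))"
      by cases auto
    from w(1) have "w = x" "\<not> s'" by (auto elim: swalk.cases)
    then show ?thesis using w by simp
  qed
  obtain s' where s': "swalk B x y s' 1" using d(1) d1 by blast
  from one[OF s'] show "{x, y} \<in> edges B" by simp
  show "{x, y} \<in> negs B \<longleftrightarrow> ad B x y = - 1"
  proof (cases s')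
    case True
    then have "{x, y} \<in> negs B" using one[OF s'] by simp
    moreover from this have "\<not> swalk B x y False 1" using one[of False] by blast
    ultimately show ?thesis using d(2) d1 by simp
  next
    case False
    then have "{x, y} \<notin> negs B" "swalk B x y False 1" using one[OF s'] s' by simp_all
    then show ?thesis using d(2) d1 by simp
  qed
qed

text \<open>A closed walk passes an even number of times between switched and unswitched vertices.\<close>

lemma sg_hom_switching:
  fixes s :: "'a \<Rightarrow> bool"
  assumes v: "\<And>x. x \<in> verts G \<Longrightarrow> \<phi> x \<in> verts B" and G: "signed_graph G"
    and e: "\<And>x y. {x, y} \<in> edges G \<Longrightarrow> {\<phi> x, \<phi> y} \<in> edges B \<and>
      ({\<phi> x, \<phi> y} \<in> negs B \<longleftrightarrow> ({x, y} \<in> negs G) \<noteq> (s x \<noteq> s y))"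
  shows "sg_hom G B \<phi>"
proof -
  have w: "walk B (map \<phi> c) \<and> (neg_parity B (map \<phi> c) \<longleftrightarrow> neg_parity G c \<noteq> (s (hd c) \<noteq> s (last c)))"
    if "walk G c" for c
    using that
  proof (induction c rule: induct_list012)
    case 1 then show ?case by (simp add: walk_def)
  next
    case (2 x) then show ?case using v by simp
  next
    case (3 x y c)
    then have "walk G (y # c)" "{x, y} \<in> edges G" "x \<in> verts G" by auto
    then have IH: "walk B (map \<phi> (y # c))" "{\<phi> x, \<phi> y} \<in> edges B" "\<phi> x \<in> verts B"
      and i: "neg_parity B (map \<phi> (y # c)) \<longleftrightarrow> neg_parity G (y # c) \<noteq> (s y \<noteq> s (last (y # c)))"
      and e': "{\<phi> x, \<phi> y} \<in> negs B \<longleftrightarrow> ({x, y} \<in> negs G) \<noteq> (s x \<noteq> s y)"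
      using 3(2) e[of x y] v[of x] by simp_all
    have "neg_parity B (map \<phi> (x # y # c)) \<longleftrightarrow> (({\<phi> x, \<phi> y} \<in> negs B) \<noteq> neg_parity B (map \<phi> (y # c)))"
      by simp
    moreover have "neg_parity G (x # y # c) \<longleftrightarrow> (({x, y} \<in> negs G) \<noteq> neg_parity G (y # c))" by simp
    ultimately have "neg_parity B (map \<phi> (x # y # c)) \<longleftrightarrow>
        neg_parity G (x # y # c) \<noteq> (s x \<noteq> s (last (y # c)))"
      using i e' by argo
    then have "neg_parity B (map \<phi> (x # y # c)) \<longleftrightarrow>
        neg_parity G (x # y # c) \<noteq> (s (hd (x # y # c)) \<noteq> s (last (x # y # c)))"
      by (simp only: list.sel last.simps list.simps if_False)
    then show ?case using IH by simp
  qed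
  show ?thesis unfolding sg_hom_def
  proof (intro conjI allI impI)
    show "\<phi> ` verts G \<subseteq> verts B" using v by blast
    fix c assume c: "closed_walk G c"
    then have "c \<noteq> []" by (auto simp: closed_walk_def walk_def)
    then show "closed_walk B (map \<phi> c)" using w[of c] c by (auto simp: closed_walk_def hd_map last_map)
    show "balanced B (map \<phi> c) = balanced G c"
      using w[of c] c by (auto simp: closed_walk_def neg_parity_def)
  qed
qed

text \<open>For the trivial minor, the residues \<open>1\<close> and \<open>2k - 1\<close> can only be realized by edges of \<open>B\<close> of the
  right sign.\<close>

theorem stable_bounds:
  assumes S: "stable k B S" and k: "2 \<le> k" and B: "signed_graph B"
  shows "bounds k B"
  unfolding bounds_def
proof (intro allI impI)
  fix G :: "nat sgraph"
  assume A: "signed_bipartite G \<and> enat (2 * k) \<le> unbalanced_girth G \<and> K4_minor_free G"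
  let ?N = "2 * int k"
  have G: "signed_graph G" using A by (simp add: signed_bipartite_def)
  obtain X Y where XY: "X \<inter> Y = {}" "\<forall>e\<in>edges G. \<exists>x\<in>X. \<exists>y\<in>Y. e = {x, y}"
    using A unfolding signed_bipartite_def by (elim conjE exE) simp
  let ?E = "\<lambda>x y. {x, y} \<in> edges G"
  let ?d = "graph_weight (2 * k) G"
  have col: "(x \<in> X) \<noteq> (y \<in> X)" if e: "{x, y} \<in> edges G" for x y
  proof -
    obtain a b where "a \<in> X" "b \<in> Y" "{x, y} = {a, b}" using XY(2) e by blast
    then show ?thesis using XY(1) by (auto simp: doubleton_eq_iff)
  qed
  have w: "weighted ?N (\<lambda>x. x \<in> X) ?E ?d"
    using weighted_graph[OF G _ _ _ col, of "2 * k"] A k by simp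
  have m: "minor_model G (verts G) (\<lambda>x. {x}) ?E"
    unfolding minor_model_def
  proof (intro conjI ballI allI impI)
    show "finite (verts G)" using G by (simp add: signed_graph_def)
    fix x y assume e: "{x, y} \<in> edges G"
    show "x \<in> verts G" "y \<in> verts G" "x \<noteq> y" using signed_graph_edgeD[OF G e] by auto
    show "{y, x} \<in> edges G" using e by (simp add: insert_commute)
    show "touching G {x} {y}" using e by (simp add: touching_def)
  qed (auto simp: conn_def)
  obtain \<phi> s where r: "realizes k B S (verts G) ?E ?d \<phi> s"
    using realizes_exists[OF S k B _ m w] A by blast
  have "sg_hom G B \<phi>"
  proof (rule sg_hom_switching[OF _ G, where s = s])
    fix x assume "x \<in> verts G"
    then obtain y where "{\<phi> x, y} \<in> sdg_edges k B" using realizesD(1)[OF r] S unfolding stable_def by blast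
    then show "\<phi> x \<in> verts B" using sdg_edgeD(3)[OF B] by blast
  next
    fix x y assume e: "{x, y} \<in> edges G"
    then have "{\<phi> x, \<phi> y} \<in> S" and ad: "[ad B (\<phi> x) (\<phi> y) = (if s x = s y then ?d x y else - ?d x y)] (mod ?N)"
      using realizesD(2,3)[OF r] by blast+
    then have sdg: "{\<phi> x, \<phi> y} \<in> sdg_edges k B" using S by (auto simp: stable_def)
    let ?p = "ad B (\<phi> x) (\<phi> y)"
    let ?n = "({x, y} \<in> negs G) \<noteq> (s x \<noteq> s y)"
    have p: "is_weight k ?p" by (rule sdg_edgeD(2)[OF B sdg])
    have "[(if s x = s y then ?d x y else - ?d x y) = (if ?n then - 1 else 1)] (mod ?N)"
      by (auto simp: graph_weight_def cong_iff_dvd_diff)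
    then have "[?p = (if ?n then - 1 else 1)] (mod ?N)" using ad cong_trans by blast
    then have "?N dvd ?p - (if ?n then - 1 else 1)" by (simp add: cong_iff_dvd_diff)
    moreover have "\<bar>?p - (if ?n then - 1 else 1)\<bar> < ?N" using p k by (auto simp: is_weight_def)
    ultimately have "?p - (if ?n then - 1 else 1) = 0" by (metis zdvd_not_zless abs_dvd_iff dvd_abs_iff zero_less_abs_iff)
    then have "?p = (if ?n then - 1 else 1)" by simp
    then show "{\<phi> x, \<phi> y} \<in> edges B \<and> ({\<phi> x, \<phi> y} \<in> negs B \<longleftrightarrow> ?n)"
      using ad_one_edge[OF B sdg] by (auto split: if_splits)
  qed
  then show "\<exists>\<phi>. sg_hom G B \<phi>" by blast
qed

section \<open>Two-trees\<close>

text \<open>Two-trees carry no signs; these come from a labelling of the vertices later on.\<close>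

definition attach :: "'a sgraph \<Rightarrow> 'a \<Rightarrow> 'a \<Rightarrow> 'a \<Rightarrow> 'a sgraph" where
  "attach H u v z = \<lparr>verts = insert z (verts H), edges = edges H \<union> {{u, z}, {v, z}}, negs = {}\<rparr>"

lemma attach_sel [simp]:
  "verts (attach H u v z) = insert z (verts H)"
  "edges (attach H u v z) = edges H \<union> {{u, z}, {v, z}}"
  "negs (attach H u v z) = {}"
  by (simp_all add: attach_def)

inductive two_tree :: "nat sgraph \<Rightarrow> bool" where
  two_tree_edge: "two_tree \<lparr>verts = {0, 1}, edges = {{0, 1}}, negs = {}\<rparr>"
| two_tree_attach: "two_tree H \<Longrightarrow> {u, v} \<in> edges H \<Longrightarrow> z \<notin> verts H \<Longrightarrow> two_tree (attach H u v z)"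

lemma signed_graph_attach:
  assumes "signed_graph H" "{u, v} \<in> edges H" "z \<notin> verts H"
  shows "signed_graph (attach H u v z)"
proof -
  have uv: "u \<in> verts H" "v \<in> verts H" using signed_graph_edgeD[OF assms(1,2)] by auto
  have "e \<in> {{x, y} | x y. x \<in> insert z (verts H) \<and> y \<in> insert z (verts H) \<and> x \<noteq> y}"
    if A: "e \<in> edges H \<union> {{u, z}, {v, z}}" for e
  proof -
    consider "e \<in> edges H" | "e = {u, z}" | "e = {v, z}" using A by blast
    then show ?thesis
    proof cases
      case 1
      then obtain x y where "e = {x, y}" "x \<in> verts H" "y \<in> verts H" "x \<noteq> y"
        using signed_graph_edge_obtain[OF assms(1)] by metis
      then show ?thesis by blast
    next
      case 2
      then show ?thesis using uv assms(3) by blast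
    next
      case 3
      then show ?thesis using uv assms(3) by blast
    qed
  qed
  then show ?thesis using assms(1) unfolding signed_graph_def attach_sel by blast
qed

lemma signed_graph_two_tree: "two_tree H \<Longrightarrow> signed_graph H"
proof (induction rule: two_tree.induct)
  case two_tree_edge
  then show ?case by (auto simp: signed_graph_def)
qed (rule signed_graph_attach)

text \<open>A path through the new vertex \<open>z\<close> enters and leaves it by \<open>u\<close> and \<open>v\<close>, so the edge \<open>uv\<close> is a shortcut.\<close>

lemma conn_rel_avoiding:
  assumes p: "(x, y) \<in> (conn_rel (attach H u v z) S)\<^sup>*" and x: "x \<noteq> z"
    and uv: "{u, v} \<in> edges H" and z: "z \<notin> verts H" and H: "signed_graph H"
  shows "if y = z then \<exists>w\<in>S \<inter> {u, v}. (x, w) \<in> (conn_rel H (S - {z}))\<^sup>* else (x, y) \<in> (conn_rel H (S - {z}))\<^sup>*"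
  using p
proof (induction)
  case base
  then show ?case using x by simp
next
  case (step a b)
  let ?R = "conn_rel H (S - {z})"
  have ab: "a \<in> S" "b \<in> S" "{a, b} \<in> edges H \<or> {a, b} = {u, z} \<or> {a, b} = {v, z}"
    using step(2) by (auto simp: conn_rel_def)
  have uz: "u \<noteq> z" "v \<noteq> z" using signed_graph_edgeD[OF H uv] z by auto
  have ez: "{a, b} \<in> edges H \<Longrightarrow> a \<noteq> z \<and> b \<noteq> z" using signed_graph_edgeD[OF H, of a b] z by auto
  show ?case
  proof (cases "a = z")
    case True
    then have b: "b = u \<or> b = v" "b \<noteq> z" using ab(3) ez uz by (auto simp: doubleton_eq_iff)
    obtain w where w: "w \<in> S \<inter> {u, v}" "(x, w) \<in> ?R\<^sup>*" using step(3) True by auto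
    have "w = b \<or> {w, b} = {u, v}" using w(1) b(1) by auto
    then have "w = b \<or> (w, b) \<in> ?R"
      using w(1) b ab(2) uv uz by (auto simp: conn_rel_def)
    then have "(x, b) \<in> ?R\<^sup>*" using w(2) by (auto intro: rtrancl_into_rtrancl)
    then show ?thesis using b by simp
  next
    case False
    then have a: "(x, a) \<in> ?R\<^sup>*" using step(3) by simp
    show ?thesis
    proof (cases "b = z")
      case True
      then have "a = u \<or> a = v" using ab(3) ez by (auto simp: doubleton_eq_iff)
      then show ?thesis using True a ab(1) by auto
    next
      case nb: False
      then have "(a, b) \<in> ?R" using ab False by (auto simp: conn_rel_def doubleton_eq_iff)
      then show ?thesis using nb a by (auto intro: rtrancl_into_rtrancl)
    qed
  qed
qed

text \<open>As \<open>K4_minor_free\<close>, but with connectedness expressed by a relation instead of paths.\<close>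

definition K4_model :: "'a sgraph \<Rightarrow> (nat \<Rightarrow> 'a set) \<Rightarrow> bool" where
  "K4_model G S \<longleftrightarrow>
     (\<forall>i<4. S i \<noteq> {} \<and> S i \<subseteq> verts G \<and> conn G (S i)) \<and>
     (\<forall>i<4. \<forall>j<4. i \<noteq> j \<longrightarrow> S i \<inter> S j = {} \<and> touching G (S i) (S j))"

lemma K4_minor_free_iff: "K4_minor_free G \<longleftrightarrow> (\<forall>S. \<not> K4_model G S)"
proof -
  have "((\<forall>i<4. S i \<noteq> {} \<and> S i \<subseteq> verts G \<and> connected_in G (S i)) \<and>
      (\<forall>i<4. \<forall>j<4. i \<noteq> j \<longrightarrow> S i \<inter> S j = {} \<and> (\<exists>x\<in>S i. \<exists>y\<in>S j. {x, y} \<in> edges G))) \<longleftrightarrow> K4_model G S"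
    for S :: "nat \<Rightarrow> 'a set"
    unfolding K4_model_def touching_def using connected_in_iff[of _ G] by (intro conj_cong refl) auto
  then show ?thesis unfolding K4_minor_free_def by simp
qed

lemma K4_modelD:
  assumes "K4_model G S" "i < 4"
  shows "S i \<noteq> {}" "S i \<subseteq> verts G" "conn G (S i)"
    "j < 4 \<Longrightarrow> i \<noteq> j \<Longrightarrow> S i \<inter> S j = {}" "j < 4 \<Longrightarrow> i \<noteq> j \<Longrightarrow> touching G (S i) (S j)"
  using assms unfolding K4_model_def by simp_all

text \<open>If \<open>{z}\<close> is a branch set, it touches at most two others, as \<open>z\<close> has two neighbours.  Otherwise \<open>z\<close> is
  removed from its branch set; the edge \<open>uv\<close> replaces the connections through \<open>z\<close>.\<close>

lemma K4_minor_free_attach: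
  assumes H: "signed_graph H" "K4_minor_free H" and uv: "{u, v} \<in> edges H" and z: "z \<notin> verts H"
  shows "K4_minor_free (attach H u v z)"
  unfolding K4_minor_free_iff
proof (intro allI notI)
  let ?A = "attach H u v z"
  fix S assume S: "K4_model ?A S"
  note D = K4_modelD[OF S]
  have uvz: "u \<noteq> z" "v \<noteq> z" "u \<noteq> v" using signed_graph_edgeD[OF H(1) uv] z by auto
  have nb: "w = u \<or> w = v" if "{z, w} \<in> edges ?A" for w
  proof -
    have "{z, w} \<notin> edges H" using signed_graph_edgeD(1)[OF H(1), of z w] z by blast
    then show ?thesis using that uvz by (auto simp: doubleton_eq_iff)
  qed
  have "\<not> (\<exists>i<4. S i = {z})"
  proof
    assume "\<exists>i<4. S i = {z}"
    then obtain i where i: "i < 4" "S i = {z}" by blast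
    have "u \<in> S j \<or> v \<in> S j" if "j < 4" "j \<noteq> i" for j
    proof -
      have "touching ?A {z} (S j)" using D(5)[OF i(1) that(1)] that(2) i(2) by simp
      then obtain w where "w \<in> S j" "{z, w} \<in> edges ?A" unfolding touching_def by blast
      then show ?thesis using nb[of w] by blast
    qed
    then have J: "u \<in> S j \<or> v \<in> S j" if "j \<in> {..<4} - {i}" for j using that by auto
    have "card ({..<4} - {i}) = 3" using i by simp
    then obtain j1 j2 j3 where j: "{..<4} - {i} = {j1, j2, j3}" "j1 \<noteq> j2" "j1 \<noteq> j3" "j2 \<noteq> j3"
      by (auto simp: card_3_iff)
    then have j4: "j1 < 4" "j2 < 4" "j3 < 4" by auto
    have "S j1 \<inter> S j2 = {}" "S j1 \<inter> S j3 = {}" "S j2 \<inter> S j3 = {}" using D(4) j4 j(2-4) by blast+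
    moreover have "u \<in> S j1 \<or> v \<in> S j1" "u \<in> S j2 \<or> v \<in> S j2" "u \<in> S j3 \<or> v \<in> S j3"
      using J j(1) by blast+
    ultimately show False by blast
  qed
  then have ne: "S i - {z} \<noteq> {}" if "i < 4" for i using D(1)[OF that] that by blast
  have conn': "conn H (S i - {z})" if i: "i < 4" for i
    unfolding conn_def
  proof (intro ballI)
    fix x y assume "x \<in> S i - {z}" "y \<in> S i - {z}"
    then have "(x, y) \<in> (conn_rel ?A (S i))\<^sup>*" "x \<noteq> z" "y \<noteq> z" using D(3)[OF i] by (auto simp: conn_def)
    then show "(x, y) \<in> (conn_rel H (S i - {z}))\<^sup>*" using conn_rel_avoiding[OF _ _ uv z H(1), of x y "S i"] by simp
  qed
  have touch: "\<exists>x\<in>S i - {z}. \<exists>y\<in>S j - {z}. {x, y} \<in> edges H" if i: "i < 4" "j < 4" "i \<noteq> j" for i j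
  proof -
    have zcase: "\<exists>x\<in>S i - {z}. \<exists>y\<in>S j - {z}. {x, y} \<in> edges H"
      if i: "i < 4" "j < 4" "i \<noteq> j" and zi: "z \<in> S i" and y: "y \<in> S j" "{z, y} \<in> edges ?A" for i j y
    proof -
      obtain x where x: "x \<in> S i - {z}" using ne[OF i(1)] by blast
      then have "(x, z) \<in> (conn_rel ?A (S i))\<^sup>*" using D(3)[OF i(1)] zi by (auto simp: conn_def)
      then obtain w where w: "w \<in> S i" "w = u \<or> w = v"
        using conn_rel_avoiding[OF _ _ uv z H(1), of x z "S i"] x by auto
      have "y = u \<or> y = v" using nb[OF y(2)] .
      moreover have "y \<noteq> w" using w(1) y(1) D(4)[OF i] by blast
      ultimately have "{w, y} \<in> edges H" using w(2) uv by (auto simp: insert_commute)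
      then show ?thesis using w y uvz \<open>y = u \<or> y = v\<close> by blast
    qed
    obtain x y where xy: "x \<in> S i" "y \<in> S j" "{x, y} \<in> edges ?A"
      using D(5)[OF i] unfolding touching_def by blast
    show ?thesis
    proof (cases "x = z \<or> y = z")
      case True
      then show ?thesis
      proof
        assume "x = z" then show ?thesis using zcase[OF i] xy by blast
      next
        assume "y = z"
        then obtain y' x' where "y' \<in> S j - {z}" "x' \<in> S i - {z}" "{y', x'} \<in> edges H"
          using zcase[of j i x] i xy by (metis insert_commute)
        then show ?thesis by (metis insert_commute)
      qed
    next
      case False
      then have "{x, y} \<in> edges H" using xy(3) by (auto simp: doubleton_eq_iff)
      then show ?thesis using False xy by blast
    qed
  qed
  have "K4_model H (\<lambda>i. S i - {z})" unfolding K4_model_def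
  proof (intro conjI allI impI)
    fix i :: nat assume i: "i < 4"
    show "S i - {z} \<noteq> {}" by (rule ne[OF i])
    show "S i - {z} \<subseteq> verts H" using D(2)[OF i] by auto
    show "conn H (S i - {z})" by (rule conn'[OF i])
    fix j :: nat assume j: "j < 4" "i \<noteq> j"
    show "(S i - {z}) \<inter> (S j - {z}) = {}" using D(4)[OF i j] by blast
    show "touching H (S i - {z}) (S j - {z})" using touch[OF i j] by (simp add: touching_def)
  qed
  then show False using H(2) unfolding K4_minor_free_iff by blast
qed

lemma K4_minor_free_card:
  assumes "finite (verts G)" "card (verts G) < 4"
  shows "K4_minor_free G"
  unfolding K4_minor_free_iff
proof (intro allI notI)
  fix S assume S: "K4_model G S"
  note D = K4_modelD[OF S]
  have "\<exists>x. x \<in> S i" if "i < 4" for i using D(1)[OF that] by blast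
  then obtain g where g: "\<And>i. i < 4 \<Longrightarrow> g i \<in> S i" by metis
  have "inj_on g {..<4}"
  proof (rule inj_onI, rule ccontr)
    fix i j assume "i \<in> {..<4}" "j \<in> {..<4}" "g i = g j" "i \<noteq> j"
    then show False using D(4)[of i j] g[of i] g[of j] by auto
  qed
  moreover have "g ` {..<4} \<subseteq> verts G" using D(2) g by blast
  ultimately have "4 \<le> card (verts G)" using card_inj_on_le[of g "{..<4}" "verts G"] assms(1) by simp
  then show False using assms(2) by simp
qed

lemma K4_minor_free_two_tree: "two_tree H \<Longrightarrow> K4_minor_free H"
proof (induction rule: two_tree.induct)
  case two_tree_edge
  then show ?case by (intro K4_minor_free_card) auto
next
  case (two_tree_attach H u v z)
  then show ?case by (intro K4_minor_free_attach signed_graph_two_tree)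
qed

lemma K4_minor_free_subgraph:
  assumes "K4_minor_free H" "verts G \<subseteq> verts H" "edges G \<subseteq> edges H"
  shows "K4_minor_free G"
  unfolding K4_minor_free_iff
proof (intro allI notI)
  fix S assume S: "K4_model G S"
  note D = K4_modelD[OF S]
  have mono: "conn_rel G T \<subseteq> conn_rel H T" for T by (rule conn_rel_mono[OF subset_refl assms(3)])
  have "K4_model H S" unfolding K4_model_def
  proof (intro conjI allI impI)
    fix i :: nat assume i: "i < 4"
    show "S i \<noteq> {}" by (rule D(1)[OF i])
    show "S i \<subseteq> verts H" using D(2)[OF i] assms(2) by blast
    show "conn H (S i)" using D(3)[OF i] rtrancl_mono[OF mono] unfolding conn_def by blast
    fix j :: nat assume j: "j < 4" "i \<noteq> j"
    show "S i \<inter> S j = {}" by (rule D(4)[OF i j])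
    show "touching H (S i) (S j)" using D(5)[OF i j] assms(3) unfolding touching_def by blast
  qed
  then show False using assms(1) unfolding K4_minor_free_iff by blast
qed

section \<open>Labelled two-trees\<close>

text \<open>The largest signed subgraph of \<open>H\<close> for which \<open>f\<close> is a labelling.  A two-tree has many edges that
  only serve for attaching further vertices; they disappear here unless their labels are those of
  an edge.\<close>

definition graph_of_labels :: "nat \<Rightarrow> nat sgraph \<Rightarrow> (nat \<Rightarrow> nat \<Rightarrow> bool) \<Rightarrow> nat sgraph" where
  "graph_of_labels N H f = \<lparr>verts = verts H,
     edges = {{x, y} | x y. {x, y} \<in> edges H \<and> (\<exists>s d. differ N (f x) (f y) s = {d})},
     negs = {{x, y} | x y. {x, y} \<in> edges H \<and> (\<exists>d. differ N (f x) (f y) True = {d})}\<rparr>"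

lemma graph_of_labels_verts [simp]: "verts (graph_of_labels N H f) = verts H"
  by (simp add: graph_of_labels_def)

lemma graph_of_labels_edges: "{x, y} \<in> edges (graph_of_labels N H f) \<longleftrightarrow> {x, y} \<in> edges H \<and> (\<exists>s d. differ N (f x) (f y) s = {d})"
proof
  assume "{x, y} \<in> edges (graph_of_labels N H f)"
  then obtain a b s d where "{x, y} = {a, b}" "{a, b} \<in> edges H" "differ N (f a) (f b) s = {d}"
    unfolding graph_of_labels_def by auto
  then show "{x, y} \<in> edges H \<and> (\<exists>s d. differ N (f x) (f y) s = {d})"
    using differ_commute[of N "f a" "f b" s] by (auto simp: doubleton_eq_iff insert_commute)
qed (auto simp: graph_of_labels_def)

lemma graph_of_labels_negs: "{x, y} \<in> negs (graph_of_labels N H f) \<longleftrightarrow> {x, y} \<in> edges H \<and> (\<exists>d. differ N (f x) (f y) True = {d})"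
proof
  assume "{x, y} \<in> negs (graph_of_labels N H f)"
  then obtain a b d where "{x, y} = {a, b}" "{a, b} \<in> edges H" "differ N (f a) (f b) True = {d}"
    unfolding graph_of_labels_def by auto
  then show "{x, y} \<in> edges H \<and> (\<exists>d. differ N (f x) (f y) True = {d})"
    using differ_commute[of N "f a" "f b" True] by (auto simp: doubleton_eq_iff insert_commute)
qed (auto simp: graph_of_labels_def)

lemma signed_graph_graph_of_labels:
  assumes "signed_graph H" shows "signed_graph (graph_of_labels N H f)"
proof -
  have "edges (graph_of_labels N H f) \<subseteq> edges H" by (auto simp: graph_of_labels_def)
  moreover have "negs (graph_of_labels N H f) \<subseteq> edges (graph_of_labels N H f)" by (auto simp: graph_of_labels_def)
  ultimately show ?thesis using assms unfolding signed_graph_def graph_of_labels_verts by blast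
qed

text \<open>Vectors that differ in one coordinate are not the complements of such vectors when \<open>N\<close> is at least
  three, so the labels determine the sign.\<close>

lemma graph_of_labels_neg_of_label:
  assumes "3 \<le> N" "{x, y} \<in> edges H" "differ N (f x) (f y) s = {d}"
  shows "{x, y} \<in> edges (graph_of_labels N H f)" "{x, y} \<in> negs (graph_of_labels N H f) \<longleftrightarrow> s"
proof -
  show "{x, y} \<in> edges (graph_of_labels N H f)" using assms by (auto simp: graph_of_labels_edges)
  have "\<not> (\<exists>d. differ N (f x) (f y) True = {d})" if "\<not> s"
  proof
    assume "\<exists>d. differ N (f x) (f y) True = {d}"
    then have "card (differ N (f x) (f y) True) = 1" by auto
    moreover have "card (differ N (f x) (f y) False) = 1" using assms(3) that by simp
    ultimately show False using card_differ_not[of N "f x" "f y" False] assms(1) by simp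
  qed
  then show "{x, y} \<in> negs (graph_of_labels N H f) \<longleftrightarrow> s" using assms(2,3) by (cases s) (auto simp: graph_of_labels_negs)
qed

lemma graph_of_labels_swalk_edge:
  assumes "3 \<le> N" "signed_graph H" "{x, y} \<in> edges H" "differ N (f x) (f y) s = {d}"
  shows "swalk (graph_of_labels N H f) x y s 1"
proof -
  note R = graph_of_labels_neg_of_label[where f = f, OF assms(1,3,4)]
  have "swalk (graph_of_labels N H f) x y ({x, y} \<in> negs (graph_of_labels N H f)) 1"
    by (rule swalk_edge[OF signed_graph_graph_of_labels[OF assms(2)] R(1)])
  then show ?thesis unfolding R(2) .
qed

lemma labelled_graph_of_labels:
  assumes "3 \<le> N" shows "labelled N (graph_of_labels N H f) f"
  unfolding labelled_def
proof (intro allI impI)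
  fix x y assume e: "{x, y} \<in> edges (graph_of_labels N H f)"
  then obtain s d where d: "{x, y} \<in> edges H" "differ N (f x) (f y) s = {d}" by (auto simp: graph_of_labels_edges)
  then show "\<exists>d. differ N (f x) (f y) ({x, y} \<in> negs (graph_of_labels N H f)) = {d}"
    using graph_of_labels_neg_of_label(2)[OF assms d(1), of f s d] by auto
qed

definition extends :: "nat sgraph \<Rightarrow> (nat \<Rightarrow> nat \<Rightarrow> bool) \<Rightarrow> nat sgraph \<Rightarrow> (nat \<Rightarrow> nat \<Rightarrow> bool) \<Rightarrow> bool" where
  "extends H f H' f' \<longleftrightarrow> two_tree H' \<and> verts H \<subseteq> verts H' \<and> edges H \<subseteq> edges H' \<and> (\<forall>x\<in>verts H. f' x = f x)"

lemma extends_refl: "two_tree H \<Longrightarrow> extends H f H f"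
  by (simp add: extends_def)

lemma extends_trans: "extends H f H' f' \<Longrightarrow> extends H' f' H'' f'' \<Longrightarrow> extends H f H'' f''"
  unfolding extends_def by fastforce

lemma extends_attach:
  assumes "two_tree H" "{u, v} \<in> edges H" "z \<notin> verts H"
  shows "extends H f (attach H u v z) (f(z := c))"
  using two_tree_attach[OF assms] assms(3) by (auto simp: extends_def)

lemma extends_swalk:
  assumes "extends H f H' f'" "signed_graph H" "swalk (graph_of_labels N H f) x y s l"
  shows "swalk (graph_of_labels N H' f') x y s l"
proof (rule swalk_mono[OF assms(3)])
  show "verts (graph_of_labels N H f) \<subseteq> verts (graph_of_labels N H' f')" using assms(1) by (simp add: extends_def)
  have lab: "f' x = f x" "f' y = f y" if "{x, y} \<in> edges H" for x y
    using signed_graph_edgeD[OF assms(2) that] assms(1) by (auto simp: extends_def)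
  have sub: "edges H \<subseteq> edges H'" using assms(1) by (simp add: extends_def)
  show "edges (graph_of_labels N H f) \<subseteq> edges (graph_of_labels N H' f')"
  proof
    fix e assume e: "e \<in> edges (graph_of_labels N H f)"
    then obtain x y where "e = {x, y}" by (auto simp: graph_of_labels_def)
    then show "e \<in> edges (graph_of_labels N H' f')" using e sub lab[of x y] by (auto simp: graph_of_labels_edges)
  qed
  fix e assume e: "e \<in> edges (graph_of_labels N H f)"
  then obtain x y where "e = {x, y}" by (auto simp: graph_of_labels_def)
  then show "e \<in> negs (graph_of_labels N H' f') \<longleftrightarrow> e \<in> negs (graph_of_labels N H f)"
    using e sub lab[of x y] by (auto simp: graph_of_labels_edges graph_of_labels_negs)
qed

text \<open>The new vertices are attached one after the other, each to the edge between the last one and \<open>v\<close>;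
  their labels change one coordinate at a time.  The last edge, to \<open>v\<close> itself, carries the sign.\<close>

lemma extends_path:
  assumes "3 \<le> N" "two_tree H" "{u, v} \<in> edges H" "distinct ds" "ds \<noteq> []" "set ds = differ N (f u) (f v) t"
  shows "\<exists>H' f'. extends H f H' f' \<and> swalk (graph_of_labels N H' f') u v t (length ds)"
  using assms
proof (induction ds arbitrary: H f u)
  case (Cons d ds)
  note H = signed_graph_two_tree[OF Cons.prems(2)]
  show ?case
  proof (cases "ds = []")
    case True
    then have "differ N (f u) (f v) t = {d}" using Cons.prems(6) by simp
    from graph_of_labels_swalk_edge[where f = f, OF Cons.prems(1) H Cons.prems(3) this]
    have "swalk (graph_of_labels N H f) u v t 1" .
    then show ?thesis using True extends_refl[OF Cons.prems(2)] by (intro exI[of _ H] exI[of _ f]) simp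
  next
    case False
    obtain z where z: "z \<notin> verts H" using H ex_new_if_finite[of "verts H"] by (auto simp: signed_graph_def)
    define H1 where "H1 = attach H u v z"
    define f1 where "f1 = f(z := \<lambda>i. f u i \<noteq> (i = d))"
    have e1: "extends H f H1 f1" unfolding H1_def f1_def by (rule extends_attach[OF Cons.prems(2,3) z])
    have t1: "two_tree H1" using e1 by (simp add: extends_def)
    have uv: "u \<noteq> z" "v \<noteq> z" using signed_graph_edgeD[OF H Cons.prems(3)] z by auto
    have dN: "d < N" "d \<in> differ N (f u) (f v) t" using Cons.prems(6) by (auto simp: differ_def)
    have "differ N (f1 u) (f1 z) False = {d}" using uv dN by (auto simp: f1_def differ_def)
    moreover have "{u, z} \<in> edges H1" by (simp add: H1_def)
    ultimately have "swalk (graph_of_labels N H1 f1) u z False 1"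
      using graph_of_labels_swalk_edge[OF Cons.prems(1) signed_graph_two_tree[OF t1]] by blast
    moreover have "\<exists>H' f'. extends H1 f1 H' f' \<and> swalk (graph_of_labels N H' f') z v t (length ds)"
    proof (rule Cons.IH[OF Cons.prems(1) t1 _ _ False])
      show "{z, v} \<in> edges H1" by (simp add: H1_def insert_commute)
      show "distinct ds" using Cons.prems(4) by simp
      have "differ N (f1 z) (f1 v) t = differ N (f u) (f v) t - {d}"
        using uv dN by (auto simp: f1_def differ_def)
      then show "set ds = differ N (f1 z) (f1 v) t" using Cons.prems(4,6) by auto
    qed
    ultimately obtain H' f' where "extends H1 f1 H' f'" "swalk (graph_of_labels N H' f') z v t (length ds)"
      "swalk (graph_of_labels N H' f') u z False 1"
      using extends_swalk[OF _ signed_graph_two_tree[OF t1]] by blast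
    note e2 = this
    have "swalk (graph_of_labels N H' f') u v t (length (d # ds))"
      using swalk_trans[OF e2(2,3)] by simp
    then show ?thesis using extends_trans[OF e1 e2(1)] by blast
  qed
qed simp

text \<open>There are \<open>u\<close>-\<open>v\<close> walks of both signs, as short as the labels permit; together they have length \<open>N\<close>.\<close>

definition linked :: "nat \<Rightarrow> nat sgraph \<Rightarrow> (nat \<Rightarrow> nat \<Rightarrow> bool) \<Rightarrow> nat \<Rightarrow> nat \<Rightarrow> bool" where
  "linked N H f u v \<longleftrightarrow> (\<forall>t. swalk (graph_of_labels N H f) u v t (card (differ N (f u) (f v) t)))"

lemma extends_linked:
  assumes N: "3 \<le> N" and H: "two_tree H" "{u, v} \<in> edges H"
    and c: "0 < card (differ N (f u) (f v) False)" "card (differ N (f u) (f v) False) < N"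
  shows "\<exists>H' f'. extends H f H' f' \<and> linked N H' f' u v"
proof -
  have uv: "u \<in> verts H" "v \<in> verts H" using signed_graph_edgeD[OF signed_graph_two_tree[OF H(1)] H(2)] by auto
  have path: "\<exists>H' f'. extends H1 f1 H' f' \<and> swalk (graph_of_labels N H' f') u v t (card (differ N (f u) (f v) t))"
    if e: "extends H f H1 f1" for H1 f1 t
  proof -
    have f1: "f1 u = f u" "f1 v = f v" and H1: "two_tree H1" "{u, v} \<in> edges H1"
      using e uv H by (auto simp: extends_def)
    obtain ds where ds: "distinct ds" "set ds = differ N (f1 u) (f1 v) t"
      using finite_distinct_list[OF finite_differ] by metis
    have "0 < card (differ N (f u) (f v) t)"
      using c card_differ_not[of N "f u" "f v" False] by (cases t) auto
    then have "ds \<noteq> []" using ds f1 by auto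
    moreover have "length ds = card (differ N (f u) (f v) t)" using ds f1 distinct_card[of ds] by simp
    ultimately show ?thesis using extends_path[OF N H1 ds(1) _ ds(2)] by metis
  qed
  obtain H1 f1 where 1: "extends H f H1 f1" "swalk (graph_of_labels N H1 f1) u v True (card (differ N (f u) (f v) True))"
    using path[OF extends_refl[OF H(1)]] by blast
  obtain H2 f2 where 2: "extends H1 f1 H2 f2" "swalk (graph_of_labels N H2 f2) u v False (card (differ N (f u) (f v) False))"
    using path[OF 1(1)] by blast
  have "two_tree H1" using 1(1) by (simp add: extends_def)
  then have "swalk (graph_of_labels N H2 f2) u v True (card (differ N (f u) (f v) True))"
    using extends_swalk[OF 2(1) signed_graph_two_tree 1(2)] by blast
  moreover have e2: "extends H f H2 f2" by (rule extends_trans[OF 1(1) 2(1)])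
  then have "f2 u = f u" "f2 v = f v" using uv by (auto simp: extends_def)
  ultimately have "linked N H2 f2 u v" using 2(2) unfolding linked_def by (metis (full_types))
  then show ?thesis using e2 by blast
qed

lemma linked_extends:
  assumes "extends H f H' f'" "two_tree H" "u \<in> verts H" "v \<in> verts H" "linked N H f u v"
  shows "linked N H' f' u v"
  using assms extends_swalk[OF assms(1) signed_graph_two_tree[OF assms(2)]]
  unfolding linked_def extends_def by simp

section \<open>Homomorphisms and switching\<close>

text \<open>Harary's theorem: a signed graph without unbalanced closed walks can be switched to an all-positive
  one.  The value at a vertex is the sign of all walks to it from the least vertex of its component.\<close>

lemma balanced_potential:
  fixes G :: "nat sgraph"
  assumes G: "signed_graph G" and bal: "\<And>x l. \<not> swalk G x x True l"
  shows "\<exists>s :: nat \<Rightarrow> bool. \<forall>x y. {x, y} \<in> edges G \<longrightarrow> ({x, y} \<in> negs G) = (s x \<noteq> s y)"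
proof -
  define root where "root x = (LEAST r. \<exists>t l. swalk G r x t l)" for x
  define s where "s x \<longleftrightarrow> (\<exists>l. swalk G (root x) x True l)" for x
  have uniq: "t = t'" if "swalk G r x t l" "swalk G r x t' l'" for r x t t' l l'
  proof (rule ccontr)
    assume "t \<noteq> t'"
    then have "(t \<noteq> t') = True" by blast
    then show False using swalk_trans[OF swalk_sym[OF G that(2)] that(1)] bal by (simp only:)
  qed
  have sx: "s x = t" if "swalk G (root x) x t l" for x t l
  proof (cases t)
    case True
    then show ?thesis using that by (auto simp: s_def)
  next
    case False
    then have "\<not> s x" using uniq[OF that, of True] unfolding s_def by blast
    then show ?thesis using False by simp
  qed
  have "({x, y} \<in> negs G) = (s x \<noteq> s y)" if e: "{x, y} \<in> edges G" for x y
  proof -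
    have step: "swalk G r y (t \<noteq> ({x, y} \<in> negs G)) (Suc l)" if "swalk G r x t l" for r t l
      by (rule swalk_step[OF that e])
    have prev: "swalk G r x (t \<noteq> ({x, y} \<in> negs G)) (Suc l)" if "swalk G r y t l" for r t l
      using swalk_step[OF that, of x] e by (simp add: insert_commute)
    have "(\<exists>t l. swalk G r x t l) \<longleftrightarrow> (\<exists>t l. swalk G r y t l)" for r using step prev by blast
    then have r: "root x = root y" by (simp add: root_def)
    have "\<exists>t l. swalk G x x t l" using swalk_nil[OF signed_graph_edgeD(1)[OF G e]] by blast
    then have "\<exists>t l. swalk G (root x) x t l" unfolding root_def by (rule LeastI)
    then obtain t l where t: "swalk G (root x) x t l" by blast
    have "s y = (t \<noteq> ({x, y} \<in> negs G))" by (rule sx[where l = "Suc l"]) (use step[OF t] r in simp)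
    then show ?thesis using sx[OF t] by blast
  qed
  then show ?thesis by (intro exI[of _ s] allI impI)
qed

lemma sg_hom_edge:
  assumes "signed_graph G" "sg_hom G B \<phi>" "{x, y} \<in> edges G"
  shows "{\<phi> x, \<phi> y} \<in> edges B"
proof -
  have "closed_walk G [x, y, x]"
    using assms(3) signed_graph_edgeD[OF assms(1,3)] by (simp add: closed_walk_def insert_commute)
  then have "closed_walk B (map \<phi> [x, y, x])" using assms(2) unfolding sg_hom_def by blast
  then show ?thesis by (simp add: closed_walk_def)
qed

text \<open>The edges whose sign is changed by \<open>\<phi>\<close> form the negative edges of a signed graph on \<open>G\<close>, which is
  balanced because \<open>\<phi>\<close> preserves the signs of closed walks.\<close>

lemma sg_hom_switching_exists:
  fixes G :: "nat sgraph"
  assumes G: "signed_graph G" and h: "sg_hom G B \<phi>"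
  shows "\<exists>s :: nat \<Rightarrow> bool. \<forall>x y. {x, y} \<in> edges G \<longrightarrow>
    ({\<phi> x, \<phi> y} \<in> negs B) = (({x, y} \<in> negs G) \<noteq> (s x \<noteq> s y))"
proof -
  define D where "D = \<lparr>verts = verts G, edges = edges G,
    negs = {e \<in> edges G. (e \<in> negs G) \<noteq> (\<phi> ` e \<in> negs B)}\<rparr>"
  have D: "signed_graph D" using G by (auto simp: D_def signed_graph_def)
  have n: "{x, y} \<in> negs D \<longleftrightarrow> (({x, y} \<in> negs G) \<noteq> ({\<phi> x, \<phi> y} \<in> negs B))" if "{x, y} \<in> edges G" for x y
    using that by (simp add: D_def)
  have par: "neg_parity D c = (neg_parity G c \<noteq> neg_parity B (map \<phi> c))" if "walk G c" for c
    using that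
  proof (induction c rule: induct_list012)
    case (3 x y c)
    have i: "neg_parity D (y # c) = (neg_parity G (y # c) \<noteq> neg_parity B (map \<phi> (y # c)))" using 3 by simp
    have n': "{x, y} \<in> negs D \<longleftrightarrow> (({x, y} \<in> negs G) \<noteq> ({\<phi> x, \<phi> y} \<in> negs B))" using n 3 by simp
    have "neg_parity D (x # y # c) = (({x, y} \<in> negs D) \<noteq> neg_parity D (y # c))"
      "neg_parity G (x # y # c) = (({x, y} \<in> negs G) \<noteq> neg_parity G (y # c))"
      "neg_parity B (map \<phi> (x # y # c)) = (({\<phi> x, \<phi> y} \<in> negs B) \<noteq> neg_parity B (map \<phi> (y # c)))"
      by simp_all
    then show ?case using i n' by argo
  qed simp_all
  have "\<not> swalk D x x True l" for x l
  proof
    assume "swalk D x x True l"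
    then obtain c where c: "walk D c" "hd c = x" "last c = x" "neg_parity D c = True"
      using walk_of_swalk[OF D] by metis
    have w: "walk G c" using c(1) by (simp add: walk_def D_def)
    then have "closed_walk G c" using c by (simp add: closed_walk_def)
    then have "neg_parity B (map \<phi> c) = neg_parity G c" using h by (simp add: sg_hom_def neg_parity_def)
    then show False using par[OF w] c(4) by simp
  qed
  from balanced_potential[OF D this] obtain s :: "nat \<Rightarrow> bool"
    where s: "\<forall>x y. {x, y} \<in> edges D \<longrightarrow> ({x, y} \<in> negs D) = (s x \<noteq> s y)" ..
  have "({\<phi> x, \<phi> y} \<in> negs B) = (({x, y} \<in> negs G) \<noteq> (s x \<noteq> s y))" if e: "{x, y} \<in> edges G" for x y
  proof -
    have "({x, y} \<in> negs D) = (s x \<noteq> s y)" using s e unfolding D_def by simp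
    then show ?thesis using n[OF e] by argo
  qed
  then show ?thesis by (intro exI[of _ s] allI impI)
qed

lemma swalk_hom:
  fixes s :: "nat \<Rightarrow> bool"
  assumes G: "signed_graph G" and h: "sg_hom G B \<phi>"
    and s: "\<And>x y. {x, y} \<in> edges G \<Longrightarrow> ({\<phi> x, \<phi> y} \<in> negs B) = (({x, y} \<in> negs G) \<noteq> (s x \<noteq> s y))"
    and w: "swalk G x y t l"
  shows "swalk B (\<phi> x) (\<phi> y) (t \<noteq> (s x \<noteq> s y)) l"
  using w
proof (induction)
  case (swalk_nil x)
  then have "\<phi> x \<in> verts B" using h by (auto simp: sg_hom_def)
  then show ?case using swalk.swalk_nil[of "\<phi> x" B] by simp
next
  case (swalk_step x y t l z)
  have "swalk B (\<phi> x) (\<phi> z) ((t \<noteq> (s x \<noteq> s y)) \<noteq> ({\<phi> y, \<phi> z} \<in> negs B)) (Suc l)"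
    by (rule swalk.swalk_step[OF swalk_step.IH sg_hom_edge[OF G h swalk_step(2)]])
  moreover have "((t \<noteq> (s x \<noteq> s y)) \<noteq> ({\<phi> y, \<phi> z} \<in> negs B)) = ((t \<noteq> ({y, z} \<in> negs G)) \<noteq> (s x \<noteq> s z))"
    using s[OF swalk_step(2)] by argo
  ultimately show ?case by (simp only:)
qed

text \<open>Two walks of opposite signs whose lengths sum to \<open>2k\<close> are both shortest among the walks of their
  signs, since a shorter one would close up to an unbalanced walk of length less than \<open>2k\<close>.  The
  algebraic distance comes from the shorter of the two, and both choices have the same residue.\<close>

lemma ad_complementary_walks:
  assumes B: "signed_graph B" and g: "enat (2 * k) \<le> unbalanced_girth B"
    and d: "0 < a" "a < 2 * k"
    and w1: "swalk B x y s a" and w2: "swalk B x y (\<not> s) (2 * k - a)"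
  shows "{x, y} \<in> sdg_edges k B" "[ad B x y = (if s then - int a else int a)] (mod 2 * int k)"
proof -
  have closed: "2 * k \<le> l + m" if "swalk B x y t l" "swalk B x y (\<not> t) m" for t l m
  proof -
    have "swalk B y y ((\<not> t) \<noteq> t) (m + l)" by (rule swalk_trans[OF that(1) swalk_sym[OF B that(2)]])
    then show ?thesis using g unfolding unbalanced_girth_ge_iff[OF B] by fastforce
  qed
  have la: "a \<le> l" if "swalk B x y s l" for l using closed[OF that w2] d by linarith
  have lb: "2 * k - a \<le> l" if "swalk B x y (\<not> s) l" for l using closed[OF w1 that] by linarith
  obtain D where D: "gdist B x y = enat D" "\<exists>t. swalk B x y t D"
    "\<And>t l. swalk B x y t l \<Longrightarrow> D \<le> l" "ad B x y = (if swalk B x y False D then int D else - int D)"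
    using ad_props[OF B w1] by metis
  have Dle: "D \<le> a" "D \<le> 2 * k - a" using D(3) w1 w2 by auto
  have Deq: "D = (if t = s then a else 2 * k - a)" if "swalk B x y t D" for t
  proof (cases "t = s")
    case True
    then show ?thesis using la[of D] that Dle by simp
  next
    case False
    then have "swalk B x y (\<not> s) D" using that by (cases s; cases t) simp_all
    then show ?thesis using lb[of D] False Dle by simp
  qed
  have "\<exists>t. swalk B x y t D \<and> ad B x y = (if t then - int D else int D)"
  proof (cases "swalk B x y False D")
    case True
    then show ?thesis using D(4) by (intro exI[of _ False]) simp
  next
    case False
    then have "swalk B x y True D" using D(2) by (metis (full_types))
    then show ?thesis using D(4) False by (intro exI[of _ True]) simp
  qed
  then obtain t where t: "swalk B x y t D" "ad B x y = (if t then - int D else int D)" by blast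
  show "[ad B x y = (if s then - int a else int a)] (mod 2 * int k)"
    unfolding t(2) using Deq[OF t(1)] d by (cases s; cases t) (auto simp: cong_iff_dvd_diff of_nat_diff)
  have "x \<noteq> y"
  proof
    assume "x = y"
    then have "2 * k \<le> (if s then a else 2 * k - a)"
      using g w1 w2 unfolding unbalanced_girth_ge_iff[OF B] by (cases s) auto
    then show False using d by (simp split: if_splits)
  qed
  moreover have "\<bar>ad B x y\<bar> \<le> int k" using t(2) Dle by auto
  moreover have "x \<in> verts B" "y \<in> verts B" using swalk_verts[OF B w1] by auto
  ultimately show "{x, y} \<in> sdg_edges k B" using D(1) unfolding sdg_edges_def by blast
qed

section \<open>Gadgets that force the image of a pair\<close>

text \<open>The condition is on all extensions, so that gadgets for different pairs can be combined.\<close>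

definition forces :: "nat \<Rightarrow> 'b sgraph \<Rightarrow> 'b set set \<Rightarrow> nat \<Rightarrow> nat \<Rightarrow> nat sgraph \<Rightarrow> (nat \<Rightarrow> nat \<Rightarrow> bool) \<Rightarrow> bool" where
  "forces N B E u v H f \<longleftrightarrow>
     (\<forall>H' f' \<phi>. extends H f H' f' \<longrightarrow> sg_hom (graph_of_labels N H' f') B \<phi> \<longrightarrow> {\<phi> u, \<phi> v} \<in> E)"

lemma forces_extends: "forces N B E u v H f \<Longrightarrow> extends H f H' f' \<Longrightarrow> forces N B E u v H' f'"
  unfolding forces_def using extends_trans by blast

text \<open>All edges of all labelled two-trees are considered at once, because the edges to the third vertices
  attached later have to be forced as well.\<close>

definition forceable :: "nat \<Rightarrow> 'b sgraph \<Rightarrow> 'b set set \<Rightarrow> bool" where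
  "forceable N B E \<longleftrightarrow>
     (\<forall>H f u v. two_tree H \<longrightarrow> {u, v} \<in> edges H \<longrightarrow>
        0 < card (differ N (f u) (f v) False) \<longrightarrow> card (differ N (f u) (f v) False) < N \<longrightarrow>
        (\<exists>H' f'. extends H f H' f' \<and> linked N H' f' u v \<and> forces N B E u v H' f'))"

text \<open>The two walks of a linked pair are mapped to two walks of \<open>B\<close> with lengths that sum to \<open>2k\<close>.\<close>

lemma linked_image:
  fixes s :: "nat \<Rightarrow> bool"
  assumes B: "signed_graph B" and g: "enat (2 * k) \<le> unbalanced_girth B"
    and H: "two_tree H" "linked (2 * k) H f u v"
    and c: "0 < card (differ (2 * k) (f u) (f v) False)" "card (differ (2 * k) (f u) (f v) False) < 2 * k"
    and h: "sg_hom (graph_of_labels (2 * k) H f) B \<phi>"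
    and s: "\<And>x y. {x, y} \<in> edges (graph_of_labels (2 * k) H f) \<Longrightarrow>
      ({\<phi> x, \<phi> y} \<in> negs B) = (({x, y} \<in> negs (graph_of_labels (2 * k) H f)) \<noteq> (s x \<noteq> s y))"
  shows "{\<phi> u, \<phi> v} \<in> sdg_edges k B"
    "[ad B (\<phi> u) (\<phi> v) = (if s u \<noteq> s v then - int (card (differ (2 * k) (f u) (f v) False))
      else int (card (differ (2 * k) (f u) (f v) False)))] (mod 2 * int k)"
proof -
  let ?a = "card (differ (2 * k) (f u) (f v) False)"
  note G = signed_graph_graph_of_labels[OF signed_graph_two_tree[OF H(1)], of "2 * k" f]
  have "swalk (graph_of_labels (2 * k) H f) u v False ?a" using H(2) by (simp add: linked_def)
  from swalk_hom[OF G h s this] have w1: "swalk B (\<phi> u) (\<phi> v) (s u \<noteq> s v) ?a" by simp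
  have "swalk (graph_of_labels (2 * k) H f) u v True (2 * k - ?a)"
    using H(2) card_differ_not[of "2 * k" "f u" "f v" False] unfolding linked_def by (metis (full_types) simp_thms(8))
  from swalk_hom[OF G h s this] have w2: "swalk B (\<phi> u) (\<phi> v) (\<not> (s u \<noteq> s v)) (2 * k - ?a)" by simp
  show "{\<phi> u, \<phi> v} \<in> sdg_edges k B"
    "[ad B (\<phi> u) (\<phi> v) = (if s u \<noteq> s v then - int ?a else int ?a)] (mod 2 * int k)"
    using ad_complementary_walks[OF B g c w1 w2] by simp_all
qed

lemma forceable_sdg:
  assumes B: "signed_graph B" and g: "enat (2 * k) \<le> unbalanced_girth B" and k: "2 \<le> k"
  shows "forceable (2 * k) B (sdg_edges k B)"
  unfolding forceable_def
proof (intro allI impI)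
  fix H f u v
  assume H: "two_tree H" "{u, v} \<in> edges H" and
    c: "0 < card (differ (2 * k) (f u) (f v) False)" "card (differ (2 * k) (f u) (f v) False) < 2 * k"
  have "3 \<le> 2 * k" using k by simp
  from extends_linked[OF this H c] obtain H' f' where e: "extends H f H' f'" "linked (2 * k) H' f' u v" by blast
  have uv: "u \<in> verts H" "v \<in> verts H" using signed_graph_edgeD[OF signed_graph_two_tree[OF H(1)] H(2)] by auto
  have "forces (2 * k) B (sdg_edges k B) u v H' f'"
    unfolding forces_def
  proof (intro allI impI)
    fix H'' f'' \<phi> assume e': "extends H' f' H'' f''" and h: "sg_hom (graph_of_labels (2 * k) H'' f'') B \<phi>"
    have t: "two_tree H''" "two_tree H'" using e e' by (auto simp: extends_def)
    have uv': "u \<in> verts H'" "v \<in> verts H'" using uv e by (auto simp: extends_def)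
    have lab: "f'' u = f u" "f'' v = f v" using extends_trans[OF e(1) e'] uv by (auto simp: extends_def)
    from sg_hom_switching_exists[OF signed_graph_graph_of_labels[OF signed_graph_two_tree[OF t(1)]] h]
    obtain s :: "nat \<Rightarrow> bool" where s: "\<forall>x y. {x, y} \<in> edges (graph_of_labels (2 * k) H'' f'') \<longrightarrow>
      ({\<phi> x, \<phi> y} \<in> negs B) = (({x, y} \<in> negs (graph_of_labels (2 * k) H'' f'')) \<noteq> (s x \<noteq> s y))" ..
    show "{\<phi> u, \<phi> v} \<in> sdg_edges k B"
      by (rule linked_image(1)[OF B g t(1) linked_extends[OF e' t(2) uv' e(2)] _ _ h s[rule_format]]) (use c lab in auto)
  qed
  then show "\<exists>H' f'. extends H f H' f' \<and> linked (2 * k) H' f' u v \<and> forces (2 * k) B (sdg_edges k B) u v H' f'"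
    using e by blast
qed

text \<open>A vertex that completes the pair \<open>u\<close>, \<open>v\<close> to a triangle of labels with the residues \<open>b\<close> and \<open>c\<close>.\<close>

definition has_third ::
    "nat \<Rightarrow> 'b sgraph \<Rightarrow> 'b set set \<Rightarrow> nat \<Rightarrow> nat \<Rightarrow> nat sgraph \<Rightarrow> (nat \<Rightarrow> nat \<Rightarrow> bool) \<Rightarrow> int \<times> int \<Rightarrow> bool" where
  "has_third N B E u v H f = (\<lambda>(b, c). \<exists>z\<in>verts H.
     int (card (differ N (f u) (f z) False)) = b \<and> int (card (differ N (f v) (f z) False)) = c \<and>
     linked N H f u z \<and> linked N H f v z \<and> forces N B E u z H f \<and> forces N B E v z H f)"

lemma has_third_extends:
  assumes e: "extends H f H' f'" "two_tree H" and uv: "u \<in> verts H" "v \<in> verts H"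
    and h: "has_third N B E u v H f p"
  shows "has_third N B E u v H' f' p"
proof -
  obtain b c where p: "p = (b, c)" by fastforce
  then obtain z where z: "z \<in> verts H"
     "int (card (differ N (f u) (f z) False)) = b" "int (card (differ N (f v) (f z) False)) = c"
     "linked N H f u z" "linked N H f v z" "forces N B E u z H f" "forces N B E v z H f"
    using h by (auto simp: has_third_def)
  have "z \<in> verts H'" "f' z = f z" "f' u = f u" "f' v = f v" using e z(1) uv by (auto simp: extends_def)
  then show ?thesis
    unfolding p has_third_def prod.case
    using z(2,3) linked_extends[OF e uv(1) z(1,4)] linked_extends[OF e uv(2) z(1,5)]
      forces_extends[OF z(6) e(1)] forces_extends[OF z(7) e(1)]
    by (intro bexI[of _ z]) simp_all
qed

text \<open>The new vertex is attached to \<open>u\<close> and \<open>v\<close>, with the label of \<open>tri_third_label\<close>; then the gadgets for the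
  two new pairs are added.\<close>

lemma has_third_exists:
  assumes F: "forceable N B E" and H: "two_tree H" "{u, v} \<in> edges H"
    and t: "tri (int N) (int (card (differ N (f u) (f v) False))) b c"
  shows "\<exists>H' f'. extends H f H' f' \<and> has_third N B E u v H' f' (b, c)"
proof -
  note sH = signed_graph_two_tree[OF H(1)]
  obtain Z where Z: "int (card (differ N (f u) Z False)) = b" "int (card (differ N (f v) Z False)) = c"
    using tri_third_label[OF t refl] .
  obtain z where z: "z \<notin> verts H" using sH ex_new_if_finite[of "verts H"] by (auto simp: signed_graph_def)
  have uvH: "u \<in> verts H" "v \<in> verts H" using signed_graph_edgeD[OF sH H(2)] by auto
  have uv: "u \<noteq> z" "v \<noteq> z" using uvH z by auto
  define H1 where "H1 = attach H u v z"
  define f1 where "f1 = f(z := Z)"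
  have e1: "extends H f H1 f1" unfolding H1_def f1_def by (rule extends_attach[OF H z])
  have t1: "two_tree H1" using e1 by (simp add: extends_def)
  have ed: "{u, z} \<in> edges H1" "{v, z} \<in> edges H1" by (simp_all add: H1_def)
  have lab: "f1 u = f u" "f1 v = f v" "f1 z = Z" using uv by (auto simp: f1_def)
  have bc: "0 < b" "b < int N" "0 < c" "c < int N" using t by (auto simp: tri_def)
  have "0 < card (differ N (f1 u) (f1 z) False)" "card (differ N (f1 u) (f1 z) False) < N"
    using bc Z lab by auto
  then obtain H2 f2 where 2: "extends H1 f1 H2 f2" "linked N H2 f2 u z" "forces N B E u z H2 f2"
    using F t1 ed(1) unfolding forceable_def by blast
  have v1: "u \<in> verts H1" "v \<in> verts H1" "z \<in> verts H1" using uvH by (auto simp: H1_def)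
  have t2: "two_tree H2" "{v, z} \<in> edges H2" and v2: "u \<in> verts H2" "v \<in> verts H2" "z \<in> verts H2"
    and lab2: "f2 u = f u" "f2 v = f v" "f2 z = Z"
    using 2(1) ed v1 lab by (auto simp: extends_def)
  have "0 < card (differ N (f2 v) (f2 z) False)" "card (differ N (f2 v) (f2 z) False) < N"
    using bc Z lab2 by auto
  then obtain H3 f3 where 3: "extends H2 f2 H3 f3" "linked N H3 f3 v z" "forces N B E v z H3 f3"
    using F t2 unfolding forceable_def by blast
  have v3: "z \<in> verts H3" and lab3: "f3 u = f u" "f3 v = f v" "f3 z = Z"
    using 3(1) v2 lab2 by (auto simp: extends_def)
  have "linked N H3 f3 u z" by (rule linked_extends[OF 3(1) t2(1) v2(1,3) 2(2)])
  moreover have "forces N B E u z H3 f3" by (rule forces_extends[OF 2(3) 3(1)])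
  ultimately have "has_third N B E u v H3 f3 (b, c)"
    unfolding has_third_def prod.case using 3(2,3) v3 Z lab3 by (intro bexI[of _ z]) simp_all
  moreover have "extends H f H3 f3" by (rule extends_trans[OF e1 extends_trans[OF 2(1) 3(1)]])
  ultimately show ?thesis by blast
qed

lemma has_thirds_exist:
  assumes "finite P" and F: "forceable N B E" and H: "two_tree H" "{u, v} \<in> edges H"
    and t: "\<And>b c. (b, c) \<in> P \<Longrightarrow> tri (int N) (int (card (differ N (f u) (f v) False))) b c"
  shows "\<exists>H' f'. extends H f H' f' \<and> (\<forall>p\<in>P. has_third N B E u v H' f' p)"
  using assms(1) t
proof (induction P)
  case empty
  then show ?case using extends_refl[OF H(1)] by blast
next
  case (insert p P)
  obtain b c where p: "p = (b, c)" by fastforce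
  have uv: "u \<in> verts H" "v \<in> verts H" using signed_graph_edgeD[OF signed_graph_two_tree[OF H(1)] H(2)] by auto
  obtain H1 f1 where 1: "extends H f H1 f1" "\<forall>p\<in>P. has_third N B E u v H1 f1 p"
    using insert.IH insert.prems by blast
  have H1: "two_tree H1" "{u, v} \<in> edges H1" "u \<in> verts H1" "v \<in> verts H1" "f1 u = f u" "f1 v = f v"
    using 1(1) H uv by (auto simp: extends_def)
  have "tri (int N) (int (card (differ N (f1 u) (f1 v) False))) b c"
    using insert.prems[of b c] p H1(5,6) by simp
  from has_third_exists[OF F H1(1,2) this] obtain H2 f2 where
    2: "extends H1 f1 H2 f2" "has_third N B E u v H2 f2 p" using p by blast
  then show ?case using extends_trans[OF 1(1) 2(1)] 1(2) has_third_extends[OF 2(1) H1(1,3,4)] by blast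
qed

lemma k_good_swap: "2 \<le> k \<Longrightarrow> k_good k p q r \<Longrightarrow> k_good k p r q"
  unfolding k_good_iff using tri_residues(2) by blast

lemma witnessed_swap: "witnessed k E w x y q r \<Longrightarrow> witnessed k E w y x r q"
  unfolding witnessed_def by blast

text \<open>The homomorphism may switch the gadget at one end of the pair, and then \<open>(q, r)\<close> has to be provided
  by a third vertex for a different triple.  This is why third vertices for all triples are attached.\<close>

lemma witnessed_of_third:
  assumes B: "signed_graph B" and g: "enat (2 * k) \<le> unbalanced_girth B" and k: "2 \<le> k"
    and H: "two_tree H" and a: "a = int (card (differ (2 * k) (f u) (f v) False))" "0 < a" "a < 2 * int k"
    and l: "linked (2 * k) H f u v"
    and P: "\<And>b c. tri (2 * int k) a b c \<Longrightarrow> has_third (2 * k) B E u v H f (b, c)"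
    and h: "sg_hom (graph_of_labels (2 * k) H f) B \<phi>"
    and q: "k_good k (ad B (\<phi> u) (\<phi> v)) q r"
  shows "witnessed k E (ad B) (\<phi> u) (\<phi> v) q r"
proof -
  let ?N = "2 * int k"
  from sg_hom_switching_exists[OF signed_graph_graph_of_labels[OF signed_graph_two_tree[OF H]] h]
  obtain s :: "nat \<Rightarrow> bool" where s: "\<forall>x y. {x, y} \<in> edges (graph_of_labels (2 * k) H f) \<longrightarrow>
    ({\<phi> x, \<phi> y} \<in> negs B) = (({x, y} \<in> negs (graph_of_labels (2 * k) H f)) \<noteq> (s x \<noteq> s y))" ..
  have im: "[ad B (\<phi> x) (\<phi> y) = (if s x \<noteq> s y then - d else d)] (mod ?N)"
    if "linked (2 * k) H f x y" "int (card (differ (2 * k) (f x) (f y) False)) = d" "0 < d" "d < ?N" for x y d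
    using linked_image(2)[OF B g H that(1) _ _ h s[rule_format]] that(2-4) by auto
  define q' where "q' = q mod ?N"
  define r' where "r' = r mod ?N"
  have qr: "is_weight k (ad B (\<phi> u) (\<phi> v))" "tri ?N (ad B (\<phi> u) (\<phi> v) mod ?N) q' r'"
    using q unfolding k_good_iff[OF k] q'_def r'_def by auto
  have qq: "[q' = q] (mod ?N)" "[r' = r] (mod ?N)" by (simp_all add: q'_def r'_def)
  have adm: "[ad B (\<phi> u) (\<phi> v) = (if s u \<noteq> s v then ?N - a else a)] (mod ?N)"
  proof (cases "s u = s v")
    case True
    then show ?thesis using im[OF l a(1)[symmetric] a(2,3)] by simp
  next
    case False
    have "[ad B (\<phi> u) (\<phi> v) = - a] (mod ?N)" using im[OF l a(1)[symmetric] a(2,3)] False by simp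
    from cong_trans[OF this cong_minus_residue] show ?thesis using False by simp
  qed
  have "ad B (\<phi> u) (\<phi> v) mod ?N = (if s u \<noteq> s v then ?N - a else a)"
    using adm a(2,3) unfolding cong_def by (subst (asm) (2) mod_pos_pos_trivial) auto
  then have t: "tri ?N (if s u \<noteq> s v then ?N - a else a) q' r'" using qr(2) by simp
  \<comment> \<open>The triple after undoing the switching at \<open>v\<close>.\<close>
  define c where "c = (if s u \<noteq> s v then ?N - r' else r')"
  have tc: "tri ?N a q' c"
    using t tri_residues(3)[of ?N "?N - a" q' r'] by (cases "s u = s v") (simp_all add: c_def)
  obtain z where z: "int (card (differ (2 * k) (f u) (f z) False)) = q'" "int (card (differ (2 * k) (f v) (f z) False)) = c"
     "linked (2 * k) H f u z" "linked (2 * k) H f v z" "forces (2 * k) B E u z H f" "forces (2 * k) B E v z H f"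
    using P[OF tc] by (auto simp: has_third_def)
  have E: "{\<phi> u, \<phi> z} \<in> E" "{\<phi> v, \<phi> z} \<in> E"
    using z(5,6) extends_refl[OF H] h unfolding forces_def by blast+
  have bc: "0 < q'" "q' < ?N" "0 < c" "c < ?N" using tc by (auto simp: tri_def)
  have 1: "[ad B (\<phi> u) (\<phi> z) = (if s u \<noteq> s z then - q' else q')] (mod ?N)" by (rule im[OF z(3,1) bc(1,2)])
  have 2: "[ad B (\<phi> v) (\<phi> z) = (if s v \<noteq> s z then - c else c)] (mod ?N)" by (rule im[OF z(4,2) bc(3,4)])
  have "[c = (if s u \<noteq> s v then - r' else r')] (mod ?N)"
    using cong_sym[OF cong_minus_residue[of r' ?N]] by (simp add: c_def)
  moreover from this have "[- c = - (if s u \<noteq> s v then - r' else r')] (mod ?N)"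
    by (simp only: cong_minus_minus_iff)
  ultimately have "[(if s v \<noteq> s z then - c else c) = (if s u \<noteq> s z then - r' else r')] (mod ?N)"
    by (cases "s u"; cases "s v"; cases "s z") simp_all
  note 3 = cong_trans[OF 2 this]
  have nq: "[- q' = - q] (mod ?N)" "[- r' = - r] (mod ?N)" using qq by (simp_all add: cong_minus_minus_iff)
  have "[ad B (\<phi> u) (\<phi> z) = q] (mod ?N) \<and> [ad B (\<phi> v) (\<phi> z) = r] (mod ?N) \<or>
    [ad B (\<phi> u) (\<phi> z) = - q] (mod ?N) \<and> [ad B (\<phi> v) (\<phi> z) = - r] (mod ?N)"
  proof (cases "s u = s z")
    case True
    then show ?thesis using cong_trans[OF 1] cong_trans[OF 3] qq by simp
  next
    case False
    then show ?thesis using cong_trans[OF 1] cong_trans[OF 3] nq by simp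
  qed
  then show ?thesis unfolding witnessed_def using E by blast
qed

text \<open>A pair is given the gadget that forces it into \<open>E\<close> and third vertices for all k-good triples, whose
  pairs are forced into \<open>E\<close> too.  The image of the pair then has all witnesses and is not the failing
  edge.\<close>

lemma forceable_remove:
  assumes B: "signed_graph B" and g: "enat (2 * k) \<le> unbalanced_girth B" and k: "2 \<le> k"
    and F: "forceable (2 * k) B E" and e: "fails_all_k_good k E (ad B) e"
  shows "forceable (2 * k) B (E - {e})"
  unfolding forceable_def
proof (intro allI impI)
  let ?N = "2 * k"
  fix H f u v
  assume H: "two_tree H" "{u, v} \<in> edges H" and
    c: "0 < card (differ ?N (f u) (f v) False)" "card (differ ?N (f u) (f v) False) < ?N"
  define a where "a = int (card (differ ?N (f u) (f v) False))"
  have a: "0 < a" "a < 2 * int k" using c by (auto simp: a_def)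
  have uv: "u \<in> verts H" "v \<in> verts H" using signed_graph_edgeD[OF signed_graph_two_tree[OF H(1)] H(2)] by auto
  obtain H1 f1 where 1: "extends H f H1 f1" "linked ?N H1 f1 u v" "forces ?N B E u v H1 f1"
    using F H c unfolding forceable_def by blast
  have H1: "two_tree H1" "{u, v} \<in> edges H1" "u \<in> verts H1" "v \<in> verts H1" "f1 u = f u" "f1 v = f v"
    using 1(1) H uv by (auto simp: extends_def)
  define P where "P = {(b, c). tri (2 * int k) a b c}"
  have "P \<subseteq> {0<..<2 * int k} \<times> {0<..<2 * int k}" by (auto simp: P_def tri_def)
  then have fP: "finite P" by (rule finite_subset) simp
  have "tri (int ?N) (int (card (differ ?N (f1 u) (f1 v) False))) b c" if "(b, c) \<in> P" for b c
    using that H1(5,6) by (simp add: P_def a_def)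
  from has_thirds_exist[OF fP F H1(1,2) this] obtain H2 f2 where
    2: "extends H1 f1 H2 f2" "\<forall>p\<in>P. has_third ?N B E u v H2 f2 p" by blast
  have H2: "two_tree H2" "u \<in> verts H2" "v \<in> verts H2" "f2 u = f u" "f2 v = f v"
    using 2(1) H1 by (auto simp: extends_def)
  have l2: "linked ?N H2 f2 u v" by (rule linked_extends[OF 2(1) H1(1,3,4) 1(2)])
  have "forces ?N B (E - {e}) u v H2 f2" unfolding forces_def
  proof (intro allI impI)
    fix H3 f3 \<phi> assume e3: "extends H2 f2 H3 f3" and h: "sg_hom (graph_of_labels ?N H3 f3) B \<phi>"
    have H3: "two_tree H3" "f3 u = f u" "f3 v = f v" using e3 H2 by (auto simp: extends_def)
    have l3: "linked ?N H3 f3 u v" by (rule linked_extends[OF e3 H2(1-3) l2])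
    have inE: "{\<phi> u, \<phi> v} \<in> E" using 1(3) extends_trans[OF 2(1) e3] h unfolding forces_def by blast
    have a3: "a = int (card (differ ?N (f3 u) (f3 v) False))" using H3 by (simp add: a_def)
    have P3: "has_third ?N B E u v H3 f3 (b, c)" if "tri (2 * int k) a b c" for b c
      by (rule has_third_extends[OF e3 H2(1-3)]) (use 2(2) that in \<open>simp add: P_def\<close>)
    have W: "witnessed k E (ad B) (\<phi> u) (\<phi> v) q r" if "k_good k (ad B (\<phi> u) (\<phi> v)) q r" for q r
      by (rule witnessed_of_third[OF B g k H3(1) a3 a l3 P3 h that])
    have W': "witnessed k E (ad B) x y q r" if "{x, y} = {\<phi> u, \<phi> v}" "k_good k (ad B x y) q r" for x y q r
    proof -
      consider "x = \<phi> u" "y = \<phi> v" | "x = \<phi> v" "y = \<phi> u" using \<open>{x, y} = {\<phi> u, \<phi> v}\<close> by (auto simp: doubleton_eq_iff)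
      then show ?thesis
      proof cases
        case 1 then show ?thesis using W that by simp
      next
        case 2
        then have "k_good k (ad B (\<phi> u) (\<phi> v)) r q" using k_good_swap[OF k that(2)] ad_sym(2)[OF B, of x y] by simp
        then show ?thesis using witnessed_swap[OF W] 2 by simp
      qed
    qed
    have "{\<phi> u, \<phi> v} \<noteq> e"
    proof
      assume "{\<phi> u, \<phi> v} = e"
      then obtain x y q r where x: "{x, y} = {\<phi> u, \<phi> v}" "k_good k (ad B x y) q r"
        "\<not> (witnessed k E (ad B) x y q r \<and> witnessed k E (ad B) x y r q)"
        using e unfolding fails_all_k_good_def by metis
      then show False using W'[OF x(1,2)] W'[OF x(1) k_good_swap[OF k x(2)]] by blast
    qed
    then show "{\<phi> u, \<phi> v} \<in> E - {e}" using inE by blast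
  qed
  then show "\<exists>H' f'. extends H f H' f' \<and> linked ?N H' f' u v \<and> forces ?N B (E - {e}) u v H' f'"
    using extends_trans[OF 1(1) 2(1)] l2 by blast
qed

text \<open>The gadget for a single edge would be mapped into the empty set.\<close>

lemma not_bounds_of_forceable_empty:
  assumes k: "2 \<le> k" and F: "forceable (2 * k) B {}"
  shows "\<not> bounds k B"
proof
  assume bd: "bounds k B"
  let ?H = "\<lparr>verts = {0, 1}, edges = {{0, 1}}, negs = {}\<rparr> :: nat sgraph"
  define f where "f = (\<lambda>(x::nat) (i::nat). x = 1 \<and> i = 0)"
  have "differ (2 * k) (f 0) (f 1) False = {0}" using k by (auto simp: differ_def f_def)
  then have "card (differ (2 * k) (f 0) (f 1) False) = 1" by simp
  then have "0 < card (differ (2 * k) (f 0) (f 1) False)" "card (differ (2 * k) (f 0) (f 1) False) < 2 * k"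
    using k by simp_all
  moreover have "{0, 1} \<in> edges ?H" by simp
  ultimately obtain H f' where H: "extends ?H f H f'" "forces (2 * k) B {} 0 1 H f'"
    using F[unfolded forceable_def, rule_format, OF two_tree_edge] by blast
  have tH: "two_tree H" using H(1) by (simp add: extends_def)
  note sH = signed_graph_two_tree[OF tH]
  have N: "3 \<le> 2 * k" using k by simp
  let ?G = "graph_of_labels (2 * k) H f'"
  note sG = signed_graph_graph_of_labels[OF sH, of "2 * k" f'] and lab = labelled_graph_of_labels[OF N, of H f']
  have "signed_bipartite ?G" by (rule labelled_bipartite[OF sG lab]) simp
  moreover have "enat (2 * k) \<le> unbalanced_girth ?G" by (rule labelled_girth[OF sG lab])
  moreover have "K4_minor_free ?G"
    by (rule K4_minor_free_subgraph[OF K4_minor_free_two_tree[OF tH]]) (auto simp: graph_of_labels_def)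
  ultimately obtain \<phi> where "sg_hom ?G B \<phi>" using bd unfolding bounds_def by blast
  then show False using H(2) extends_refl[OF tH] unfolding forces_def by blast
qed

section \<open>Correctness of the answer\<close>

lemma witnessed_mono: "witnessed k E w x y q r \<Longrightarrow> E \<subseteq> E' \<Longrightarrow> witnessed k E' w x y q r"
  unfolding witnessed_def by blast

text \<open>A failing edge still fails after further removals.  The order in which edges are removed is
  therefore free, and a list of failing edges never has to be revised.\<close>

lemma fails_antimono: "fails_all_k_good k E' w e \<Longrightarrow> E \<subseteq> E' \<Longrightarrow> fails_all_k_good k E w e"
  unfolding fails_all_k_good_def using witnessed_mono by metis

text \<open>Forceability is an invariant of the run.\<close>

theorem algorithm_run_correct:
  assumes B: "signed_graph B" and g: "enat (2 * k) \<le> unbalanced_girth B" and k: "2 \<le> k"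
    and run: "algorithm_run k B rs out"
  shows "out \<noteq> None \<longleftrightarrow> bounds k B"
proof -
  have "(out = None \<longrightarrow> \<not> bounds k B) \<and> (out \<noteq> None \<longrightarrow> bounds k B)"
    if "run_from k B E rs out" "forceable (2 * k) B E" "E \<subseteq> sdg_edges k B" for E
    using that
  proof (induction)
    case (answer_no E)
    then show ?case using not_bounds_of_forceable_empty[OF k] by simp
  next
    case (restart e E es out)
    then show ?case using forceable_remove[OF B g k] by blast
  next
    case (answer_yes E)
    then have "stable k B E" by (simp add: stable_def)
    then show ?case using stable_bounds[OF _ k B] by blast
  qed
  from this[of "sdg_edges k B"] show ?thesis
    using run forceable_sdg[OF B g k] unfolding algorithm_run_def by blast
qed

section \<open>Results and costs of loops\<close>

lemma ret_simps [simp]: "val (ret x) = x" "time (ret x) = 1"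
  by (simp_all add: ret_def)

lemma bind_simps [simp]:
  "val (bind_tm m f) = val (f (val m))" "time (bind_tm m f) = time m + time (f (val m))"
  by (simp_all add: bind_tm_def split: tm.split)

lemma val_for_each: "val (for_each xs f s) = fold (\<lambda>x s. val (f x s)) xs s"
  by (induction xs arbitrary: s) simp_all

lemma time_for_each:
  assumes "\<And>x s. x \<in> set xs \<Longrightarrow> time (f x s) \<le> t"
  shows "time (for_each xs f s) \<le> length xs * t + 1"
  using assms
proof (induction xs arbitrary: s)
  case (Cons x xs)
  have "time (f x s) \<le> t" using Cons.prems by simp
  moreover have "time (for_each xs f (val (f x s))) \<le> length xs * t + 1" using Cons by simp
  ultimately show ?case by simp
qed simp

lemma val_all_tm: "val (all_tm P xs) \<longleftrightarrow> (\<forall>x\<in>set xs. P x)"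
  by (induction xs) auto

text \<open>The entries before the first failure, that entry itself, and the end of the list.\<close>

lemma time_all_tm: "time (all_tm P xs) \<le> length (takeWhile P xs) + 2"
  by (induction xs) auto

text \<open>Loops over several indices become a single fold over tuples.\<close>

lemma fold_nested: "fold (\<lambda>x. fold (\<lambda>y. g x y) ys) xs s = fold (\<lambda>(x, y). g x y) (List.product xs ys) s"
proof (induction xs arbitrary: s)
  case (Cons x xs)
  have "fold (\<lambda>(x, y). g x y) (map (Pair x) ys) s = fold (\<lambda>y. g x y) ys s"
    by (simp add: fold_map comp_def)
  then show ?case using Cons by simp
qed simp

section \<open>The table of k-good triples\<close>

lemma set_weights: "set (weights k) = {p. is_weight k p}"
  by (auto simp: weights_def is_weight_def)

lemma distinct_weights: "distinct (weights k)"
  by (auto simp: weights_def)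

lemma length_weights: "length (weights k) = 2 * k"
  by (simp add: weights_def)

lemma good_test_k_good:
  assumes "2 \<le> k" "is_weight k p" "is_weight k q" "is_weight k r"
  shows "good_test k p q r \<longleftrightarrow> k_good k p q r"
  unfolding good_test_iff[OF assms] k_good_iff[OF assms(1)] using assms by simp

text \<open>The body of the innermost loop.\<close>

definition triple_step :: "nat \<Rightarrow> int \<times> int \<times> int \<Rightarrow> good_lists \<times> good_table \<Rightarrow> good_lists \<times> good_table" where
  "triple_step k = (\<lambda>(p, q, r) (T, R). if good_test k p q r
            then (T(p := (q, r) # T p), R((p, key k q r) := True))
            else (T, R))"

lemma val_good_triples:
  "val (good_triples k) = fold (triple_step k)
     (List.product (weights k) (List.product (weights k) (weights k))) (\<lambda>_. [], \<lambda>_. False)"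
proof -
  have 1: "val (case s of (T, R) \<Rightarrow> ret (if good_test k p q r
            then (T(p := (q, r) # T p), R((p, key k q r) := True))
            else (T, R))) = triple_step k (p, q, r) s" for p q r s
    by (cases s) (simp add: triple_step_def)
  show ?thesis
    unfolding good_triples_def val_for_each 1 fold_nested
    by (intro arg_cong2[where f = "\<lambda>f. fold f _"] ext) (auto split: prod.split)
qed

lemma triple_step_eq:
  "triple_step k (p, q, r) (T, R) = (if good_test k p q r
     then (T(p := (q, r) # T p), R((p, key k q r) := True)) else (T, R))"
  by (simp add: triple_step_def)

lemma fold_triple_step_lists:
  "fst (fold (triple_step k) L (T, R)) p =
     rev (map snd (filter (\<lambda>(p', q, r). p' = p \<and> good_test k p q r) L)) @ T p"
proof (induction L arbitrary: T R)
  case (Cons t L)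
  obtain p' q r where t: "t = (p', q, r)" by (cases t)
  show ?case unfolding t fold_Cons comp_def triple_step_eq
    by (cases "good_test k p' q r"; cases "p' = p") (simp_all add: Cons.IH)
qed simp

lemma fold_triple_step_table:
  "snd (fold (triple_step k) L (T, R)) (p, \<kappa>) \<longleftrightarrow>
     R (p, \<kappa>) \<or> (\<exists>q r. (p, q, r) \<in> set L \<and> good_test k p q r \<and> key k q r = \<kappa>)"
proof (induction L arbitrary: T R)
  case (Cons t L)
  obtain p' q r where t: "t = (p', q, r)" by (cases t)
  let ?X = "\<lambda>L. \<exists>q r. (p, q, r) \<in> set L \<and> good_test k p q r \<and> key k q r = \<kappa>"
  have X: "?X ((p', q, r) # L) \<longleftrightarrow> p = p' \<and> good_test k p' q r \<and> \<kappa> = key k q r \<or> ?X L"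
    by auto
  have R: "(R((p', key k q r) := True)) (p, \<kappa>) \<longleftrightarrow> R (p, \<kappa>) \<or> (p = p' \<and> \<kappa> = key k q r)" by auto
  show ?case
  proof (cases "good_test k p' q r")
    case True
    show ?thesis unfolding t fold_Cons comp_def triple_step_eq if_P[OF True] Cons.IH R X
      using True by (simp only: simp_thms disj_assoc)
  next
    case False
    show ?thesis unfolding t fold_Cons comp_def triple_step_eq if_not_P[OF False] Cons.IH X
      using False by (simp only: simp_thms)
  qed
qed simp

text \<open>The lists are free of repetitions, which bounds the time for going through them.\<close>

lemma good_lists:
  assumes "2 \<le> k" "is_weight k p"
  shows "set (fst (val (good_triples k)) p) = {(q, r). k_good k p q r}"
    "distinct (fst (val (good_triples k)) p)"
    "snd (val (good_triples k)) (p, \<kappa>) \<longleftrightarrow> (\<exists>q r. k_good k p q r \<and> key k q r = \<kappa>)"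
proof -
  let ?L = "List.product (weights k) (List.product (weights k) (weights k))"
  let ?F = "filter (\<lambda>(p', q, r). p' = p \<and> good_test k p q r) ?L"
  have kg: "k_good k p q r \<Longrightarrow> is_weight k q \<and> is_weight k r" for q r
    by (simp add: k_good_iff[OF assms(1)])
  have L: "(p, q, r) \<in> set ?L \<and> good_test k p q r \<longleftrightarrow> k_good k p q r" for q r
    using kg[of q r] good_test_k_good[OF assms, of q r] assms(2) by (auto simp: set_weights)
  have T: "fst (val (good_triples k)) p = rev (map snd ?F)"
    unfolding val_good_triples using fold_triple_step_lists[of k ?L "\<lambda>_. []" "\<lambda>_. False" p] by simp
  have F: "(p', q, r) \<in> set ?F \<longleftrightarrow> p' = p \<and> k_good k p q r" for p' q r
    using L[of q r] by auto
  have "(q, r) \<in> set (rev (map snd ?F)) \<longleftrightarrow> (\<exists>p'. (p', q, r) \<in> set ?F)" for q r by force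
  then show "set (fst (val (good_triples k)) p) = {(q, r). k_good k p q r}" unfolding T F by auto
  have "distinct ?F" by (intro distinct_filter distinct_product distinct_weights)
  moreover have "inj_on snd (set ?F)" by (rule inj_onI) (use F in auto)
  ultimately show "distinct (fst (val (good_triples k)) p)" unfolding T by (simp add: distinct_map)
  show "snd (val (good_triples k)) (p, \<kappa>) \<longleftrightarrow> (\<exists>q r. k_good k p q r \<and> key k q r = \<kappa>)"
    unfolding val_good_triples using fold_triple_step_table[of k ?L "\<lambda>_. []" "\<lambda>_. False" p \<kappa>] L by blast
qed

lemma time_good_triples: "time (good_triples k) \<le> 2 * k * (2 * k * (2 * k * 1 + 1) + 1) + 1"
  unfolding good_triples_def length_weights[of k, symmetric]
  by (intro time_for_each) (auto split: prod.split)

section \<open>Algebraic distances by relaxation\<close>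

lemma non_isolated:
  shows "set (val (non_isolated n es)) = {x. x < n \<and> (\<exists>(a, b, neg)\<in>set es. x = a \<or> x = b)}"
    "distinct (val (non_isolated n es))"
    "time (non_isolated n es) \<le> length es + n + 2"
proof -
  define t where "t = val (for_each es (\<lambda>(a, b, neg) t. ret (t(a := True, b := True))) (\<lambda>_. False))"
  have "t x \<longleftrightarrow> (\<exists>(a, b, neg)\<in>set es. x = a \<or> x = b)" for x
  proof -
    have "fold (\<lambda>e s. val ((case e of (a, b, neg) \<Rightarrow> \<lambda>t. ret (t(a := True, b := True))) s)) es t0 x \<longleftrightarrow>
        t0 x \<or> (\<exists>(a, b, neg)\<in>set es. x = a \<or> x = b)" for t0
      by (induction es arbitrary: t0) auto
    then show ?thesis unfolding t_def val_for_each by (simp add: case_prod_unfold)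
  qed
  note t = this
  have vs: "val (non_isolated n es) = fold (\<lambda>x vs. if t x then x # vs else vs) [0..<n] []"
    unfolding non_isolated_def t_def by (simp add: val_for_each)
  have "fold (\<lambda>x vs. if t x then x # vs else vs) xs vs0 = rev (filter t xs) @ vs0" for xs vs0
    by (induction xs arbitrary: vs0) auto
  then have v: "val (non_isolated n es) = rev (filter t [0..<n])" unfolding vs by simp
  show "set (val (non_isolated n es)) = {x. x < n \<and> (\<exists>(a, b, neg)\<in>set es. x = a \<or> x = b)}"
    unfolding v using t by auto
  show "distinct (val (non_isolated n es))" unfolding v by simp
  have "time (for_each es (\<lambda>(a, b, neg) t. ret (t(a := True, b := True))) (\<lambda>_. False)) \<le> length es * 1 + 1"
    by (intro time_for_each) (auto split: prod.split)
  moreover have "time (for_each [0..<n] (\<lambda>x vs. ret (if t x then x # vs else vs)) []) \<le> length [0..<n] * 1 + 1"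
    by (intro time_for_each) auto
  ultimately show "time (non_isolated n es) \<le> length es + n + 2"
    unfolding non_isolated_def bind_simps t_def[symmetric] by simp
qed

lemma distinct_walk_edges: "distinct c \<Longrightarrow> distinct (walk_edges c) \<and> (\<forall>e\<in>set (walk_edges c). e \<subseteq> set c)"
proof (induction c rule: induct_list012)
  case (3 x y c)
  then have IH: "distinct (walk_edges (y # c))" "\<forall>e\<in>set (walk_edges (y # c)). e \<subseteq> set (y # c)" by auto
  have "{x, y} \<notin> set (walk_edges (y # c))" using IH(2) 3(3) by auto
  then show ?case using IH by auto
qed simp_all

lemma distinct_walk_length:
  assumes "signed_graph B" "walk B c" "distinct c"
  shows "walk_length c \<le> card (edges B)"
proof -
  have "finite (edges B)"
    by (rule finite_subset[of _ "Pow (verts B)"]) (use assms(1) in \<open>auto simp: signed_graph_def\<close>)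
  moreover have "set (walk_edges c) \<subseteq> edges B" using assms(2) by (simp add: walk_def)
  ultimately have "card (set (walk_edges c)) \<le> card (edges B)" by (rule card_mono)
  then show ?thesis using distinct_card distinct_walk_edges[OF assms(3)] by (metis walk_length_def)
qed

text \<open>A shortest path uses every edge at most once, so \<open>m\<close> rounds of relaxation reach all distances.\<close>

lemma gdist_le_edges:
  assumes B: "signed_graph B" and d: "gdist B x y = enat d"
  shows "d \<le> card (edges B)"
proof -
  let ?A = "(\<lambda>c. enat (walk_length c)) ` {c. path B x y c}"
  have "?A \<noteq> {}" using d unfolding gdist_def by (metis Inf_enat_def enat.distinct(1) infinity_enat_def)
  then have "Inf ?A \<in> ?A" by (meson wellorder_InfI ex_in_conv)
  then obtain c where "path B x y c" "walk_length c = d" using d unfolding gdist_def by auto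
  then show ?thesis using distinct_walk_length[OF B, of c] by (auto simp: path_def)
qed

lemma extend_le: "extend a b neg s L z \<le> L z"
  by (auto simp: extend_def)

lemma relax_le: "relax e L z \<le> L z"
  unfolding relax_def by (cases e) (simp, intro order_trans[OF extend_le] order_refl)

lemma fold_relax_le: "fold relax es L z \<le> L z"
proof (induction es arbitrary: L)
  case (Cons e es)
  have "fold relax (e # es) L z \<le> relax e L z" using Cons by simp
  then show ?case using relax_le by (rule order_trans)
qed simp

lemma extend_new: "extend a b neg s L (b, s \<noteq> neg) \<le> L (a, s) + 1"
  by (simp add: extend_def)

text \<open>The four updates of a relaxation are done in place, and the later ones may read values lowered by
  the earlier ones; as entries only decrease, the bound survives.\<close>

lemma relax_new:
  "relax (a, b, neg) L (b, s \<noteq> neg) \<le> L (a, s) + 1"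
  "relax (a, b, neg) L (a, s \<noteq> neg) \<le> L (b, s) + 1"
proof -
  define L1 where "L1 = extend a b neg False L"
  define L2 where "L2 = extend a b neg True L1"
  define L3 where "L3 = extend b a neg False L2"
  define L4 where "L4 = extend b a neg True L3"
  have r: "relax (a, b, neg) L = L4" by (simp add: relax_def L1_def L2_def L3_def L4_def)
  have 1: "L1 z \<le> L z" for z unfolding L1_def by (rule extend_le)
  have 2: "L2 z \<le> L1 z" for z unfolding L2_def by (rule extend_le)
  have 3: "L3 z \<le> L2 z" for z unfolding L3_def by (rule extend_le)
  have 4: "L4 z \<le> L3 z" for z unfolding L4_def by (rule extend_le)
  have m: "u \<le> v \<Longrightarrow> u + 1 \<le> v + (1::enat)" for u v by (rule add_right_mono)
  show "relax (a, b, neg) L (b, s \<noteq> neg) \<le> L (a, s) + 1"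
  proof (cases s)
    case True
    have "L2 (b, s \<noteq> neg) \<le> L1 (a, s) + 1" unfolding L2_def using extend_new[of a b neg True L1] True by simp
    then show ?thesis unfolding r using 3 4 m[OF 1] by (meson order_trans)
  next
    case False
    have "L1 (b, s \<noteq> neg) \<le> L (a, s) + 1" unfolding L1_def using extend_new[of a b neg False L] False by simp
    then show ?thesis unfolding r using 2 3 4 by (meson order_trans)
  qed
  show "relax (a, b, neg) L (a, s \<noteq> neg) \<le> L (b, s) + 1"
  proof (cases s)
    case True
    have "L4 (a, s \<noteq> neg) \<le> L3 (b, s) + 1" unfolding L4_def using extend_new[of b a neg True L3] True by simp
    moreover have "L3 (b, s) \<le> L (b, s)" using 1 2 3 by (meson order_trans)
    ultimately show ?thesis unfolding r using m by (meson order_trans)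
  next
    case False
    have "L3 (a, s \<noteq> neg) \<le> L2 (b, s) + 1" unfolding L3_def using extend_new[of b a neg False L2] False by simp
    moreover have "L2 (b, s) \<le> L (b, s)" using 1 2 by (meson order_trans)
    ultimately show ?thesis unfolding r using 4 m by (meson order_trans)
  qed
qed

lemma fold_relax_new:
  assumes "(a, b, neg) \<in> set es"
  shows "fold relax es L (b, s \<noteq> neg) \<le> L (a, s) + 1"
    "fold relax es L (a, s \<noteq> neg) \<le> L (b, s) + 1"
proof -
  obtain xs ys where es: "es = xs @ (a, b, neg) # ys" using assms by (meson split_list)
  let ?L = "fold relax xs L"
  have "fold relax es L z \<le> relax (a, b, neg) ?L z" for z
    unfolding es by (simp add: fold_relax_le)
  moreover have "?L z + 1 \<le> L z + 1" for z using fold_relax_le by (rule add_right_mono)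
  ultimately show "fold relax es L (b, s \<noteq> neg) \<le> L (a, s) + 1"
    "fold relax es L (a, s \<noteq> neg) \<le> L (b, s) + 1"
    using relax_new[of a b neg ?L s] by (meson order_trans)+
qed

text \<open>Every finite entry is the length of a walk.\<close>

definition sound :: "'a sgraph \<Rightarrow> 'a \<Rightarrow> ('a \<times> bool \<Rightarrow> enat) \<Rightarrow> bool" where
  "sound B x L \<longleftrightarrow> (\<forall>y s l. L (y, s) = enat l \<longrightarrow> swalk B x y s l)"

lemma sound_extend:
  assumes "sound B x L" "{a, b} \<in> edges B" "neg \<longleftrightarrow> {a, b} \<in> negs B"
  shows "sound B x (extend a b neg s L)"
  unfolding sound_def
proof (intro allI impI)
  fix y t l assume A: "extend a b neg s L (y, t) = enat l"
  show "swalk B x y t l"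
  proof (cases "L (y, t) = enat l")
    case True
    then show ?thesis using assms(1) by (simp add: sound_def)
  next
    case False
    then have yt: "y = b" "t = (s \<noteq> neg)" "L (a, s) + 1 = enat l"
      using A by (auto simp: extend_def min_def split: if_splits)
    then obtain l' where l': "L (a, s) = enat l'" by (cases "L (a, s)") auto
    then have "l = Suc l'" using yt(3) by (simp add: one_enat_def)
    moreover have "swalk B x a s l'" using assms(1) l' by (simp add: sound_def)
    ultimately show ?thesis using swalk_step[OF _ assms(2)] assms(3) yt by simp
  qed
qed

lemma sound_relax:
  assumes "sound B x L" "{a, b} \<in> edges B" "neg \<longleftrightarrow> {a, b} \<in> negs B"
  shows "sound B x (relax (a, b, neg) L)"
  using assms unfolding relax_def by (auto simp: insert_commute intro!: sound_extend)

lemma walk_lengths_val: "val (walk_lengths es x) = (fold relax es ^^ length es) ((\<lambda>_. \<infinity>)((x, False) := 0))"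
proof -
  have "fold (\<lambda>_. g) xs s = (g ^^ length xs) s" for g :: "'s \<Rightarrow> 's" and xs :: "'t list" and s
    by (induction xs arbitrary: s) (simp_all add: funpow_swap1)
  then show ?thesis unfolding walk_lengths_def by (simp add: val_for_each)
qed

lemma time_walk_lengths: "time (walk_lengths es x) \<le> length es * (length es * 1 + 1) + 1"
  unfolding walk_lengths_def by (intro time_for_each) auto

locale impl =
  fixes k n :: nat and B :: "nat sgraph" and es :: edge_list
  assumes B: "signed_graph B" and k: "2 \<le> k" and vB: "verts B = {..<n}" and es: "is_edge_list B es"
begin

lemma es_edge: "(a, b, neg) \<in> set es \<Longrightarrow> {a, b} \<in> edges B \<and> (neg \<longleftrightarrow> {a, b} \<in> negs B)"
  using es by (fastforce simp: is_edge_list_def)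

lemma edge_es:
  assumes "{y, z} \<in> edges B"
  obtains a b where "(a, b, {y, z} \<in> negs B) \<in> set es" "{y, z} = {a, b}"
proof -
  obtain a b neg where "(a, b, neg) \<in> set es" "{y, z} = {a, b}"
    using assms es by (auto simp: is_edge_list_def)
  then show ?thesis using es_edge[of a b neg] that by auto
qed

lemma length_es: "length es = card (edges B)"
  using es by (simp add: is_edge_list_def)

lemma sound_rounds:
  assumes "x \<in> verts B"
  shows "sound B x ((fold relax es ^^ i) ((\<lambda>_. \<infinity>)((x, False) := 0)))"
proof (induction i)
  case 0
  then show ?case using assms by (auto simp: sound_def zero_enat_def intro: swalk_nil)
next
  case (Suc i)
  have "sound B x (fold relax xs L)" if "sound B x L" "set xs \<subseteq> set es" for xs L
    using that
  proof (induction xs arbitrary: L)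
    case (Cons e xs)
    obtain a b neg where e: "e = (a, b, neg)" by (cases e)
    then have "sound B x (relax e L)" using sound_relax[OF Cons.prems(1)] es_edge[of a b neg] Cons.prems(2) by simp
    then show ?case using Cons by simp
  qed simp
  then show ?case using Suc by simp
qed

text \<open>After \<open>i\<close> rounds the walks of at most \<open>i\<close> edges have been taken into account.\<close>

lemma complete_rounds:
  assumes "swalk B x y s l" "l \<le> i"
  shows "(fold relax es ^^ i) ((\<lambda>_. \<infinity>)((x, False) := 0)) (y, s) \<le> enat l"
proof -
  let ?L = "\<lambda>i. (fold relax es ^^ i) ((\<lambda>_. \<infinity>)((x, False) := 0))"
  have mono: "?L j z \<le> ?L i z" if "i \<le> j" for i j z
    using that
  proof (induction rule: dec_induct)
    case (step j)
    have "?L (Suc j) z \<le> ?L j z" by (simp add: fold_relax_le)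
    then show ?case using step.IH by (rule order_trans)
  qed simp
  have "?L l (y, s) \<le> enat l" using assms(1)
  proof (induction)
    case (swalk_nil x)
    then show ?case by (simp add: zero_enat_def)
  next
    case (swalk_step x y s l z)
    obtain a b where ab: "(a, b, {y, z} \<in> negs B) \<in> set es" "{y, z} = {a, b}"
      using edge_es[OF swalk_step(2)] .
    let ?L = "(fold relax es ^^ l) ((\<lambda>_. \<infinity>)((x, False) := 0))" and ?neg = "{y, z} \<in> negs B"
    have "fold relax es ?L (z, s \<noteq> ?neg) \<le> ?L (y, s) + 1"
    proof (cases "a = y \<and> b = z")
      case True
      then show ?thesis using fold_relax_new(1)[OF ab(1), of ?L s] by simp
    next
      case False
      then have "a = z" "b = y" using ab(2) by (auto simp: doubleton_eq_iff)
      then show ?thesis using fold_relax_new(2)[OF ab(1), of ?L s] by simp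
    qed
    then have "(fold relax es ^^ Suc l) ((\<lambda>_. \<infinity>)((x, False) := 0)) (z, s \<noteq> ?neg) \<le> ?L (y, s) + 1"
      by (simp only: funpow.simps comp_def)
    also have "\<dots> \<le> enat l + 1" using swalk_step.IH by (rule add_right_mono)
    also have "enat l + 1 = enat (Suc l)" by (simp add: one_enat_def)
    finally show ?case .
  qed
  then show ?thesis using mono[OF assms(2)] order_trans by blast
qed

text \<open>The shortest walk of one of the two signs may have more than \<open>m\<close> edges, so the table need not be
  exact for both.  It is exact for the signs of walks of length \<open>gdist\<close>, and it is never too small;
  this determines the result of the comparison.\<close>

lemma ad_entry_walk_lengths:
  assumes x: "x \<in> verts B"
  shows "ad_entry (val (walk_lengths es x)) y = (if gdist B x y \<noteq> \<infinity> then Some (ad B x y) else None)"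
proof -
  define L where "L = val (walk_lengths es x)"
  have s: "swalk B x y s l" if "L (y, s) = enat l" for s l
    using sound_rounds[OF x] that unfolding L_def walk_lengths_val sound_def by blast
  show ?thesis
  proof (cases "gdist B x y = \<infinity>")
    case True
    then have no: "\<not> swalk B x y s l" for s l using gdist_finite_iff[OF B] by blast
    have "L (y, s) = \<infinity>" for s using s[of s] no by (cases "L (y, s)") auto
    then show ?thesis unfolding L_def[symmetric] ad_entry_def using True by simp
  next
    case False
    then obtain s0 l0 where w: "swalk B x y s0 l0" using gdist_finite_iff[OF B] by blast
    obtain d where d: "gdist B x y = enat d" "\<exists>s. swalk B x y s d"
      "\<And>s l. swalk B x y s l \<Longrightarrow> d \<le> l" "ad B x y = (if swalk B x y False d then int d else - int d)"
      using ad_props[OF B w] by metis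
    have "d \<le> length es" using gdist_le_edges[OF B d(1)] length_es by simp
    then have c: "L (y, s) \<le> enat d" if "swalk B x y s d" for s
      using complete_rounds[OF that] unfolding L_def walk_lengths_val by blast
    have lb: "enat d \<le> L (y, s)" for s using s[of s] d(3) by (cases "L (y, s)") auto
    have eq: "L (y, s) = enat d" if "swalk B x y s d" for s using c[OF that] lb by (rule antisym)
    show ?thesis
    proof (cases "swalk B x y False d")
      case True
      then have "L (y, False) = enat d" by (rule eq)
      then show ?thesis unfolding L_def[symmetric] ad_entry_def using lb[of True] False True d(4) by simp
    next
      case nF: False
      then have "swalk B x y True d" using d(2) by (metis (full_types))
      then have T: "L (y, True) = enat d" by (rule eq)
      have "L (y, False) \<noteq> enat d" using s nF by blast
      then have "\<not> L (y, False) \<le> L (y, True)" unfolding T using lb[of False] by (metis antisym)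
      then show ?thesis unfolding L_def[symmetric] ad_entry_def using T False nF d(4) by simp
    qed
  qed
qed

definition vs :: "nat list" where "vs = val (non_isolated n es)"

lemma distinct_vs: "distinct vs"
  unfolding vs_def by (rule non_isolated)

lemma set_vs: "x \<in> set vs \<longleftrightarrow> (\<exists>y. {x, y} \<in> edges B)"
proof
  assume "x \<in> set vs"
  then obtain a b neg where "(a, b, neg) \<in> set es" "x = a \<or> x = b" by (auto simp: vs_def non_isolated(1))
  then show "\<exists>y. {x, y} \<in> edges B" using es_edge[of a b neg] by (auto simp: insert_commute)
next
  assume "\<exists>y. {x, y} \<in> edges B"
  then obtain y where y: "{x, y} \<in> edges B" by blast
  then obtain a b where "(a, b, {x, y} \<in> negs B) \<in> set es" "{x, y} = {a, b}" using edge_es by metis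
  moreover have "x < n" using signed_graph_edgeD[OF B y] vB by simp
  ultimately show "x \<in> set vs" unfolding vs_def non_isolated(1) by (auto simp: doubleton_eq_iff)
qed

lemma vs_verts: "x \<in> set vs \<Longrightarrow> x \<in> verts B"
  using set_vs signed_graph_edgeD[OF B] by blast

lemma length_vs: "length vs \<le> n" "length vs \<le> 2 * card (edges B)"
proof -
  have l: "length vs = card (set vs)" using distinct_vs distinct_card by metis
  have "set vs \<subseteq> {..<n}" using vs_verts vB by blast
  then show "length vs \<le> n" unfolding l using card_mono[of "{..<n}" "set vs"] by simp
  have "set vs \<subseteq> fst ` set es \<union> (\<lambda>e. fst (snd e)) ` set es"
    unfolding vs_def non_isolated(1) by force
  then have "card (set vs) \<le> card (fst ` set es \<union> (\<lambda>e. fst (snd e)) ` set es)" by (intro card_mono) auto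
  also have "\<dots> \<le> card (fst ` set es) + card ((\<lambda>e. fst (snd e)) ` set es)" by (rule card_Un_le)
  also have "\<dots> \<le> length es + length es"
    by (intro add_mono order_trans[OF card_image_le card_length]) auto
  finally show "length vs \<le> 2 * card (edges B)" unfolding l length_es by simp
qed

lemma val_ad_table:
  "val (ad_table vs es) (x, y) =
     (if x \<in> set vs \<and> y \<in> set vs \<and> gdist B x y \<noteq> \<infinity> then Some (ad B x y) else None)"
proof -
  have inner: "fold (\<lambda>y A. A((x', y) := g y)) ys A (x, y) = (if x = x' \<and> y \<in> set ys then g y else A (x, y))"
    for x' g ys and A :: weight_table
    by (induction ys arbitrary: A) auto
  have outer: "fold (\<lambda>x A. fold (\<lambda>y A. A((x, y) := g x y)) vs A) xs A (x, y) =
      (if x \<in> set xs \<and> y \<in> set vs then g x y else A (x, y))" for g xs and A :: weight_table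
    by (induction xs arbitrary: A) (auto simp: inner)
  show ?thesis
    unfolding ad_table_def using ad_entry_walk_lengths[OF vs_verts]
    by (simp add: val_for_each outer)
qed

lemma time_ad_table:
  "time (ad_table vs es) \<le> length vs * ((length es * (length es * 1 + 1) + 1) + (length vs * 1 + 1)) + 1"
  unfolding ad_table_def
proof (intro time_for_each)
  fix x :: nat and A :: weight_table
  have "time (for_each vs (\<lambda>y A. ret (A((x, y) := ad_entry L y))) A) \<le> length vs * 1 + 1" for L
    by (intro time_for_each) auto
  then show "time (walk_lengths es x \<bind> (\<lambda>L. for_each vs (\<lambda>y A. ret (A((x, y) := ad_entry L y))) A))
      \<le> (length es * (length es * 1 + 1) + 1) + (length vs * 1 + 1)"
    unfolding bind_simps using time_walk_lengths[of es x] by (intro add_mono)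
qed

section \<open>The partial signed distance graph\<close>

text \<open>The weight table of an edge set; all tables that occur in the main part have this form.\<close>

definition table :: "nat set set \<Rightarrow> weight_table" where
  "table E = (\<lambda>(x, y). if {x, y} \<in> E then Some (ad B x y) else None)"

lemma table_eq: "table E (x, y) = (if {x, y} \<in> E then Some (ad B x y) else None)"
  by (simp add: table_def)

lemma sdg_vs:
  assumes "{x, y} \<in> sdg_edges k B"
  shows "x \<in> set vs" "y \<in> set vs"
proof -
  have end_in: "y \<in> set vs" if "swalk B x y s l" "x \<noteq> y" for x y s l
    using that by (cases rule: swalk.cases) (auto simp: set_vs insert_commute)
  note D = sdg_edgeD[OF B assms]
  obtain s l where w: "swalk B x y s l" using gdist_finiteD[OF D(1)] .
  show "y \<in> set vs" by (rule end_in[OF w D(5)])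
  show "x \<in> set vs" using end_in[OF swalk_sym[OF B w]] D(5) by blast
qed

definition sdg_list :: "(nat \<times> nat) list" where
  "sdg_list = fst (val (partial_graph k vs (val (ad_table vs es))))"

lemma in_sdg:
  assumes "x \<in> set vs" "y \<in> set vs"
  shows "{x, y} \<in> sdg_edges k B \<longleftrightarrow> x \<noteq> y \<and> gdist B x y \<noteq> \<infinity> \<and> \<bar>ad B x y\<bar> \<le> int k"
proof
  assume "{x, y} \<in> sdg_edges k B"
  from sdg_edgeD[OF B this] show "x \<noteq> y \<and> gdist B x y \<noteq> \<infinity> \<and> \<bar>ad B x y\<bar> \<le> int k"
    by (simp add: is_weight_def)
next
  assume "x \<noteq> y \<and> gdist B x y \<noteq> \<infinity> \<and> \<bar>ad B x y\<bar> \<le> int k"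
  then show "{x, y} \<in> sdg_edges k B" using vs_verts assms unfolding sdg_edges_def by blast
qed

lemma val_partial_graph:
  shows "snd (val (partial_graph k vs (val (ad_table vs es)))) = table (sdg_edges k B)"
    "set sdg_list = {(x, y). x < y \<and> {x, y} \<in> sdg_edges k B}" "distinct sdg_list"
    "length sdg_list \<le> length vs * length vs"
proof -
  define A where "A = val (ad_table vs es)"
  define step where "step = (\<lambda>(x, y) (F, W). case A (x, y) of
         None \<Rightarrow> (F, W)
       | Some p \<Rightarrow> if x \<noteq> y \<and> \<bar>p\<bar> \<le> int k
                  then (if x < y then (x, y) # F else F, W((x, y) := Some p))
                  else (F, W))"
  have v: "val (partial_graph k vs A) = fold step (List.product vs vs) ([], \<lambda>_. None)"
  proof -
    have 1: "val (case s of (F, W) \<Rightarrow> ret (case A (x, y) of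
         None \<Rightarrow> (F, W)
       | Some p \<Rightarrow> if x \<noteq> y \<and> \<bar>p\<bar> \<le> int k
                  then (if x < y then (x, y) # F else F, W((x, y) := Some p))
                  else (F, W))) = step (x, y) s" for x y and s :: "(nat \<times> nat) list \<times> weight_table"
      by (cases s) (simp add: step_def)
    show ?thesis unfolding partial_graph_def val_for_each 1 fold_nested
      by (intro arg_cong2[where f = "\<lambda>f. fold f _"] ext) auto
  qed
  let ?ok = "\<lambda>(x, y). x \<noteq> y \<and> (\<exists>p. A (x, y) = Some p \<and> \<bar>p\<bar> \<le> int k)"
  have st: "step e (F, W) = (if ?ok e then (if fst e < snd e then e # F else F, W(e := A e)) else (F, W))" for e F W
    by (cases e) (auto simp: step_def split: option.split)
  have f: "fst (fold step L (F, W)) = rev (filter (\<lambda>e. ?ok e \<and> fst e < snd e) L) @ F \<and>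
     snd (fold step L (F, W)) e = (if e \<in> set L \<and> ?ok e then A e else W e)" for L F W e
  proof (induction L arbitrary: F W)
    case (Cons a L)
    have IH1: "fst (fold step L (F, W)) = rev (filter (\<lambda>e. ?ok e \<and> fst e < snd e) L) @ F" for F W
      using Cons.IH by blast
    have IH2: "snd (fold step L (F, W)) e = (if e \<in> set L \<and> ?ok e then A e else W e)" for F W
      using Cons.IH by blast
    show ?case unfolding fold_Cons comp_def st IH1 IH2
      by (cases "?ok a"; cases "fst a < snd a"; cases "a = e") (simp_all add: IH1 IH2)
  qed simp
  have ok: "(x, y) \<in> set (List.product vs vs) \<and> ?ok (x, y) \<longleftrightarrow> {x, y} \<in> sdg_edges k B" for x y
  proof (cases "x \<in> set vs \<and> y \<in> set vs")
    case True
    then show ?thesis using in_sdg[of x y] val_ad_table[of x y] by (simp add: A_def)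
  next
    case False
    then show ?thesis using sdg_vs[of x y] by (simp, blast)
  qed
  have Aad: "A (x, y) = Some (ad B x y)" if "{x, y} \<in> sdg_edges k B" for x y
    using val_ad_table[of x y] sdg_vs[OF that] sdg_edgeD(1)[OF B that] by (simp add: A_def)
  show "snd (val (partial_graph k vs (val (ad_table vs es)))) = table (sdg_edges k B)"
  proof (rule ext)
    fix e :: "nat \<times> nat"
    obtain x y where e: "e = (x, y)" by fastforce
    show "snd (val (partial_graph k vs (val (ad_table vs es)))) e = table (sdg_edges k B) e"
      unfolding A_def[symmetric] v e table_eq
      using f[of "List.product vs vs" "[]" "\<lambda>_. None" "(x, y)"] ok[of x y] Aad[of x y] by simp
  qed
  have F: "sdg_list = rev (filter (\<lambda>e. ?ok e \<and> fst e < snd e) (List.product vs vs))"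
    unfolding sdg_list_def A_def[symmetric] v using f[of "List.product vs vs" "[]" "\<lambda>_. None"] by simp
  have "(x, y) \<in> set sdg_list \<longleftrightarrow> x < y \<and> {x, y} \<in> sdg_edges k B" for x y
    unfolding F using ok[of x y] by auto
  then show "set sdg_list = {(x, y). x < y \<and> {x, y} \<in> sdg_edges k B}" by auto
  show "distinct sdg_list" unfolding F using distinct_vs by (simp add: distinct_product)
  show "length sdg_list \<le> length vs * length vs"
    unfolding F length_rev using length_filter_le[of _ "List.product vs vs"] by (simp add: length_product)
qed

lemma time_partial_graph: "time (partial_graph k vs A) \<le> length vs * (length vs * 1 + 1) + 1"
  unfolding partial_graph_def by (intro time_for_each) (auto split: prod.split)

end

section \<open>Counting witnesses\<close>

text \<open>By how much \<open>count_up\<close> raises the counter of \<open>\<kappa>\<close>.  The value \<open>2\<close> is possible, since a key may agree with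
  its negative.\<close>

definition hit :: "nat \<Rightarrow> int \<Rightarrow> int \<Rightarrow> key \<Rightarrow> nat" where
  "hit k q r \<kappa> = of_bool (key k q r = \<kappa>) + of_bool (key k (- q) (- r) = \<kappa>)"

lemma count_up_apply: "count_up k e q r c (e', \<kappa>) = c (e', \<kappa>) + (if e' = e then hit k q r \<kappa> else 0)"
  by (auto simp: count_up_def hit_def Let_def)

lemma count_down_apply: "count_down k e q r c (e', \<kappa>) = c (e', \<kappa>) - (if e' = e then hit k q r \<kappa> else 0)"
  by (auto simp: count_down_def hit_def Let_def)

lemma key_eq_iff: "key k q r = key k q' r' \<longleftrightarrow> [q = q'] (mod 2 * int k) \<and> [r = r'] (mod 2 * int k)"
  by (simp add: key_def cong_def)

lemma key_minus_eq_iff: "key k (- q) (- r) = key k (- q') (- r') \<longleftrightarrow> key k q r = key k q' r'"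
  by (simp only: key_eq_iff cong_minus_minus_iff)

lemma key_minus_swap: "key k (- q) (- r) = key k q' r' \<longleftrightarrow> key k q r = key k (- q') (- r')"
  using key_minus_eq_iff[of k q r "- q'" "- r'"] by simp

lemma hit_minus: "hit k q r (key k (- q') (- r')) = hit k q r (key k q' r')"
  unfolding hit_def by (simp only: key_minus_eq_iff key_minus_swap[of k q r q' r'] add.commute)

lemma hit_pos_iff: "0 < hit k q r \<kappa> \<longleftrightarrow> key k q r = \<kappa> \<or> key k (- q) (- r) = \<kappa>"
  by (simp add: hit_def)

text \<open>A pair loses a witness with the given weights.\<close>

type_synonym loss = "(nat \<times> nat) \<times> int \<times> int"

definition lose ::
    "nat \<Rightarrow> good_table \<Rightarrow> weight_table \<Rightarrow> loss \<Rightarrow> counters \<times> (nat \<times> nat) list \<Rightarrow> counters \<times> (nat \<times> nat) list" where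
  "lose k R W = (\<lambda>(e, q, r) (c, Q). let c' = count_down k e q r c
     in (c', if R (the (W e), key k q r) \<and> c' (e, key k q r) = 0 then e # Q else Q))"

definition loss_at :: "nat \<Rightarrow> nat \<Rightarrow> int \<Rightarrow> int \<Rightarrow> loss" where
  "loss_at x z p r = (if x < z then ((x, z), p, r) else ((z, x), r, p))"

lemma lose_witness_eq: "lose_witness k R W x z p r cQ = lose k R W (loss_at x z p r) cQ"
  by (cases cQ) (simp add: lose_witness_def lose_def loss_at_def)

text \<open>For a list of losses that concern different pairs: the counters drop by the hits, and the pairs
  that are appended are those that need a witness for the lost key and have none left.\<close>

lemma fold_lose:
  assumes "distinct (map fst lost)"
  shows "(\<forall>e \<kappa>. fst (fold (lose k R W) lost (c, Q)) (e, \<kappa>) =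
        c (e, \<kappa>) - (case map_of lost e of None \<Rightarrow> 0 | Some (q, r) \<Rightarrow> hit k q r \<kappa>)) \<and>
     set (snd (fold (lose k R W) lost (c, Q))) = set Q \<union> {e. \<exists>q r. (e, q, r) \<in> set lost \<and>
        R (the (W e), key k q r) \<and> fst (fold (lose k R W) lost (c, Q)) (e, key k q r) = 0} \<and>
     length (snd (fold (lose k R W) lost (c, Q))) \<le> length Q + length lost"
  using assms
proof (induction lost arbitrary: c Q)
  case (Cons ev lost)
  obtain e0 q0 r0 where ev: "ev = (e0, q0, r0)" by (cases ev)
  define c1 where "c1 = count_down k e0 q0 r0 c"
  define Q1 where "Q1 = (if R (the (W e0), key k q0 r0) \<and> c1 (e0, key k q0 r0) = 0 then e0 # Q else Q)"
  define c' where "c' = fst (fold (lose k R W) lost (c1, Q1))"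
  have st: "lose k R W ev (c, Q) = (c1, Q1)" by (simp add: lose_def ev c1_def Q1_def Let_def)
  have e0: "e0 \<notin> fst ` set lost" and d: "distinct (map fst lost)" using Cons.prems by (auto simp: ev)
  then have n0: "map_of lost e0 = None" by (simp add: map_of_eq_None_iff)
  note IH = Cons.IH[OF d, of c1 Q1, folded c'_def]
  have IH1: "c' (e, \<kappa>) = c1 (e, \<kappa>) - (case map_of lost e of None \<Rightarrow> 0 | Some (q, r) \<Rightarrow> hit k q r \<kappa>)" for e \<kappa>
    using IH by blast
  have IH2: "set (snd (fold (lose k R W) lost (c1, Q1))) = set Q1 \<union> {e. \<exists>q r. (e, q, r) \<in> set lost \<and>
        R (the (W e), key k q r) \<and> c' (e, key k q r) = 0}"
    using IH by blast
  have c0: "c' (e0, \<kappa>) = c1 (e0, \<kappa>)" for \<kappa> using IH1[of e0 \<kappa>] n0 by simp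
  have c1e: "c1 (e, \<kappa>) = c (e, \<kappa>) - (if e = e0 then hit k q0 r0 \<kappa> else 0)" for e \<kappa>
    unfolding c1_def by (rule count_down_apply)
  have 1: "c' (e, \<kappa>) = c (e, \<kappa>) - (case map_of (ev # lost) e of None \<Rightarrow> 0 | Some (q, r) \<Rightarrow> hit k q r \<kappa>)" for e \<kappa>
  proof (cases "e = e0")
    case True
    then show ?thesis using c0[of \<kappa>] c1e[of e0 \<kappa>] by (simp add: ev)
  next
    case False
    then show ?thesis using IH1[of e \<kappa>] c1e[of e \<kappa>] by (simp add: ev)
  qed
  let ?N = "\<lambda>lost. {e. \<exists>q r. (e, q, r) \<in> set lost \<and> R (the (W e), key k q r) \<and> c' (e, key k q r) = 0}"
  have mem: "(e, q, r) \<in> set (ev # lost) \<longleftrightarrow> e = e0 \<and> q = q0 \<and> r = r0 \<or> (e, q, r) \<in> set lost" for e q r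
    by (auto simp: ev)
  let ?new = "R (the (W e0), key k q0 r0) \<and> c1 (e0, key k q0 r0) = 0"
  have "e \<in> ?N (ev # lost) \<longleftrightarrow> e \<in> ?N lost \<or> e = e0 \<and> ?new" for e
    unfolding mem_Collect_eq mem using c0 by metis
  moreover have "e \<in> set Q1 \<longleftrightarrow> e \<in> set Q \<or> e = e0 \<and> ?new" for e
    by (auto simp: Q1_def)
  ultimately have 2: "set (snd (fold (lose k R W) lost (c1, Q1))) = set Q \<union> ?N (ev # lost)"
    unfolding IH2 by blast
  have "length Q1 \<le> Suc (length Q)" by (simp add: Q1_def)
  moreover have "length (snd (fold (lose k R W) lost (c1, Q1))) \<le> length Q1 + length lost" using IH by blast
  ultimately have 3: "length (snd (fold (lose k R W) lost (c1, Q1))) \<le> length Q + length (ev # lost)" by simp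
  show ?case unfolding fold_Cons comp_def st c'_def[symmetric] using 1 2 3 by blast
qed simp

context impl
begin

text \<open>The contribution of the vertex \<open>z\<close> to the counter.\<close>

definition share :: "nat set set \<Rightarrow> nat \<Rightarrow> nat \<Rightarrow> key \<Rightarrow> nat \<Rightarrow> nat" where
  "share E a b \<kappa> z = (if {a, z} \<in> E \<and> {b, z} \<in> E then hit k (ad B a z) (ad B b z) \<kappa> else 0)"

definition cnt :: "nat set set \<Rightarrow> nat \<Rightarrow> nat \<Rightarrow> key \<Rightarrow> nat" where
  "cnt E a b \<kappa> = (\<Sum>z\<leftarrow>vs. share E a b \<kappa> z)"

lemma cnt_sum: "cnt E a b \<kappa> = (\<Sum>z\<in>set vs. share E a b \<kappa> z)"
  unfolding cnt_def using distinct_vs by (rule sum_list_distinct_conv_sum_set)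

lemma val_count_witnesses:
  assumes "distinct F"
  shows "val (count_witnesses k vs F (table E)) ((a, b), \<kappa>) = (if (a, b) \<in> set F then cnt E a b \<kappa> else 0)"
proof -
  define g where "g = (\<lambda>e z (c :: counters). if {fst e, z} \<in> E \<and> {snd e, z} \<in> E
    then count_up k e (ad B (fst e) z) (ad B (snd e) z) c else c)"
  have g: "g e z c (e', \<kappa>) = c (e', \<kappa>) + (if e' = e then share E (fst e) (snd e) \<kappa> z else 0)" for e z c e'
    by (simp add: g_def share_def count_up_apply)
  have case_eq: "(case (table E (x, z), table E (y, z)) of
         (Some q, Some r) \<Rightarrow> count_up k (x, y) q r c | _ \<Rightarrow> c) = g (x, y) z c" for x y z c
    by (simp add: g_def table_eq)
  have zs: "fold (g e) zs c (e', \<kappa>) = c (e', \<kappa>) + (if e' = e then \<Sum>z\<leftarrow>zs. share E (fst e) (snd e) \<kappa> z else 0)" for e zs c e'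
    by (induction zs arbitrary: c) (simp_all add: g)
  have "fold (\<lambda>e. fold (g e) vs) F c ((a, b), \<kappa>) = c ((a, b), \<kappa>) + (if (a, b) \<in> set F then cnt E a b \<kappa> else 0)" for c
    using assms by (induction F arbitrary: c) (auto simp: zs cnt_def)
  moreover have "val (count_witnesses k vs F (table E)) = fold (\<lambda>e. fold (g e) vs) F (\<lambda>_. 0)"
    unfolding count_witnesses_def case_eq val_for_each
    by (intro arg_cong2[where f = "\<lambda>f. fold f F"] ext refl) (simp add: val_for_each split: prod.split)
  ultimately show ?thesis by simp
qed

lemma cnt_pos_iff: "0 < cnt E a b \<kappa> \<longleftrightarrow> (\<exists>z\<in>set vs. {a, z} \<in> E \<and> {b, z} \<in> E \<and>
    (key k (ad B a z) (ad B b z) = \<kappa> \<or> key k (- ad B a z) (- ad B b z) = \<kappa>))"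
proof -
  have "cnt E a b \<kappa> = 0 \<longleftrightarrow> (\<forall>z\<in>set vs. share E a b \<kappa> z = 0)" unfolding cnt_sum by simp
  then have "0 < cnt E a b \<kappa> \<longleftrightarrow> (\<exists>z\<in>set vs. 0 < share E a b \<kappa> z)" by (simp add: bex_simps flip: neq0_conv)
  moreover have "0 < share E a b \<kappa> z \<longleftrightarrow> {a, z} \<in> E \<and> {b, z} \<in> E \<and>
    (key k (ad B a z) (ad B b z) = \<kappa> \<or> key k (- ad B a z) (- ad B b z) = \<kappa>)" for z
    by (cases "{a, z} \<in> E \<and> {b, z} \<in> E") (auto simp: share_def hit_pos_iff)
  ultimately show ?thesis by (simp only:)
qed

lemma witnessed_iff:
  assumes "E \<subseteq> sdg_edges k B"
  shows "witnessed k E (ad B) a b q r \<longleftrightarrow> 0 < cnt E a b (key k q r)"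
proof -
  have v: "z \<in> set vs" if "{a, z} \<in> E" for z using sdg_vs(2)[of a z] that assms by blast
  have K: "key k (ad B a z) (ad B b z) = key k q r \<longleftrightarrow>
      [ad B a z = q] (mod 2 * int k) \<and> [ad B b z = r] (mod 2 * int k)" for z
    by (rule key_eq_iff)
  have K': "key k (- ad B a z) (- ad B b z) = key k q r \<longleftrightarrow>
      [ad B a z = - q] (mod 2 * int k) \<and> [ad B b z = - r] (mod 2 * int k)" for z
    unfolding key_minus_swap by (rule key_eq_iff)
  show ?thesis unfolding witnessed_def cnt_pos_iff K K' Bex_def using v by metis
qed

text \<open>The keys for which an edge of weight \<open>p\<close> must have a witness.\<close>

definition needs :: "int \<Rightarrow> key \<Rightarrow> bool" where
  "needs p \<kappa> \<longleftrightarrow> (\<exists>q r. k_good k p q r \<and> key k q r = \<kappa>)"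

text \<open>The definition of a failing edge asks for the witnesses of \<open>(q, r)\<close> and \<open>(r, q)\<close> and for both orders of
  the ends; the k-good triples are closed under exchanging \<open>q\<close> and \<open>r\<close>, so one order suffices.\<close>

lemma fails_iff:
  assumes E: "E \<subseteq> sdg_edges k B" and e: "{a, b} \<in> E"
  shows "fails_all_k_good k E (ad B) {a, b} \<longleftrightarrow> (\<exists>\<kappa>. needs (ad B a b) \<kappa> \<and> cnt E a b \<kappa> = 0)"
proof
  assume "fails_all_k_good k E (ad B) {a, b}"
  then obtain x y q r where x: "{a, b} = {x, y}" "k_good k (ad B x y) q r"
    "\<not> (witnessed k E (ad B) x y q r \<and> witnessed k E (ad B) x y r q)"
    unfolding fails_all_k_good_def by blast
  have "\<exists>q r. k_good k (ad B x y) q r \<and> \<not> witnessed k E (ad B) x y q r"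
    using x(2,3) k_good_swap[OF k x(2)] by blast
  then obtain q r where q: "k_good k (ad B x y) q r" "\<not> witnessed k E (ad B) x y q r" by blast
  have "x = a \<and> y = b \<or> x = b \<and> y = a" using x(1) by (auto simp: doubleton_eq_iff)
  then have "\<exists>q r. k_good k (ad B a b) q r \<and> \<not> witnessed k E (ad B) a b q r"
  proof
    assume "x = b \<and> y = a"
    then have "k_good k (ad B a b) r q" using k_good_swap[OF k q(1)] ad_sym(2)[OF B, of a b] by simp
    moreover have "\<not> witnessed k E (ad B) a b r q" using q(2) witnessed_swap[of k E "ad B" a b r q] \<open>x = b \<and> y = a\<close> by blast
    ultimately show ?thesis by blast
  qed (use q in blast)
  then show "\<exists>\<kappa>. needs (ad B a b) \<kappa> \<and> cnt E a b \<kappa> = 0"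
    unfolding needs_def witnessed_iff[OF E] by blast
next
  assume "\<exists>\<kappa>. needs (ad B a b) \<kappa> \<and> cnt E a b \<kappa> = 0"
  then obtain q r where "k_good k (ad B a b) q r" "cnt E a b (key k q r) = 0" unfolding needs_def by blast
  then have "\<not> witnessed k E (ad B) a b q r" using witnessed_iff[OF E] by simp
  then show "fails_all_k_good k E (ad B) {a, b}"
    unfolding fails_all_k_good_def using \<open>k_good k (ad B a b) q r\<close> by blast
qed

text \<open>A lost witness affects the counters of a key and of its negative, but only the first one is compared
  with zero.  This lemma and \<open>cnt_minus\<close> show that the second one need not be tested.\<close>

lemma needs_minus:
  assumes "needs p (key k (- q) (- r))"
  shows "needs p (key k q r)"
proof -
  let ?N = "2 * int k"
  obtain q' r' where g: "k_good k p q' r'" "key k q' r' = key k (- q) (- r)" using assms by (auto simp: needs_def)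
  have w: "is_weight k q'" "is_weight k r'" and t: "tri ?N (p mod ?N) (q' mod ?N) (r' mod ?N)"
    using g(1) unfolding k_good_iff[OF k] by auto
  have m: "(- x) mod ?N = ?N - x mod ?N" if "is_weight k x" "x mod ?N \<in> {0<..<?N}" for x
    using that by (simp add: zmod_zminus1_eq_if)
  have "q' mod ?N \<in> {0<..<?N}" "r' mod ?N \<in> {0<..<?N}" using t by (simp_all add: tri_def)
  then have "k_good k p (- q') (- r')"
    unfolding k_good_iff[OF k] m[OF w(1)] m[OF w(2)]
    using g(1) w tri_residues(5)[OF t] unfolding k_good_iff[OF k] by (simp add: is_weight_def m)
  moreover have "key k (- q') (- r') = key k q r" using g(2) key_minus_swap by metis
  ultimately show ?thesis by (auto simp: needs_def)
qed

lemma cnt_minus: "cnt E a b (key k (- q) (- r)) = cnt E a b (key k q r)"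
  unfolding cnt_def share_def hit_minus ..

section \<open>Removing an edge\<close>

text \<open>Removing \<open>xy\<close> affects exactly the pairs \<open>xz\<close> and \<open>yz\<close> of the triangles \<open>xyz\<close>, which lose the witnesses
  \<open>y\<close> and \<open>x\<close>.\<close>

definition losses :: "nat set set \<Rightarrow> nat \<Rightarrow> nat \<Rightarrow> nat \<Rightarrow> loss list" where
  "losses E x y z = (if {x, z} \<in> E \<and> {y, z} \<in> E
     then [loss_at x z (ad B x y) (ad B y z), loss_at y z (ad B x y) (ad B x z)] else [])"

lemma val_remove_edge:
  "val (remove_edge k R vs (table E) x y (ad B x y) cQ) = fold (lose k R (table E)) (concat (map (losses E x y) vs)) cQ"
proof -
  have "fold (\<lambda>z cQ. case (table E (x, z), table E (y, z)) of
         (Some q, Some r) \<Rightarrow> lose_witness k R (table E) y z (ad B x y) q (lose_witness k R (table E) x z (ad B x y) r cQ)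
       | _ \<Rightarrow> cQ) zs cQ = fold (lose k R (table E)) (concat (map (losses E x y) zs)) cQ" for zs cQ
    by (induction zs arbitrary: cQ) (simp_all add: table_eq losses_def lose_witness_eq)
  then show ?thesis unfolding remove_edge_def val_for_each ret_simps .
qed

lemma time_remove_edge: "time (remove_edge k R vs W x y p cQ) \<le> length vs * 1 + 1"
  unfolding remove_edge_def by (intro time_for_each) auto

context
  fixes E x y E' lost
  assumes E: "E \<subseteq> sdg_edges k B" and xy: "{x, y} \<in> E"
  defines "E' \<equiv> E - {{x, y}}" and "lost \<equiv> concat (map (losses (E - {{x, y}}) x y) vs)"
begin

lemma E_neq: "{a, b} \<in> E \<Longrightarrow> a \<noteq> b"
  using E sdg_edgeD(5)[OF B] by blast

text \<open>Seen from the pair that suffers the loss: it shares one end with \<open>xy\<close>, and the other end of \<open>xy\<close> was its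
  witness.\<close>

lemma in_lost_iff:
  "((a, b), q, r) \<in> set lost \<longleftrightarrow> a < b \<and> {a, b} \<in> E' \<and>
     (\<exists>o'\<in>{x, y}. o' \<notin> {a, b} \<and> {x, y} \<inter> {a, b} \<noteq> {} \<and> {a, o'} \<in> E \<and> {b, o'} \<in> E \<and> q = ad B a o' \<and> r = ad B b o')"
  (is "?L \<longleftrightarrow> ?R")
proof
  have ne: "x \<noteq> y" using E_neq[OF xy] .
  assume ?L
  then obtain z where z: "{x, z} \<in> E'" "{y, z} \<in> E'"
    "((a, b), q, r) = loss_at x z (ad B x y) (ad B y z) \<or> ((a, b), q, r) = loss_at y z (ad B x y) (ad B x z)"
    unfolding lost_def losses_def E'_def by (auto split: if_splits)
  have zE: "{x, z} \<in> E" "{y, z} \<in> E" using z(1,2) by (auto simp: E'_def)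
  then have nz: "x \<noteq> z" "y \<noteq> z" using E_neq by blast+
  have zE': "{z, x} \<in> E'" "{z, y} \<in> E'" "{z, x} \<in> E" "{z, y} \<in> E" "{y, x} \<in> E"
    using z(1,2) zE xy by (simp_all add: insert_commute)
  note A1 = ad_sym(2)[OF B, of y z] and A2 = ad_sym(2)[OF B, of x z] and A3 = ad_sym(2)[OF B, of x y]
  from z(3) show ?R
  proof
    assume A: "((a, b), q, r) = loss_at x z (ad B x y) (ad B y z)"
    show ?R
    proof (cases "x < z")
      case True
      then have "a = x" "b = z" "q = ad B x y" "r = ad B y z" using A by (auto simp: loss_at_def)
      then show ?thesis using True z(1) zE'(4) nz ne xy A1 by (intro conjI bexI[of _ y]) simp_all
    next
      case False
      then have "a = z" "b = x" "q = ad B y z" "r = ad B x y" using A by (auto simp: loss_at_def)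
      then show ?thesis using False zE' nz ne xy A1 by (intro conjI bexI[of _ y]) simp_all
    qed
  next
    assume A: "((a, b), q, r) = loss_at y z (ad B x y) (ad B x z)"
    show ?R
    proof (cases "y < z")
      case True
      then have "a = y" "b = z" "q = ad B x y" "r = ad B x z" using A by (auto simp: loss_at_def)
      then show ?thesis using True z(2) zE' nz ne A2 A3 by (intro conjI bexI[of _ x]) simp_all
    next
      case False
      then have "a = z" "b = y" "q = ad B x z" "r = ad B x y" using A by (auto simp: loss_at_def)
      then show ?thesis using False zE' nz ne A2 A3 by (intro conjI bexI[of _ x]) simp_all
    qed
  qed
next
  have ne: "x \<noteq> y" using E_neq[OF xy] .
  assume ?R
  then obtain o' where R: "a < b" "{a, b} \<in> E'" "o' \<in> {x, y}" "o' \<notin> {a, b}" "{x, y} \<inter> {a, b} \<noteq> {}"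
    "{a, o'} \<in> E" "{b, o'} \<in> E" "q = ad B a o'" "r = ad B b o'" by blast
  have ev: "l \<in> set lost" if "{x, z} \<in> E'" "{y, z} \<in> E'"
    "l = loss_at x z (ad B x y) (ad B y z) \<or> l = loss_at y z (ad B x y) (ad B x z)" for l z
  proof -
    have "z \<in> set vs" using that(1) E sdg_vs(2)[of x z] by (auto simp: E'_def)
    moreover have "l \<in> set (losses E' x y z)" using that by (auto simp: losses_def)
    ultimately show ?thesis unfolding lost_def E'_def by auto
  qed
  have E'I: "{u, w} \<in> E'" if "{u, w} \<in> E" "w \<notin> {x, y}" for u w
    using that by (auto simp: E'_def doubleton_eq_iff)
  have R': "{y, a} \<in> E \<or> o' \<noteq> y" "{y, b} \<in> E \<or> o' \<noteq> y" "{x, a} \<in> E \<or> o' \<noteq> x" "{x, b} \<in> E \<or> o' \<noteq> x" "{b, a} \<in> E'"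
    using R(2,6,7) by (auto simp: insert_commute)
  from R(3,4,5) consider "o' = y" "a = x" "b \<notin> {x, y}" | "o' = y" "b = x" "a \<notin> {x, y}"
    | "o' = x" "a = y" "b \<notin> {x, y}" | "o' = x" "b = y" "a \<notin> {x, y}"
    using R(1) ne by auto
  then show ?L
  proof cases
    case 1
    then have "((a, b), q, r) = loss_at x b (ad B x y) (ad B y b)"
      using R(1,8,9) ad_sym(2)[OF B, of b y] by (simp add: loss_at_def)
    moreover have "{x, b} \<in> E'" "{y, b} \<in> E'" using 1 R(2) R' E'I[of y b] by auto
    ultimately show ?thesis using ev by blast
  next
    case 2
    then have "((a, b), q, r) = loss_at x a (ad B x y) (ad B y a)"
      using R(1,8,9) ad_sym(2)[OF B, of a y] by (simp add: loss_at_def)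
    moreover have "{x, a} \<in> E'" "{y, a} \<in> E'" using 2 R' E'I[of y a] by auto
    ultimately show ?thesis using ev by blast
  next
    case 3
    then have "((a, b), q, r) = loss_at y b (ad B x y) (ad B x b)"
      using R(1,8,9) ad_sym(2)[OF B, of b x] ad_sym(2)[OF B, of y x] by (simp add: loss_at_def)
    moreover have "{x, b} \<in> E'" "{y, b} \<in> E'" using 3 R(2) R' E'I[of x b] by auto
    ultimately show ?thesis using ev by blast
  next
    case 4
    then have "((a, b), q, r) = loss_at y a (ad B x y) (ad B x a)"
      using R(1,8,9) ad_sym(2)[OF B, of a x] ad_sym(2)[OF B, of y x] by (simp add: loss_at_def)
    moreover have "{x, a} \<in> E'" "{y, a} \<in> E'" using 4 R' E'I[of x a] by auto
    ultimately show ?thesis using ev by blast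
  qed
qed

text \<open>A pair loses at most one witness, so counters are not decreased twice for the same pair.\<close>

lemma distinct_lost: "distinct (map fst lost)"
proof -
  have ne: "x \<noteq> y" using E_neq[OF xy] .
  have f: "fst (loss_at u z p r) = (min u z, max u z)" for u z p r by (auto simp: loss_at_def min_def max_def)
  have mm: "(min u z, max u z) = (min u' z', max u' z') \<longleftrightarrow> {u, z} = {u', z'}" for u z u' z' :: nat
    by (auto simp: min_def max_def doubleton_eq_iff)
  define g where "g z = map fst (losses E' x y z)" for z
  have g_eq: "g z = (if {x, z} \<in> E' \<and> {y, z} \<in> E' then [(min x z, max x z), (min y z, max y z)] else [])" for z
    by (simp add: g_def losses_def f)
  have gin: "e \<in> set (g z) \<longleftrightarrow> {x, z} \<in> E' \<and> {y, z} \<in> E' \<and> (e = (min x z, max x z) \<or> e = (min y z, max y z))" for e z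
    by (simp add: g_eq)
  have nz: "z \<noteq> x \<and> z \<noteq> y" if "{x, z} \<in> E'" "{y, z} \<in> E'" for z
    using that E_neq[of x z] E_neq[of y z] by (auto simp: E'_def)
  have dg: "distinct (g z)" for z
  proof -
    have "(min x z, max x z) \<noteq> (min y z, max y z)" using mm[of x z y z] ne by (auto simp: doubleton_eq_iff)
    then show ?thesis by (simp only: g_eq split: if_split) (simp only: distinct.simps list.set, blast)
  qed
  have dis: "set (g z) \<inter> set (g z') = {}" if "z \<noteq> z'" for z z'
  proof (rule ccontr)
    assume "set (g z) \<inter> set (g z') \<noteq> {}"
    then obtain e where e: "e \<in> set (g z)" "e \<in> set (g z')" by blast
    have n: "z \<noteq> x" "z \<noteq> y" "z' \<noteq> x" "z' \<noteq> y" using e nz unfolding gin by blast+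
    obtain u u' where "u \<in> {x, y}" "u' \<in> {x, y}" "(min u z, max u z) = (min u' z', max u' z')"
      using e unfolding gin by blast
    then have "{u, z} = {u', z'}" using mm by blast
    then show False using n that \<open>u \<in> _\<close> \<open>u' \<in> _\<close> by (auto simp: doubleton_eq_iff)
  qed
  have "distinct (concat (map g zs))" if "distinct zs" for zs
    using that
  proof (induction zs)
    case (Cons z zs)
    have "set (g z) \<inter> set (g z') = {}" if "z' \<in> set zs" for z'
      by (rule dis) (use Cons.prems that in auto)
    then have "set (g z) \<inter> set (concat (map g zs)) = {}" by auto
    moreover have "distinct (concat (map g zs))" using Cons by simp
    ultimately show ?case using dg[of z] by simp
  qed simp
  moreover have "map fst lost = concat (map g vs)"
  proof -
    have "g = (\<lambda>z. map fst (losses E' x y z))" by (rule ext) (rule g_def)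
    then show ?thesis by (simp add: lost_def map_concat E'_def comp_def)
  qed
  ultimately show ?thesis using distinct_vs by simp
qed

lemma cnt_remove:
  assumes ab: "a < b" "{a, b} \<in> E'"
  shows "cnt E a b \<kappa> = cnt E' a b \<kappa> + (case map_of lost (a, b) of None \<Rightarrow> 0 | Some (q, r) \<Rightarrow> hit k q r \<kappa>)"
proof -
  have ne: "x \<noteq> y" using E_neq[OF xy] .
  have abE: "{a, b} \<in> E" "{a, b} \<noteq> {x, y}" using ab by (auto simp: E'_def)
  have some: "map_of lost (a, b) = Some (q, r) \<longleftrightarrow> ((a, b), q, r) \<in> set lost" for q r
    by (rule map_of_eq_Some_iff[OF distinct_lost])
  have same: "share E a b \<kappa> z = share E' a b \<kappa> z" if "{a, z} \<noteq> {x, y}" "{b, z} \<noteq> {x, y}" for z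
    using that by (simp add: share_def E'_def)
  show ?thesis
  proof (cases "{x, y} \<inter> {a, b} = {}")
    case True
    then have "{a, z} \<noteq> {x, y}" "{b, z} \<noteq> {x, y}" for z by blast+
    then have "cnt E a b \<kappa> = cnt E' a b \<kappa>"
      unfolding cnt_def by (intro arg_cong[where f = sum_list] map_cong refl same)
    moreover have "map_of lost (a, b) = None"
      using in_lost_iff[of a b] True some by (metis not_None_eq surj_pair)
    ultimately show ?thesis by simp
  next
    case False
    then have "x \<in> {a, b} \<and> y \<notin> {a, b} \<or> y \<in> {a, b} \<and> x \<notin> {a, b}" using abE(2) ne by auto
    then obtain u o' where u: "u \<in> {a, b}" "o' \<notin> {a, b}" "{u, o'} = {x, y}" "o' \<in> {x, y}"
    proof
      assume "x \<in> {a, b} \<and> y \<notin> {a, b}"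
      then show ?thesis using that[of x y] by simp
    next
      assume "y \<in> {a, b} \<and> x \<notin> {a, b}"
      then show ?thesis using that[of y x] by (simp add: insert_commute)
    qed
    have o_vs: "o' \<in> set vs" using sdg_vs[of x y] xy E u(4) by blast
    have noself: "{u, u} \<notin> E" using E_neq[of u u] by blast
    have "share E a b \<kappa> z = share E' a b \<kappa> z" if "z \<noteq> o'" for z
    proof (cases "z = u")
      case True
      then show ?thesis using u(1) noself by (auto simp: share_def E'_def)
    next
      case nu: False
      have "{w, z} \<noteq> {x, y}" for w using that nu u(3) by (metis doubleton_eq_iff)
      then show ?thesis by (intro same)
    qed
    moreover have "share E' a b \<kappa> o' = 0" using u by (auto simp: share_def E'_def)
    ultimately have "cnt E a b \<kappa> = cnt E' a b \<kappa> + share E a b \<kappa> o'"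
      unfolding cnt_sum using o_vs by (simp add: sum.remove[of "set vs" o'])
    moreover have "share E a b \<kappa> o' = (case map_of lost (a, b) of None \<Rightarrow> 0 | Some (q, r) \<Rightarrow> hit k q r \<kappa>)"
    proof (cases "{a, o'} \<in> E \<and> {b, o'} \<in> E")
      case True
      then have "((a, b), ad B a o', ad B b o') \<in> set lost"
        unfolding in_lost_iff using ab u False by blast
      then have "map_of lost (a, b) = Some (ad B a o', ad B b o')" using some by blast
      then show ?thesis using True by (simp add: share_def)
    next
      case nE: False
      have "((a, b), q, r) \<notin> set lost" for q r
      proof
        assume "((a, b), q, r) \<in> set lost"
        then have "\<exists>o2\<in>{x, y}. o2 \<notin> {a, b} \<and> {a, o2} \<in> E \<and> {b, o2} \<in> E"
          unfolding in_lost_iff by (elim conjE bexE) (intro bexI conjI; assumption)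
        then obtain o2 where o2: "o2 \<in> {x, y}" "o2 \<notin> {a, b}" "{a, o2} \<in> E" "{b, o2} \<in> E" by blast
        then have "o2 \<in> {u, o'}" using u(3) by simp
        then have "o2 = o'" using u(1) o2(2) by blast
        then show False using nE o2 by blast
      qed
      then have "map_of lost (a, b) = None" using some by (metis not_None_eq surj_pair)
      then show ?thesis using nE by (auto simp: share_def)
    qed
    ultimately show ?thesis by simp
  qed
qed

lemma length_lost: "length lost \<le> 2 * length vs"
proof -
  have "length (concat (map (losses E' x y) zs)) \<le> 2 * length zs" for zs
    by (induction zs) (auto simp: losses_def)
  then show ?thesis by (simp add: lost_def E'_def)
qed

end

text \<open>The list may contain edges that have been removed already, also repeatedly; those that are left do
  fail.\<close>

definition loop_inv :: "nat set set \<Rightarrow> counters \<Rightarrow> (nat \<times> nat) list \<Rightarrow> bool" where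
  "loop_inv E c Q \<longleftrightarrow> E \<subseteq> sdg_edges k B \<and>
     (\<forall>a b \<kappa>. a < b \<longrightarrow> {a, b} \<in> E \<longrightarrow> c ((a, b), \<kappa>) = cnt E a b \<kappa>) \<and>
     (\<forall>a b. (a, b) \<in> set Q \<longrightarrow> a < b \<and> ({a, b} \<in> E \<longrightarrow> fails_all_k_good k E (ad B) {a, b})) \<and>
     (\<forall>a b. a < b \<longrightarrow> {a, b} \<in> E \<longrightarrow> fails_all_k_good k E (ad B) {a, b} \<longrightarrow> (a, b) \<in> set Q)"

lemma loop_invD:
  assumes "loop_inv E c Q"
  shows "E \<subseteq> sdg_edges k B"
    "a < b \<Longrightarrow> {a, b} \<in> E \<Longrightarrow> c ((a, b), \<kappa>) = cnt E a b \<kappa>"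
    "(a, b) \<in> set Q \<Longrightarrow> a < b"
    "(a, b) \<in> set Q \<Longrightarrow> {a, b} \<in> E \<Longrightarrow> fails_all_k_good k E (ad B) {a, b}"
    "a < b \<Longrightarrow> {a, b} \<in> E \<Longrightarrow> fails_all_k_good k E (ad B) {a, b} \<Longrightarrow> (a, b) \<in> set Q"
  using assms unfolding loop_inv_def by blast+

text \<open>An edge that did not fail before the removal and fails afterwards has lost its last witness for some
  key, so it is among the losses and is appended to the list.\<close>

lemma loop_inv_remove_edge:
  assumes i: "loop_inv E c ((x, y) # Q)" and xy: "{x, y} \<in> E"
    and R: "\<And>p \<kappa>. is_weight k p \<Longrightarrow> R (p, \<kappa>) \<longleftrightarrow> needs p \<kappa>"
    and v: "val (remove_edge k R vs (table (E - {{x, y}})) x y (ad B x y) (c, Q)) = (c', Q')"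
  shows "loop_inv (E - {{x, y}}) c' Q'" "length Q' \<le> length Q + 2 * length vs"
proof -
  let ?E' = "E - {{x, y}}"
  note E = loop_invD(1)[OF i]
  define lost where "lost = concat (map (losses ?E' x y) vs)"
  note L = in_lost_iff[OF E xy, folded lost_def] and D = distinct_lost[OF E xy, folded lost_def]
    and C = cnt_remove[OF E xy, folded lost_def] and len = length_lost[OF E xy, folded lost_def]
  have f: "fold (lose k R (table ?E')) lost (c, Q) = (c', Q')"
    using v unfolding val_remove_edge lost_def .
  note F = fold_lose[OF D, of k R "table ?E'" c Q, unfolded f fst_conv snd_conv]
  have c': "c' ((a, b), \<kappa>) = cnt ?E' a b \<kappa>" if "a < b" "{a, b} \<in> ?E'" for a b \<kappa>
  proof -
    have "c ((a, b), \<kappa>) = cnt E a b \<kappa>" using loop_invD(2)[OF i that(1)] that(2) by simp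
    moreover have "c' ((a, b), \<kappa>) = c ((a, b), \<kappa>) -
        (case map_of lost (a, b) of None \<Rightarrow> 0 | Some (q, r) \<Rightarrow> hit k q r \<kappa>)" using F by blast
    ultimately show ?thesis using C[OF that, of \<kappa>] by simp
  qed
  have E': "?E' \<subseteq> sdg_edges k B" using E by blast
  have w: "is_weight k (ad B a b)" if "{a, b} \<in> ?E'" for a b using sdg_edgeD(2)[OF B] that E by blast
  have Q': "(a, b) \<in> set Q' \<longleftrightarrow> (a, b) \<in> set Q \<or> (\<exists>q r. ((a, b), q, r) \<in> set lost \<and>
      needs (ad B a b) (key k q r) \<and> cnt ?E' a b (key k q r) = 0)" for a b
  proof -
    have "(R (the (table ?E' (a, b)), key k q r) \<and> c' ((a, b), key k q r) = 0) \<longleftrightarrow>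
        (needs (ad B a b) (key k q r) \<and> cnt ?E' a b (key k q r) = 0)" if "((a, b), q, r) \<in> set lost" for q r
    proof -
      have "a < b" "{a, b} \<in> ?E'" using that unfolding L by auto
      then show ?thesis using R[OF w] c' by (simp add: table_eq)
    qed
    moreover have "(a, b) \<in> set Q' \<longleftrightarrow> (a, b) \<in> set Q \<or> (\<exists>q r. ((a, b), q, r) \<in> set lost \<and>
        R (the (table ?E' (a, b)), key k q r) \<and> c' ((a, b), key k q r) = 0)" using F by blast
    ultimately show ?thesis by blast
  qed
  show "length Q' \<le> length Q + 2 * length vs" using F len by linarith
  show "loop_inv ?E' c' Q'"
    unfolding loop_inv_def
  proof (intro conjI allI impI)
    show "?E' \<subseteq> sdg_edges k B" by (rule E')
    fix a b
    show "c' ((a, b), \<kappa>) = cnt ?E' a b \<kappa>" if "a < b" "{a, b} \<in> ?E'" for \<kappa> by (rule c'[OF that])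
    show "a < b" if "(a, b) \<in> set Q'" using that loop_invD(3)[OF i, of a b] unfolding Q' L by auto
    show "fails_all_k_good k ?E' (ad B) {a, b}" if q: "(a, b) \<in> set Q'" and e: "{a, b} \<in> ?E'"
    proof (cases "(a, b) \<in> set Q")
      case True
      then have "fails_all_k_good k E (ad B) {a, b}" using loop_invD(4)[OF i, of a b] e by simp
      then show ?thesis by (rule fails_antimono) blast
    next
      case False
      then show ?thesis using q unfolding Q' fails_iff[OF E' e] by blast
    qed
    show "(a, b) \<in> set Q'" if ab: "a < b" "{a, b} \<in> ?E'" and fl: "fails_all_k_good k ?E' (ad B) {a, b}"
    proof (cases "fails_all_k_good k E (ad B) {a, b}")
      case True
      have "{a, b} \<in> E" "(a, b) \<noteq> (x, y)" using ab(2) by auto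
      then show ?thesis using loop_invD(5)[OF i ab(1) _ True] unfolding Q' by auto
    next
      case False
      have abE: "{a, b} \<in> E" using ab by blast
      obtain \<kappa> where \<kappa>: "needs (ad B a b) \<kappa>" "cnt ?E' a b \<kappa> = 0" using fl unfolding fails_iff[OF E' ab(2)] by blast
      have "cnt E a b \<kappa> \<noteq> 0"
      proof
        assume "cnt E a b \<kappa> = 0"
        then have "fails_all_k_good k E (ad B) {a, b}"
          unfolding fails_iff[OF E abE] by (intro exI[of _ \<kappa>] conjI \<kappa>(1))
        then show False using False by simp
      qed
      then obtain q r where qr: "map_of lost (a, b) = Some (q, r)" "0 < hit k q r \<kappa>"
        using C[OF ab, of \<kappa>] \<kappa>(2) by (auto split: option.splits)
      have ev: "((a, b), q, r) \<in> set lost" using qr(1) by (rule map_of_SomeD)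
      have "needs (ad B a b) (key k q r) \<and> cnt ?E' a b (key k q r) = 0"
        using qr(2) unfolding hit_pos_iff
      proof
        assume "key k q r = \<kappa>"
        then show ?thesis using \<kappa> by simp
      next
        assume "key k (- q) (- r) = \<kappa>"
        then show ?thesis using \<kappa> needs_minus[of "ad B a b" q r] cnt_minus[of ?E' a b q r] by simp
      qed
      then show ?thesis using ev unfolding Q' by blast
    qed
  qed
qed

section \<open>The main loop\<close>

definition edges_of :: "weight_table \<Rightarrow> nat set set" where
  "edges_of W = {{x, y} | x y. W (x, y) \<noteq> None}"

lemma edges_of_table:
  assumes "E \<subseteq> sdg_edges k B" shows "edges_of (table E) = E"
proof -
  have "\<exists>x y. e = {x, y}" if "e \<in> E" for e using that assms unfolding sdg_edges_def by blast
  then have "{{x, y} | x y. {x, y} \<in> E} = E" by blast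
  moreover have "table E (x, y) \<noteq> None \<longleftrightarrow> {x, y} \<in> E" for x y by (simp add: table_eq)
  then have "edges_of (table E) = {{x, y} | x y. {x, y} \<in> E}" unfolding edges_of_def by (simp only:)
  ultimately show ?thesis by simp
qed

lemma table_remove: "(table E)((x, y) := None, (y, x) := None) = table (E - {{x, y}})"
proof (rule ext)
  fix e :: "nat \<times> nat"
  obtain a b where e: "e = (a, b)" by fastforce
  show "((table E)((x, y) := None, (y, x) := None)) e = table (E - {{x, y}}) e"
    unfolding e by (auto simp: table_eq doubleton_eq_iff)
qed

lemma finite_sdg: "finite (sdg_edges k B)"
proof (rule finite_subset)
  show "sdg_edges k B \<subseteq> Pow (verts B)" by (auto simp: sdg_edges_def)
  show "finite (Pow (verts B))" using B by (simp add: signed_graph_def)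
qed

text \<open>Each removal costs a pass through the vertices and adds at most two entries per vertex to the list,
  each of which is taken from it once.  The initial length of the list is part of the bound.\<close>

lemma main_loop:
  assumes R: "\<And>p \<kappa>. is_weight k p \<Longrightarrow> R (p, \<kappa>) \<longleftrightarrow> needs p \<kappa>"
    and "loop_inv E c Q" "m = card E"
  shows "(\<exists>ls. fst (val (main_loop k R vs m Q (table E) c D)) = rev ls @ D \<and>
      run_from k B E (map (\<lambda>(x, y). {x, y}) ls)
        (map_option edges_of (snd (val (main_loop k R vs m Q (table E) c D))))) \<and>
    time (main_loop k R vs m Q (table E) c D) \<le> length Q + m * (3 * length vs + 5) + 1"
  using assms(2,3)
proof (induction m arbitrary: E c Q D)
  case 0
  have "finite E" using finite_subset[OF loop_invD(1)[OF 0(1)] finite_sdg] .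
  then have "E = {}" using 0 by simp
  then show ?case by (auto intro: answer_no)
next
  case (Suc m)
  have fin: "finite E" using finite_subset[OF loop_invD(1)[OF Suc.prems(1)] finite_sdg] .
  show ?case using Suc.prems(1)
  proof (induction Q)
    case Nil
    note i = Nil
    have "E \<noteq> {}" using Suc.prems(2) by auto
    moreover have "\<not> fails_all_k_good k E (ad B) e" if e: "e \<in> E" for e
    proof -
      obtain x y where "e = {x, y}" "x \<noteq> y" using e loop_invD(1)[OF i] unfolding sdg_edges_def by blast
      then obtain a b where "e = {a, b}" "a < b" by (metis insert_commute linorder_neqE_nat)
      then show ?thesis using loop_invD(5)[OF i, of a b] e by auto
    qed
    ultimately have "run_from k B E [] (Some E)" by (intro answer_yes) auto
    then show ?case using edges_of_table[OF loop_invD(1)[OF i]] by auto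
  next
    case (Cons e Q)
    obtain x y where e: "e = (x, y)" by fastforce
    note i = Cons.prems
    show ?case
    proof (cases "{x, y} \<in> E")
      case False
      then have w: "table E (x, y) = None" by (simp add: table_eq)
      have "loop_inv E c Q" unfolding loop_inv_def
      proof (intro conjI allI impI)
        show "E \<subseteq> sdg_edges k B" by (rule loop_invD(1)[OF i])
        fix a b
        show "c ((a, b), \<kappa>) = cnt E a b \<kappa>" if "a < b" "{a, b} \<in> E" for \<kappa> by (rule loop_invD(2)[OF i that])
        show "a < b" if "(a, b) \<in> set Q" using loop_invD(3)[OF i, of a b] that by simp
        show "fails_all_k_good k E (ad B) {a, b}" if "(a, b) \<in> set Q" "{a, b} \<in> E"
          using loop_invD(4)[OF i, of a b] that by simp
        show "(a, b) \<in> set Q" if "a < b" "{a, b} \<in> E" "fails_all_k_good k E (ad B) {a, b}"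
          using loop_invD(5)[OF i that] False that(2) by (auto simp: e)
      qed
      from Cons.IH[OF this] show ?thesis unfolding e using w by auto
    next
      case True
      let ?E' = "E - {{x, y}}"
      have w: "table E (x, y) = Some (ad B x y)" using True by (simp add: table_eq)
      obtain c' Q' where v: "val (remove_edge k R vs (table ?E') x y (ad B x y) (c, Q)) = (c', Q')" by fastforce
      note step = loop_inv_remove_edge[OF i[unfolded e] True R v]
      let ?M = "main_loop k R vs m Q' (table ?E') c' ((x, y) # D)"
      have val: "val (main_loop k R vs (Suc m) (e # Q) (table E) c D) = val ?M"
        unfolding e by (simp add: w table_remove v del: fun_upd_apply)
      have time: "time (main_loop k R vs (Suc m) (e # Q) (table E) c D) =
          2 + time (remove_edge k R vs (table ?E') x y (ad B x y) (c, Q)) + time ?M"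
        unfolding e by (simp add: w table_remove v del: fun_upd_apply)
      have "m = card ?E'" using Suc.prems(2) True fin by simp
      from Suc.IH[OF step(1) this, of "(x, y) # D"] obtain ls where
        ls: "fst (val ?M) = rev ls @ (x, y) # D"
          "run_from k B ?E' (map (\<lambda>(x, y). {x, y}) ls) (map_option edges_of (snd (val ?M)))"
        and t: "time ?M \<le> length Q' + m * (3 * length vs + 5) + 1" by blast
      have "fails_all_k_good k E (ad B) {x, y}" using loop_invD(4)[OF i, of x y] True by (simp add: e)
      from restart[OF True this ls(2)]
      have "run_from k B E (map (\<lambda>(x, y). {x, y}) ((x, y) # ls)) (map_option edges_of (snd (val ?M)))" by simp
      moreover have "fst (val ?M) = rev ((x, y) # ls) @ D" using ls(1) by simp
      moreover have "time (main_loop k R vs (Suc m) (e # Q) (table E) c D)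
          \<le> length (e # Q) + Suc m * (3 * length vs + 5) + 1"
        using t step(2) time_remove_edge[of R "table ?E'" x y "ad B x y" "(c, Q)"] unfolding time by simp
      ultimately show ?thesis unfolding val by blast
    qed
  qed
qed

end

context impl
begin

section \<open>The first list of failing edges\<close>

lemma val_failing_edges:
  "val (failing_edges k T F W c) = rev (filter (\<lambda>e. \<not> (\<forall>(q, r)\<in>set (T (the (W e))).
     c (e, key k q r) > 0 \<and> c (e, key k r q) > 0)) F)"
proof -
  let ?P = "\<lambda>e. \<forall>(q, r)\<in>set (T (the (W e))). c (e, key k q r) > 0 \<and> c (e, key k r q) > 0"
  have "fold (\<lambda>e Q. if ?P e then Q else e # Q) F Q = rev (filter (\<lambda>e. \<not> ?P e) F) @ Q" for Q
    by (induction F arbitrary: Q) simp_all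
  then show ?thesis unfolding failing_edges_def by (simp add: val_for_each val_all_tm)
qed

lemma card_sdg: "card (sdg_edges k B) = length sdg_list"
proof -
  have "inj_on (\<lambda>(x, y). {x, y}) (set sdg_list)"
    by (rule inj_onI) (auto simp: val_partial_graph(2) doubleton_eq_iff)
  moreover have "(\<lambda>(x, y). {x, y}) ` set sdg_list = sdg_edges k B"
  proof
    show "(\<lambda>(x, y). {x, y}) ` set sdg_list \<subseteq> sdg_edges k B" by (auto simp: val_partial_graph(2))
    show "sdg_edges k B \<subseteq> (\<lambda>(x, y). {x, y}) ` set sdg_list"
    proof
      fix e assume e: "e \<in> sdg_edges k B"
      then obtain x y where xy: "e = {x, y}" "x \<noteq> y" unfolding sdg_edges_def by blast
      then obtain a b where ab: "e = {a, b}" "a < b" by (metis insert_commute linorder_neqE_nat)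
      then have "(a, b) \<in> set sdg_list" using e by (simp add: val_partial_graph(2))
      then show "e \<in> (\<lambda>(x, y). {x, y}) ` set sdg_list" using ab(1) by force
    qed
  qed
  ultimately have "card (sdg_edges k B) = card (set sdg_list)" by (metis card_image)
  then show ?thesis using distinct_card[OF val_partial_graph(3)] by simp
qed

text \<open>The search tests the keys of \<open>(q, r)\<close> and of \<open>(r, q)\<close> for each triple, which is the same condition
  because the triples are closed under exchange.\<close>

lemma loop_inv_init:
  assumes T: "\<And>p. is_weight k p \<Longrightarrow> set (T p) = {(q, r). k_good k p q r}"
    and c: "\<And>a b \<kappa>. (a, b) \<in> set sdg_list \<Longrightarrow> c ((a, b), \<kappa>) = cnt (sdg_edges k B) a b \<kappa>"
  shows "loop_inv (sdg_edges k B) c (val (failing_edges k T sdg_list (table (sdg_edges k B)) c))"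
proof -
  let ?E = "sdg_edges k B"
  have F: "(a, b) \<in> set sdg_list \<longleftrightarrow> a < b \<and> {a, b} \<in> ?E" for a b
    by (simp add: val_partial_graph(2))
  have Q: "(a, b) \<in> set (val (failing_edges k T sdg_list (table ?E) c)) \<longleftrightarrow>
      (a, b) \<in> set sdg_list \<and> fails_all_k_good k ?E (ad B) {a, b}" for a b
  proof (cases "(a, b) \<in> set sdg_list")
    case True
    then have e: "{a, b} \<in> ?E" using F by simp
    have w: "is_weight k (ad B a b)" by (rule sdg_edgeD(2)[OF B e])
    have "(a, b) \<in> set (val (failing_edges k T sdg_list (table ?E) c)) \<longleftrightarrow>
      \<not> (\<forall>(q, r)\<in>set (T (the (table ?E (a, b)))). c ((a, b), key k q r) > 0 \<and> c ((a, b), key k r q) > 0)"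
      using True by (simp add: val_failing_edges)
    also have "\<dots> \<longleftrightarrow> (\<exists>q r. k_good k (ad B a b) q r \<and>
        (cnt ?E a b (key k q r) = 0 \<or> cnt ?E a b (key k r q) = 0))"
      using e T[OF w] c[OF True] by (auto simp: table_eq)
    also have "\<dots> \<longleftrightarrow> (\<exists>q r. k_good k (ad B a b) q r \<and> cnt ?E a b (key k q r) = 0)"
      using k_good_swap[OF k] by blast
    also have "\<dots> \<longleftrightarrow> fails_all_k_good k ?E (ad B) {a, b}"
      unfolding fails_iff[OF subset_refl e] needs_def by blast
    finally show ?thesis using True by blast
  qed (simp add: val_failing_edges)
  show ?thesis unfolding loop_inv_def using Q F c by blast
qed

text \<open>A residue comes from two weights at most.\<close>

lemma card_key_preimage:
  "card {(q, r). is_weight k q \<and> is_weight k r \<and> key k q r = \<kappa>} \<le> 4"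
  "finite {(q, r). is_weight k q \<and> is_weight k r \<and> key k q r = \<kappa>}"
proof -
  let ?N = "2 * int k"
  let ?A = "{(q, r). is_weight k q \<and> is_weight k r \<and> key k q r = \<kappa>}"
  let ?C = "{fst \<kappa>, fst \<kappa> - ?N} \<times> {snd \<kappa>, snd \<kappa> - ?N}"
  have w: "p = p mod ?N \<or> p = p mod ?N - ?N" if "is_weight k p" for p
    using weight_mod[OF that k] by simp
  have sub: "?A \<subseteq> ?C"
  proof
    fix x assume "x \<in> ?A"
    then obtain q r where x: "x = (q, r)" "is_weight k q" "is_weight k r" "key k q r = \<kappa>" by blast
    then have "q mod ?N = fst \<kappa>" "r mod ?N = snd \<kappa>" by (auto simp: key_def)
    then show "x \<in> ?C" using w[OF x(2)] w[OF x(3)] x(1) by auto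
  qed
  have fin: "finite ?C" by simp
  show "finite ?A" by (rule finite_subset[OF sub fin])
  have "card ?A \<le> card ?C" by (rule card_mono[OF fin sub])
  also have "\<dots> \<le> 2 * 2" unfolding card_cartesian_product by (intro mult_mono) (auto simp: card_insert_if)
  finally show "card ?A \<le> 4" by simp
qed

text \<open>Each of the \<open>v\<close> vertices makes at most two counters positive, one for its pair of weights and one for
  the negatives.\<close>

lemma card_witnessed_pairs:
  "card {(q, r). is_weight k q \<and> is_weight k r \<and> 0 < cnt E a b (key k q r)} \<le> 8 * length vs"
  "finite {(q, r). is_weight k q \<and> is_weight k r \<and> 0 < cnt E a b (key k q r)}"
proof -
  let ?A = "{(q, r). is_weight k q \<and> is_weight k r \<and> 0 < cnt E a b (key k q r)}"
  let ?P = "\<lambda>\<kappa>. {(q, r). is_weight k q \<and> is_weight k r \<and> key k q r = \<kappa>}"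
  define K where "K = (\<Union>z\<in>set vs. {key k (ad B a z) (ad B b z), key k (- ad B a z) (- ad B b z)})"
  have fK: "finite K" by (simp add: K_def)
  have "card K \<le> (\<Sum>z\<in>set vs. card {key k (ad B a z) (ad B b z), key k (- ad B a z) (- ad B b z)})"
    unfolding K_def by (rule card_UN_le) simp
  also have "\<dots> \<le> (\<Sum>z\<in>set vs. 2)" by (intro sum_mono) (simp add: card_insert_if)
  finally have cK: "card K \<le> 2 * length vs" using distinct_card[OF distinct_vs] by simp
  have "\<kappa> \<in> K" if "0 < cnt E a b \<kappa>" for \<kappa> using that unfolding cnt_pos_iff K_def by blast
  then have sub: "?A \<subseteq> (\<Union>\<kappa>\<in>K. ?P \<kappa>)" by blast
  have fin: "finite (\<Union>\<kappa>\<in>K. ?P \<kappa>)" using fK card_key_preimage(2) by (rule finite_UN_I)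
  show "finite ?A" by (rule finite_subset[OF sub fin])
  have "card ?A \<le> card (\<Union>\<kappa>\<in>K. ?P \<kappa>)" by (rule card_mono[OF fin sub])
  also have "\<dots> \<le> (\<Sum>\<kappa>\<in>K. card (?P \<kappa>))" by (rule card_UN_le[OF fK])
  also have "\<dots> \<le> (\<Sum>\<kappa>\<in>K. 4)" by (intro sum_mono card_key_preimage(1))
  finally show "card ?A \<le> 8 * length vs" using cK by simp
qed

text \<open>An edge may have quadratically many k-good triples, but the search stops at the first one without
  witnesses, and there are only \<open>O(v)\<close> that have some.\<close>

lemma time_failing_edges:
  assumes T: "\<And>p. is_weight k p \<Longrightarrow> set (T p) = {(q, r). k_good k p q r} \<and> distinct (T p)"
    and c: "\<And>a b \<kappa>. (a, b) \<in> set sdg_list \<Longrightarrow> c ((a, b), \<kappa>) = cnt (sdg_edges k B) a b \<kappa>"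
  shows "time (failing_edges k T sdg_list (table (sdg_edges k B)) c) \<le> length sdg_list * (8 * length vs + 3) + 1"
  unfolding failing_edges_def
proof (intro time_for_each)
  let ?E = "sdg_edges k B"
  fix e and Q :: "(nat \<times> nat) list" assume e: "e \<in> set sdg_list"
  obtain a b where ab: "e = (a, b)" by fastforce
  then have edge: "{a, b} \<in> ?E" using e by (simp add: val_partial_graph(2))
  have w: "is_weight k (ad B a b)" by (rule sdg_edgeD(2)[OF B edge])
  define P where "P = (\<lambda>(q, r). c (e, key k q r) > 0 \<and> c (e, key k r q) > 0)"
  define xs where "xs = T (the (table ?E e))"
  have xs: "set xs = {(q, r). k_good k (ad B a b) q r}" "distinct xs"
    using T[OF w] edge by (simp_all add: xs_def ab table_eq)
  have sub: "set (takeWhile P xs) \<subseteq> {(q, r). is_weight k q \<and> is_weight k r \<and> 0 < cnt ?E a b (key k q r)}"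
  proof
    fix x assume x: "x \<in> set (takeWhile P xs)"
    obtain q r where qr: "x = (q, r)" by fastforce
    have "x \<in> set xs" "P x" using set_takeWhileD[OF x] by auto
    then have "k_good k (ad B a b) q r" "0 < c ((a, b), key k q r)" using xs(1) by (simp_all add: qr P_def ab)
    then show "x \<in> {(q, r). is_weight k q \<and> is_weight k r \<and> 0 < cnt ?E a b (key k q r)}"
      using c e k_good_iff[OF k] by (simp add: qr ab)
  qed
  have "length (takeWhile P xs) = card (set (takeWhile P xs))"
    using distinct_card[OF distinct_takeWhile[OF xs(2)]] by metis
  also have "\<dots> \<le> 8 * length vs"
    using card_mono[OF card_witnessed_pairs(2) sub] card_witnessed_pairs(1)[of ?E a b] by linarith
  finally have "time (all_tm P xs) \<le> 8 * length vs + 2" using time_all_tm[of P xs] by linarith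
  then show "time (all_tm (\<lambda>(q, r). c (e, key k q r) > 0 \<and> c (e, key k r q) > 0) (T (the (table ?E e)))
      \<bind> (\<lambda>ok. ret (if ok then Q else e # Q))) \<le> 8 * length vs + 3"
    unfolding P_def xs_def bind_simps by simp
qed

lemma time_count_witnesses:
  "time (count_witnesses k vs F W) \<le> length F * (length vs * 1 + 1) + 1"
  unfolding count_witnesses_def
proof (intro time_for_each)
  fix e and c :: counters
  show "time ((case e of (x, y) \<Rightarrow> for_each vs (\<lambda>z c. ret (case (W (x, z), W (y, z)) of
         (Some q, Some r) \<Rightarrow> count_up k (x, y) q r c
       | _ \<Rightarrow> c))) c) \<le> length vs * 1 + 1"
    by (cases e) (simp only: prod.case, intro time_for_each, simp)
qed

section \<open>The whole algorithm\<close>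

lemma algorithm_result:
  shows "algorithm_run k B (removed_edges (val (algorithm k n es))) (outcome (val (algorithm k n es)))"
    and "time (algorithm k n es) \<le>
      (2 * k * (2 * k * (2 * k * 1 + 1) + 1) + 1) + (length es + n + 2) +
      (length vs * ((length es * (length es * 1 + 1) + 1) + (length vs * 1 + 1)) + 1) +
      (length vs * (length vs * 1 + 1) + 1) + (length sdg_list * 1 + 1) +
      (length sdg_list * (length vs * 1 + 1) + 1) + (length sdg_list * (8 * length vs + 3) + 1) +
      (length sdg_list + length sdg_list * (3 * length vs + 5) + 1)"
proof -
  let ?E = "sdg_edges k B"
  obtain T R where TR: "val (good_triples k) = (T, R)" by fastforce
  have T: "set (T p) = {(q, r). k_good k p q r} \<and> distinct (T p)" if "is_weight k p" for p
    using good_lists[OF k that] by (simp add: TR)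
  have R: "R (p, \<kappa>) \<longleftrightarrow> needs p \<kappa>" if "is_weight k p" for p \<kappa>
    using good_lists(3)[OF k that, of \<kappa>] by (simp add: TR needs_def)
  define A where "A = val (ad_table vs es)"
  have FW: "val (partial_graph k vs A) = (sdg_list, table ?E)"
    using val_partial_graph(1) by (simp add: sdg_list_def A_def prod_eq_iff)
  have lf: "val (for_each xs (\<lambda>_ m. ret (Suc m)) m) = length xs + m" for xs :: "(nat \<times> nat) list" and m
    by (induction xs arbitrary: m) simp_all
  define c where "c = val (count_witnesses k vs sdg_list (table ?E))"
  have c: "c ((a, b), \<kappa>) = cnt ?E a b \<kappa>" if "(a, b) \<in> set sdg_list" for a b \<kappa>
    using val_count_witnesses[OF val_partial_graph(3)] that by (simp add: c_def)
  define Q where "Q = val (failing_edges k T sdg_list (table ?E) c)"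
  have i: "loop_inv ?E c Q" unfolding Q_def by (rule loop_inv_init) (use T c in blast)+
  have lQ: "length Q \<le> length sdg_list" by (simp add: Q_def val_failing_edges)
  define M where "M = main_loop k R vs (length sdg_list) Q (table ?E) c []"
  have v: "val (algorithm k n es) = val M"
    unfolding algorithm_def bind_simps vs_def[symmetric] TR prod.case A_def[symmetric] FW lf
      c_def[symmetric] Q_def[symmetric] M_def by simp
  have t: "time (algorithm k n es) = time (good_triples k) + (time (non_isolated n es) + (time (ad_table vs es) +
      (time (partial_graph k vs A) + (time (for_each sdg_list (\<lambda>_ m. ret (Suc m)) (0::nat)) +
      (time (count_witnesses k vs sdg_list (table ?E)) +
      (time (failing_edges k T sdg_list (table ?E) c) + time M))))))"
    unfolding algorithm_def bind_simps vs_def[symmetric] TR prod.case A_def[symmetric] FW lf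
      c_def[symmetric] Q_def[symmetric] M_def by simp
  from main_loop[OF R i card_sdg[symmetric], of "[]"] obtain ls where
    ls: "fst (val M) = rev ls" "run_from k B ?E (map (\<lambda>(x, y). {x, y}) ls) (map_option edges_of (snd (val M)))"
    and tM: "time M \<le> length Q + length sdg_list * (3 * length vs + 5) + 1"
    unfolding M_def by auto
  have "removed_edges (val M) = map (\<lambda>(x, y). {x, y}) ls"
    unfolding removed_edges_def ls(1) by (simp add: rev_map)
  moreover have "outcome (val M) = map_option edges_of (snd (val M))"
    unfolding outcome_def edges_of_def ..
  ultimately show "algorithm_run k B (removed_edges (val (algorithm k n es))) (outcome (val (algorithm k n es)))"
    unfolding v algorithm_run_def using ls(2) by simp
  have t5: "time (for_each sdg_list (\<lambda>_ m. ret (Suc m)) (0::nat)) \<le> length sdg_list * 1 + 1"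
    by (intro time_for_each) simp
  have t7: "time (failing_edges k T sdg_list (table ?E) c) \<le> length sdg_list * (8 * length vs + 3) + 1"
    by (rule time_failing_edges[OF T c])
  show "time (algorithm k n es) \<le>
      (2 * k * (2 * k * (2 * k * 1 + 1) + 1) + 1) + (length es + n + 2) +
      (length vs * ((length es * (length es * 1 + 1) + 1) + (length vs * 1 + 1)) + 1) +
      (length vs * (length vs * 1 + 1) + 1) + (length sdg_list * 1 + 1) +
      (length sdg_list * (length vs * 1 + 1) + 1) + (length sdg_list * (8 * length vs + 3) + 1) +
      (length sdg_list + length sdg_list * (3 * length vs + 5) + 1)"
    unfolding t
    using time_good_triples[of k] non_isolated(3)[of n es] time_ad_table time_partial_graph[of A] t5
      time_count_witnesses[of sdg_list "table ?E"] t7 tM lQ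
    by linarith
qed

end

text \<open>The variables are \<open>2k\<close>, the numbers of edges, of vertices and of vertices that are not isolated, and the
  number of pairs in the initial partial signed distance graph.  After expansion every summand is a
  product of at most three factors, which are bounded by \<open>2m\<close>, \<open>2m\<close> and \<open>n\<close>; the constant is crude.\<close>

lemma cost_bound:
  fixes K m n v F :: nat
  assumes "K \<le> 2 * m" "K \<le> n" "v \<le> n" "v \<le> 2 * m" "F \<le> v * v" "1 \<le> m" "1 \<le> n"
  shows "(K * (K * (K * 1 + 1) + 1) + 1) + (m + n + 2) + (v * ((m * (m * 1 + 1) + 1) + (v * 1 + 1)) + 1) +
      (v * (v * 1 + 1) + 1) + (F * 1 + 1) + (F * (v * 1 + 1) + 1) + (F * (8 * v + 3) + 1) +
      (F + F * (3 * v + 5) + 1) \<le> 100 * (m ^ 2 * n)"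
proof -
  define X where "X = m * m * n"
  have mm: "m \<le> m * m" "1 \<le> m * m" using assms by auto
  have X1: "1 \<le> X" "m \<le> X" "n \<le> X" "m * m \<le> X" "m * n \<le> X"
    using mult_le_mono[OF mm(2) assms(7)] mult_le_mono[OF mm(1) assms(7)] mult_le_mono[OF mm(2) order_refl[of n]]
      mult_le_mono[OF order_refl[of "m * m"] assms(7)] mult_le_mono[OF mm(1) order_refl[of n]]
    by (simp_all add: X_def)
  have K: "K * K * K \<le> 4 * X" "K * K \<le> 4 * X" "K \<le> 2 * X"
  proof -
    have "K * K \<le> (2 * m) * (2 * m)" by (intro mult_le_mono assms)
    then have KK: "K * K \<le> 4 * (m * m)" by simp
    then have "K * K * K \<le> 4 * (m * m) * n" by (rule mult_le_mono[OF _ assms(2)])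
    then show "K * K * K \<le> 4 * X" by (simp add: X_def)
    show "K * K \<le> 4 * X" using KK X1 by linarith
    show "K \<le> 2 * X" using assms X1 by linarith
  qed
  have v: "v * v * v \<le> 4 * X" "v * v \<le> 2 * X" "v \<le> X" "v * (m * m) \<le> X" "v * m \<le> X"
  proof -
    have "v * v * v \<le> (2 * m) * (2 * m) * n" by (intro mult_le_mono assms)
    then show "v * v * v \<le> 4 * X" by (simp add: X_def)
    have "v * v \<le> 2 * m * n" by (intro mult_le_mono assms)
    then show "v * v \<le> 2 * X" using X1 by simp
    show "v \<le> X" using assms X1 by linarith
    have "v * (m * m) \<le> n * (m * m)" by (intro mult_le_mono assms order_refl)
    then show "v * (m * m) \<le> X" by (simp add: X_def mult.commute)
    have "v * m \<le> n * m" by (intro mult_le_mono assms order_refl)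
    then show "v * m \<le> X" unfolding mult.commute[of n m] using X1(5) by (rule order_trans)
  qed
  have F: "F \<le> 2 * X" "F * v \<le> 4 * X"
  proof -
    show "F \<le> 2 * X" using assms(5) v by linarith
    have "F * v \<le> v * v * v" by (rule mult_le_mono[OF assms(5) order_refl])
    then show "F * v \<le> 4 * X" using v by linarith
  qed
  have "(K * (K * (K * 1 + 1) + 1) + 1) + (m + n + 2) + (v * ((m * (m * 1 + 1) + 1) + (v * 1 + 1)) + 1) +
      (v * (v * 1 + 1) + 1) + (F * 1 + 1) + (F * (v * 1 + 1) + 1) + (F * (8 * v + 3) + 1) +
      (F + F * (3 * v + 5) + 1) =
    K * K * K + K * K + K + m + n + v * (m * m) + v * m + 3 * v + 2 * (v * v) + 11 * F + 12 * (F * v) + 9"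
    by (simp add: algebra_simps)
  also have "\<dots> \<le> 100 * X" using K X1 v F by linarith
  finally show ?thesis by (simp add: X_def power2_eq_square)
qed

text \<open>An unbalanced cycle of length \<open>2k\<close> exists, as the unbalanced-girth is finite.\<close>

lemma unbalanced_cycle_size:
  assumes B: "signed_graph B" and g: "unbalanced_girth B = enat (2 * k)" and n: "verts B = {..<n}"
  shows "2 \<le> k" "2 * k \<le> n" "2 * k \<le> card (edges B) + 1"
proof -
  obtain c where c: "cycle B c" "walk_length c = 2 * k" using unbalanced_girth_attained[OF g] by metis
  have w: "walk B c" "3 \<le> walk_length c" "distinct (tl c)"
    using c(1) by (auto simp: cycle_def closed_walk_def)
  show "2 \<le> k" using w(2) c(2) by simp
  obtain h y t where ct: "c = h # y # t" using w(2) by (cases c; cases "tl c") (auto simp: walk_length_eq)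
  then have wt: "walk B (tl c)" "length (tl c) = 2 * k" using w(1) c(2) by (simp_all add: walk_length_eq)
  have "set (tl c) \<subseteq> {..<n}" using wt(1) n by (simp add: walk_def)
  then have "card (set (tl c)) \<le> n" using card_mono[of "{..<n}" "set (tl c)"] by simp
  then show "2 * k \<le> n" using distinct_card[OF w(3)] wt(2) by simp
  \<comment> \<open>Without one edge the cycle is a path, which is enough for this bound.\<close>
  show "2 * k \<le> card (edges B) + 1"
    using distinct_walk_length[OF B wt(1) w(3)] wt(2) unfolding walk_length_eq by simp
qed

lemma card_edges_le:
  assumes "signed_graph B" "verts B = {..<n}"
  shows "card (edges B) \<le> n ^ 2"
proof -
  have "edges B \<subseteq> (\<lambda>(x, y). {x, y}) ` ({..<n} \<times> {..<n})"
    using assms unfolding signed_graph_def by fastforce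
  then have "card (edges B) \<le> card ((\<lambda>(x, y). {x, y}) ` ({..<n} \<times> {..<n}))" by (intro card_mono) auto
  also have "\<dots> \<le> card ({..<n} \<times> {..<n})" by (intro card_image_le) auto
  finally show ?thesis by (simp add: power2_eq_square)
qed

theorem theorem5p1:
  shows "\<exists>C::nat. \<forall>(k::nat) (n::nat) (m::nat) (B::nat sgraph) (es::edge_list).
    signed_bipartite B \<and> unbalanced_girth B = enat (2 * k) \<and>
    verts B = {..<n} \<and> m = card (edges B) \<and> is_edge_list B es \<longrightarrow>
      (\<forall>rs out. algorithm_run k B rs out \<longrightarrow> (out \<noteq> None \<longleftrightarrow> bounds k B)) \<and>
      (let comp = algorithm k n es in
         algorithm_run k B (removed_edges (val comp)) (outcome (val comp)) \<and>
         time comp \<le> C * (m ^ 2 * n) \<and>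
         time comp \<le> C * n ^ 5)"
proof (rule exI[of _ 100], intro allI impI)
  fix k n m :: nat and B :: "nat sgraph" and es :: edge_list
  assume A: "signed_bipartite B \<and> unbalanced_girth B = enat (2 * k) \<and>
    verts B = {..<n} \<and> m = card (edges B) \<and> is_edge_list B es"
  then have B: "signed_graph B" and g: "unbalanced_girth B = enat (2 * k)" and n: "verts B = {..<n}"
    and m: "m = card (edges B)" and es: "is_edge_list B es"
    by (simp_all add: signed_bipartite_def)
  note size = unbalanced_cycle_size[OF B g n]
  interpret impl k n B es by unfold_locales (fact B size(1) n es)+
  have run: "out \<noteq> None \<longleftrightarrow> bounds k B" if "algorithm_run k B rs out" for rs out
    by (rule algorithm_run_correct[OF B _ size(1) that]) (simp add: g)
  have m1: "1 \<le> m" "2 * k \<le> 2 * m" using size m by auto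
  have n1: "1 \<le> n" using size by simp
  have le: "length es = m" using length_es m by simp
  have "length sdg_list \<le> length vs * length vs" by (rule val_partial_graph(4))
  from cost_bound[OF m1(2) size(2) length_vs(1) length_vs(2)[folded m] this m1(1) n1]
  have time: "time (algorithm k n es) \<le> 100 * (m ^ 2 * n)"
    using algorithm_result(2) unfolding le by linarith
  have "m ^ 2 * n \<le> (n ^ 2) ^ 2 * n"
    using card_edges_le[OF B n] m by (intro mult_le_mono power_mono) simp_all
  also have "\<dots> = n ^ 5" by (simp add: power_mult[symmetric] eval_nat_numeral)
  finally have "time (algorithm k n es) \<le> 100 * n ^ 5" using time by linarith
  then show "(\<forall>rs out. algorithm_run k B rs out \<longrightarrow> (out \<noteq> None \<longleftrightarrow> bounds k B)) \<and>
      (let comp = algorithm k n es in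
         algorithm_run k B (removed_edges (val comp)) (outcome (val comp)) \<and>
         time comp \<le> 100 * (m ^ 2 * n) \<and>
         time comp \<le> 100 * n ^ 5)"
    using run time algorithm_result(1) unfolding Let_def by blast
qed

end
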